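(* Let $\Lambda$ be an artin algebra and let $T$ be a basic classical tilting $\Lambda$-module (so $T$ has projective dimension at most $1$). Then $T$ is $\mathrm{gen}_1$-critical. If in addition $\Lambda$ is hereditary, then $T$ is minimal faithfully balanced.
   Context: All modules are finitely generated left modules. A module is basic if its indecomposable summands occur with multiplicity one. A classical tilting module is a module $T$ with projective dimension $\le1$, $\mathrm{Ext}^1_\Lambda(T,T)=0$, and an exact sequence $0\to\Lambda\to T_0\to T_1\to0$ with $T_0,T_1\in\mathrm{add}(T)$, where $\mathrm{add}(T)$ consists of the direct summands of finite direct sums of copies of $T$. $\mathrm{gen}_1(M)$ is the full subcategory of modules $X$ for which there is an exact sequence $M''\to M'\to X\to0$ with $M',M''\in\mathrm{add}(M)$ such that $\mathrm{Hom}(M,M'')\to\mathrm{Hom}(M,M')\to\mathrm{Hom}(M,X)\to0$ is exact. $M$ is $\mathrm{gen}_1$-critical if every proper direct summand $N$ of $M$ satisfies $\mathrm{gen}_1(N)\neq\mathrm{gen}_1(M)$. $M$ is faithfully balanced if the natural map $\Lambda\to\mathrm{End}_E(M)$, $E=\mathrm{End}_\Lambda(M)$, is bijective. $M$ is minimal faithfully balanced if it is faithfully balanced and no proper direct summand of $M$ is faithfully balanced. *)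

theory Defs
  imports "HOL-Algebra.Module" "HOL-Algebra.RingHom" "HOL-Algebra.Elementary_Groups"
begin

section \<open>Left modules over a ring that need not be commutative\<close>

text \<open>The locale \<^locale>\<open>module\<close> of the library requires a commutative ring of scalars; the
  record type and the notion \<^locale>\<open>submodule\<close> do not, and are reused here. The fields
  \<^const>\<open>monoid.mult\<close> and \<^const>\<open>one\<close> of a module record carry no meaning.\<close>

locale left_module = R?: ring R + M?: abelian_group M
  for R :: "('a, 'r) ring_scheme" (structure) and M :: "('a, 'm) module" (structure) +
  assumes smult_closed [simp, intro]:
      "\<lbrakk>a \<in> carrier R; x \<in> carrier M\<rbrakk> \<Longrightarrow> a \<odot>\<^bsub>M\<^esub> x \<in> carrier M"
    and smult_l_distr:
      "\<lbrakk>a \<in> carrier R; b \<in> carrier R; x \<in> carrier M\<rbrakk>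
       \<Longrightarrow> (a \<oplus> b) \<odot>\<^bsub>M\<^esub> x = a \<odot>\<^bsub>M\<^esub> x \<oplus>\<^bsub>M\<^esub> b \<odot>\<^bsub>M\<^esub> x"
    and smult_r_distr:
      "\<lbrakk>a \<in> carrier R; x \<in> carrier M; y \<in> carrier M\<rbrakk>
       \<Longrightarrow> a \<odot>\<^bsub>M\<^esub> (x \<oplus>\<^bsub>M\<^esub> y) = a \<odot>\<^bsub>M\<^esub> x \<oplus>\<^bsub>M\<^esub> a \<odot>\<^bsub>M\<^esub> y"
    and smult_assoc1:
      "\<lbrakk>a \<in> carrier R; b \<in> carrier R; x \<in> carrier M\<rbrakk>
       \<Longrightarrow> (a \<otimes> b) \<odot>\<^bsub>M\<^esub> x = a \<odot>\<^bsub>M\<^esub> (b \<odot>\<^bsub>M\<^esub> x)"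
    and smult_one [simp]:
      "x \<in> carrier M \<Longrightarrow> \<one> \<odot>\<^bsub>M\<^esub> x = x"

definition finitely_generated :: "('a, 'r) ring_scheme \<Rightarrow> ('a, 'm) module \<Rightarrow> bool" where
  "finitely_generated R M \<longleftrightarrow>
     (\<exists>S. finite S \<and> S \<subseteq> carrier M \<and> (\<forall>H. submodule H R M \<and> S \<subseteq> H \<longrightarrow> H = carrier M))"

definition fg_module :: "('a, 'r) ring_scheme \<Rightarrow> ('a, 'm) module \<Rightarrow> bool" where
  "fg_module R M \<longleftrightarrow> left_module R M \<and> finitely_generated R M"

text \<open>Module homomorphisms are extensional functions, so that equality of homomorphisms is
  equality of functions.\<close>

definition mod_hom ::
  "('a, 'r) ring_scheme \<Rightarrow> ('a, 'm) module \<Rightarrow> ('a, 'n) module \<Rightarrow> ('m \<Rightarrow> 'n) set" where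
  "mod_hom R M N = {f \<in> carrier M \<rightarrow>\<^sub>E carrier N.
     (\<forall>x\<in>carrier M. \<forall>y\<in>carrier M. f (x \<oplus>\<^bsub>M\<^esub> y) = f x \<oplus>\<^bsub>N\<^esub> f y) \<and>
     (\<forall>r\<in>carrier R. \<forall>x\<in>carrier M. f (r \<odot>\<^bsub>M\<^esub> x) = r \<odot>\<^bsub>N\<^esub> f x)}"

definition mod_isomorphic ::
  "('a, 'r) ring_scheme \<Rightarrow> ('a, 'm) module \<Rightarrow> ('a, 'n) module \<Rightarrow> bool" where
  "mod_isomorphic R M N \<longleftrightarrow> (\<exists>f\<in>mod_hom R M N. bij_betw f (carrier M) (carrier N))"

definition hom_group ::
  "('a, 'r) ring_scheme \<Rightarrow> ('a, 'm) module \<Rightarrow> ('a, 'n) module \<Rightarrow> ('m \<Rightarrow> 'n) monoid" where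
  "hom_group R M N =
     \<lparr>carrier = mod_hom R M N,
      monoid.mult = (\<lambda>f g. \<lambda>x\<in>carrier M. f x \<oplus>\<^bsub>N\<^esub> g x),
      one = (\<lambda>x\<in>carrier M. \<zero>\<^bsub>N\<^esub>)\<rparr>"

definition short_exact ::
  "('a, 'r) ring_scheme \<Rightarrow> ('a, 'l) module \<Rightarrow> ('l \<Rightarrow> 'm) \<Rightarrow> ('a, 'm) module
    \<Rightarrow> ('m \<Rightarrow> 'n) \<Rightarrow> ('a, 'n) module \<Rightarrow> bool" where
  "short_exact R L f M g N \<longleftrightarrow>
     f \<in> mod_hom R L M \<and> g \<in> mod_hom R M N \<and>
     inj_on f (carrier L) \<and> f ` carrier L = a_kernel M N g \<and> g ` carrier M = carrier N"


section \<open>Direct sums and direct summands\<close>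

abbreviation sub_module :: "('a, 'm) module \<Rightarrow> 'm set \<Rightarrow> ('a, 'm) module" where
  "sub_module M H \<equiv> M\<lparr>carrier := H\<rparr>"

definition direct_summand :: "('a, 'r) ring_scheme \<Rightarrow> 'm set \<Rightarrow> ('a, 'm) module \<Rightarrow> bool" where
  "direct_summand R H M \<longleftrightarrow> submodule H R M \<and>
     (\<exists>K. submodule K R M \<and> H \<inter> K = {\<zero>\<^bsub>M\<^esub>} \<and> H <+>\<^bsub>M\<^esub> K = carrier M)"

definition proper_direct_summand ::
  "('a, 'r) ring_scheme \<Rightarrow> 'm set \<Rightarrow> ('a, 'm) module \<Rightarrow> bool" where
  "proper_direct_summand R H M \<longleftrightarrow> direct_summand R H M \<and> H \<noteq> carrier M"

definition indecomposable :: "('a, 'r) ring_scheme \<Rightarrow> ('a, 'm) module \<Rightarrow> bool" where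
  "indecomposable R M \<longleftrightarrow> carrier M \<noteq> {\<zero>\<^bsub>M\<^esub>} \<and>
     (\<forall>H. direct_summand R H M \<longrightarrow> H = {\<zero>\<^bsub>M\<^esub>} \<or> H = carrier M)"

definition direct_decomposition ::
  "('a, 'r) ring_scheme \<Rightarrow> ('a, 'm) module \<Rightarrow> nat \<Rightarrow> (nat \<Rightarrow> 'm set) \<Rightarrow> bool" where
  "direct_decomposition R M n H \<longleftrightarrow> (\<forall>i<n. submodule (H i) R M) \<and>
     (\<forall>x\<in>carrier M. \<exists>!f. f \<in> (\<Pi>\<^sub>E i\<in>{..<n}. H i) \<and> finsum M f {..<n} = x)"

text \<open>By the Krull-Schmidt theorem a finitely generated module over an artin algebra has a
  decomposition into indecomposable modules, and any two of them agree up to isomorphism and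
  order, so it does not matter that all decompositions are considered.\<close>

definition basic :: "('a, 'r) ring_scheme \<Rightarrow> ('a, 'm) module \<Rightarrow> bool" where
  "basic R M \<longleftrightarrow>
     (\<forall>n H. direct_decomposition R M n H \<and> (\<forall>i<n. indecomposable R (sub_module M (H i))) \<longrightarrow>
       (\<forall>i<n. \<forall>j<n. i \<noteq> j \<longrightarrow> \<not> mod_isomorphic R (sub_module M (H i)) (sub_module M (H j))))"

definition power_module :: "('a, 'm) module \<Rightarrow> nat \<Rightarrow> ('a, nat \<Rightarrow> 'm) module" where
  "power_module M n =
     \<lparr>carrier = {..<n} \<rightarrow>\<^sub>E carrier M, monoid.mult = undefined, one = undefined,
      ring.zero = (\<lambda>i\<in>{..<n}. \<zero>\<^bsub>M\<^esub>),
      ring.add = (\<lambda>u v. \<lambda>i\<in>{..<n}. u i \<oplus>\<^bsub>M\<^esub> v i),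
      smult = (\<lambda>r u. \<lambda>i\<in>{..<n}. r \<odot>\<^bsub>M\<^esub> u i)\<rparr>"

definition add_subcat ::
  "('a, 'r) ring_scheme \<Rightarrow> ('a, 'm) module \<Rightarrow> ('a, 'x) module set" where
  "add_subcat R M = {X. left_module R X \<and>
     (\<exists>n H. direct_summand R H (power_module M n) \<and>
            mod_isomorphic R X (sub_module (power_module M n) H))}"


section \<open>Artin algebras, projective modules, hereditary rings\<close>

definition artinian_cring :: "('k, 's) ring_scheme \<Rightarrow> bool" where
  "artinian_cring k \<longleftrightarrow> cring k \<and>
     (\<forall>I :: nat \<Rightarrow> 'k set. (\<forall>n. ideal (I n) k) \<and> (\<forall>n. I (Suc n) \<subseteq> I n) \<longrightarrow>
        (\<exists>m. \<forall>n\<ge>m. I n = I m))"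

definition scalar_module ::
  "('k \<Rightarrow> 'a) \<Rightarrow> ('a, 'r) ring_scheme \<Rightarrow> ('k, 'a) module" where
  "scalar_module \<phi> R =
     \<lparr>carrier = carrier R, monoid.mult = monoid.mult R, one = one R, ring.zero = ring.zero R, ring.add = ring.add R,
      smult = (\<lambda>c x. \<phi> c \<otimes>\<^bsub>R\<^esub> x)\<rparr>"

definition artin_algebra ::
  "('k, 's) ring_scheme \<Rightarrow> ('k \<Rightarrow> 'a) \<Rightarrow> ('a, 'r) ring_scheme \<Rightarrow> bool" where
  "artin_algebra k \<phi> R \<longleftrightarrow> artinian_cring k \<and> ring R \<and> \<phi> \<in> ring_hom k R \<and>
     (\<forall>c\<in>carrier k. \<forall>x\<in>carrier R. \<phi> c \<otimes>\<^bsub>R\<^esub> x = x \<otimes>\<^bsub>R\<^esub> \<phi> c) \<and>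
     finitely_generated k (scalar_module \<phi> R)"

definition regular_module :: "('a, 'r) ring_scheme \<Rightarrow> ('a, 'a) module" where
  "regular_module R = scalar_module (\<lambda>r. r) R"

text \<open>Finitely generated projective modules: direct summands of free modules of finite rank.\<close>

definition fg_projective :: "('a, 'r) ring_scheme \<Rightarrow> ('a, 'm) module \<Rightarrow> bool" where
  "fg_projective R P \<longleftrightarrow> P \<in> add_subcat R (regular_module R)"

text \<open>The submodules of the regular module are the left ideals.\<close>

definition hereditary :: "('a, 'r) ring_scheme \<Rightarrow> bool" where
  "hereditary R \<longleftrightarrow>
     (\<forall>I. submodule I R (regular_module R) \<longrightarrow> fg_projective R (sub_module (regular_module R) I))"

text \<open>Up to isomorphism every finitely generated projective module has its elements in the type
  \<^typ>\<open>nat \<Rightarrow> 'a\<close>, so fixing this type loses no projective resolutions.\<close>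

definition proj_dim_le_1 :: "('a, 'r) ring_scheme \<Rightarrow> ('a, 'm) module \<Rightarrow> bool" where
  "proj_dim_le_1 R M \<longleftrightarrow>
     (\<exists>(P1 :: ('a, nat \<Rightarrow> 'a) module) (P0 :: ('a, nat \<Rightarrow> 'a) module) f g.
        fg_projective R P1 \<and> fg_projective R P0 \<and> short_exact R P1 f P0 g M)"


section \<open>The group $\mathrm{Ext}^1$\<close>

text \<open>The first extension group of \<open>M\<close> by \<open>N\<close>, computed from the canonical free presentation
  \<open>0 \<rightarrow> \<Omega> \<rightarrow> F \<rightarrow> M \<rightarrow> 0\<close> with \<open>F\<close> free on the set of elements of \<open>M\<close>: it is the cokernel of the
  restriction map from \<open>Hom(F, N)\<close> to \<open>Hom(\<Omega>, N)\<close>.\<close>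

definition free_cover :: "('a, 'r) ring_scheme \<Rightarrow> ('a, 'm) module \<Rightarrow> ('a, 'm \<Rightarrow> 'a) module" where
  "free_cover R M =
     \<lparr>carrier = {u \<in> carrier M \<rightarrow>\<^sub>E carrier R. finite {x \<in> carrier M. u x \<noteq> \<zero>\<^bsub>R\<^esub>}},
      monoid.mult = undefined, one = undefined,
      ring.zero = (\<lambda>x\<in>carrier M. \<zero>\<^bsub>R\<^esub>),
      ring.add = (\<lambda>u v. \<lambda>x\<in>carrier M. u x \<oplus>\<^bsub>R\<^esub> v x),
      smult = (\<lambda>r u. \<lambda>x\<in>carrier M. r \<otimes>\<^bsub>R\<^esub> u x)\<rparr>"

definition free_cover_map :: "('a, 'r) ring_scheme \<Rightarrow> ('a, 'm) module \<Rightarrow> ('m \<Rightarrow> 'a) \<Rightarrow> 'm" where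
  "free_cover_map R M =
     (\<lambda>u\<in>carrier (free_cover R M).
        \<Oplus>\<^bsub>M\<^esub>x\<in>{x \<in> carrier M. u x \<noteq> \<zero>\<^bsub>R\<^esub>}. u x \<odot>\<^bsub>M\<^esub> x)"

definition syzygy :: "('a, 'r) ring_scheme \<Rightarrow> ('a, 'm) module \<Rightarrow> ('a, 'm \<Rightarrow> 'a) module" where
  "syzygy R M =
     sub_module (free_cover R M) (a_kernel (free_cover R M) M (free_cover_map R M))"

definition Ext1 ::
  "('a, 'r) ring_scheme \<Rightarrow> ('a, 'm) module \<Rightarrow> ('a, 'n) module
    \<Rightarrow> (('m \<Rightarrow> 'a) \<Rightarrow> 'n) set monoid" where
  "Ext1 R M N = hom_group R (syzygy R M) N Mod
     ((\<lambda>h. restrict h (carrier (syzygy R M))) ` mod_hom R (free_cover R M) N)"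


section \<open>Classical tilting modules\<close>

text \<open>Up to isomorphism every module in the additive closure of \<open>T\<close> has its elements in the type
  \<^typ>\<open>nat \<Rightarrow> 'm\<close>.\<close>

definition classical_tilting :: "('a, 'r) ring_scheme \<Rightarrow> ('a, 'm) module \<Rightarrow> bool" where
  "classical_tilting R T \<longleftrightarrow> fg_module R T \<and> proj_dim_le_1 R T \<and> trivial_group (Ext1 R T T) \<and>
     (\<exists>(T0 :: ('a, nat \<Rightarrow> 'm) module) (T1 :: ('a, nat \<Rightarrow> 'm) module) f g.
        T0 \<in> add_subcat R T \<and> T1 \<in> add_subcat R T \<and>
        short_exact R (regular_module R) f T0 g T1)"


section \<open>The subcategory $\mathrm{gen}_1$\<close>

definition gen1 :: "('a, 'r) ring_scheme \<Rightarrow> ('a, 'm) module \<Rightarrow> ('a, 'x) module set" where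
  "gen1 R M = {X. fg_module R X \<and>
     (\<exists>(M2 :: ('a, nat \<Rightarrow> 'm) module) (M1 :: ('a, nat \<Rightarrow> 'm) module) f g.
        M2 \<in> add_subcat R M \<and> M1 \<in> add_subcat R M \<and>
        f \<in> mod_hom R M2 M1 \<and> g \<in> mod_hom R M1 X \<and>
        f ` carrier M2 = a_kernel M1 X g \<and> g ` carrier M1 = carrier X \<and>
        compose (carrier M) f ` mod_hom R M M2
          = {h \<in> mod_hom R M M1. compose (carrier M) g h = (\<lambda>x\<in>carrier M. \<zero>\<^bsub>X\<^esub>)} \<and>
        compose (carrier M) g ` mod_hom R M M1 = mod_hom R M X)}"

text \<open>Every finitely generated module is isomorphic to a quotient of a free module of finite rank,
  whose elements are cosets, that is, of type \<^typ>\<open>(nat \<Rightarrow> 'a) set\<close>. Hence the modules with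
  elements of this type represent all isomorphism classes, and two isomorphism-closed classes of
  finitely generated modules are equal if they have the same members of this type.\<close>

definition gen1_critical :: "('a, 'r) ring_scheme \<Rightarrow> ('a, 'm) module \<Rightarrow> bool" where
  "gen1_critical R M \<longleftrightarrow>
     (\<forall>N. proper_direct_summand R N M \<longrightarrow>
        (gen1 R (sub_module M N) :: ('a, (nat \<Rightarrow> 'a) set) module set) \<noteq> gen1 R M)"


section \<open>Faithfully balanced modules\<close>

definition endo_ring :: "('a, 'r) ring_scheme \<Rightarrow> ('a, 'm) module \<Rightarrow> ('m \<Rightarrow> 'm) ring" where
  "endo_ring R M =
     \<lparr>carrier = mod_hom R M M,
      monoid.mult = compose (carrier M), one = (\<lambda>x\<in>carrier M. x),
      ring.zero = (\<lambda>x\<in>carrier M. \<zero>\<^bsub>M\<^esub>),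
      ring.add = (\<lambda>f g. \<lambda>x\<in>carrier M. f x \<oplus>\<^bsub>M\<^esub> g x)\<rparr>"

definition endo_module :: "('a, 'm) module \<Rightarrow> ('m \<Rightarrow> 'm, 'm) module" where
  "endo_module M =
     \<lparr>carrier = carrier M, monoid.mult = monoid.mult M, one = one M, ring.zero = ring.zero M, ring.add = ring.add M,
      smult = (\<lambda>f x. f x)\<rparr>"

definition faithfully_balanced :: "('a, 'r) ring_scheme \<Rightarrow> ('a, 'm) module \<Rightarrow> bool" where
  "faithfully_balanced R M \<longleftrightarrow>
     bij_betw (\<lambda>r. \<lambda>x\<in>carrier M. r \<odot>\<^bsub>M\<^esub> x) (carrier R)
       (mod_hom (endo_ring R M) (endo_module M) (endo_module M))"

definition minimal_faithfully_balanced ::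
  "('a, 'r) ring_scheme \<Rightarrow> ('a, 'm) module \<Rightarrow> bool" where
  "minimal_faithfully_balanced R M \<longleftrightarrow> faithfully_balanced R M \<and>
     (\<forall>N. proper_direct_summand R N M \<longrightarrow> \<not> faithfully_balanced R (sub_module M N))"

end

theory Submission
  imports Defs
begin

text \<open>Let \<open>N\<close> be a proper direct summand of \<open>T\<close>. As \<open>T\<close> is basic, the Krull-Schmidt theorem shows that \<open>T\<close> is
  not in \<open>add(N)\<close>, so each of the two claims follows once its failure puts \<open>T\<close> into \<open>add(N)\<close>. As \<open>T\<close> has
  projective dimension at most one, \<open>Ext\<^sup>1(T,K) = 0\<close> for every \<open>K\<close> generated by \<open>T\<close>. Hence a surjection
  from a module in \<open>add(N)\<close> to \<open>T\<close> splits if its kernel is generated by \<open>N\<close>.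

  If \<open>gen\<^sub>1(N) = gen\<^sub>1(T)\<close>, such a surjection exists because \<open>T\<close> lies in \<open>gen\<^sub>1(N)\<close>.

  If \<open>\<Lambda>\<close> is hereditary and \<open>N\<close> is faithfully balanced, there is an exact sequence \<open>0 \<rightarrow> \<Lambda> \<rightarrow> N\<^sup>m \<rightarrow> N\<^sup>s\<close>
  of left \<open>add(N)\<close>-approximations. Right exactness of \<open>Ext\<^sup>1\<close> makes the image \<open>D\<close> of the second map a
  summand of \<open>N\<^sup>s\<close>, so \<open>N\<close> generates every module \<open>Y\<close> with \<open>Ext\<^sup>1(N,Y) = 0\<close>. This applies to \<open>T\<close> and to
  the kernel of a right \<open>add(N)\<close>-approximation of \<open>T\<close>.

  \<open>T\<close> itself is faithfully balanced by the sequence \<open>0 \<rightarrow> \<Lambda> \<rightarrow> T\<^sub>0 \<rightarrow> T\<^sub>1 \<rightarrow> 0\<close>: a map \<open>\<psi>\<close> commuting with all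
  endomorphisms of \<open>T\<close> acts naturally on \<open>add(T)\<close>, and maps the image of \<open>1\<close> in \<open>T\<^sub>0\<close> into the kernel of
  \<open>T\<^sub>0 \<rightarrow> T\<^sub>1\<close>.\<close>

section \<open>Linear maps and submodules\<close>

text \<open>\<open>Ext1\<close> refers to one fixed free presentation, on all elements of the
  module, and \<open>add_subcat\<close> to submodules of powers. Both are traded for statements
  about maps: vanishing of Ext becomes extension of maps from a kernel (\<open>ext_zero\<close>),
  membership in add(M) a retraction of a power (\<open>retract_of_power\<close>), and each exactness
  argument the explicit correction of one map by another. A surjection onto T splits because the
  identity of its kernel extends. Finiteness comes from k. Hom groups between finitely generated
  modules are artinian over k, hence finitely generated over k by
  \<open>artinian_finitely_generated\<close>; finite generating sets of Hom groups are what makes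
  the approximations by powers of N exist. Artinian Hom groups also give Fitting's lemma, and with
  it the one instance of Krull-Schmidt that is required: if T lay in add(N), an explicit
  decomposition of T would repeat a summand. \<open>gen1_critical\<close> compares modules with
  elements of type \<open>(nat \<Rightarrow> 'a) set\<close>, while T has its own type. So T enters
  as a copy whose points are the fibres of a free presentation of T.\<close>

context left_module
begin

lemma smult_l_null [simp]: "x \<in> carrier M \<Longrightarrow> \<zero> \<odot>\<^bsub>M\<^esub> x = \<zero>\<^bsub>M\<^esub>"
  using smult_l_distr[of \<zero> \<zero> x] by (simp add: M.add.l_cancel_one')

lemma smult_r_null [simp]: "a \<in> carrier R \<Longrightarrow> a \<odot>\<^bsub>M\<^esub> \<zero>\<^bsub>M\<^esub> = \<zero>\<^bsub>M\<^esub>"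
  using smult_r_distr[of a "\<zero>\<^bsub>M\<^esub>" "\<zero>\<^bsub>M\<^esub>"] by (simp add: M.add.l_cancel_one')

lemma smult_minus_one: "x \<in> carrier M \<Longrightarrow> (\<ominus> \<one>) \<odot>\<^bsub>M\<^esub> x = \<ominus>\<^bsub>M\<^esub> x"
  using smult_l_distr[of "\<ominus> \<one>" \<one> x] by (simp add: R.l_neg M.minus_equality)

lemma smult_r_minus:
  "\<lbrakk>a \<in> carrier R; x \<in> carrier M\<rbrakk> \<Longrightarrow> a \<odot>\<^bsub>M\<^esub> (\<ominus>\<^bsub>M\<^esub> x) = \<ominus>\<^bsub>M\<^esub> (a \<odot>\<^bsub>M\<^esub> x)"
  using smult_r_distr[of a "\<ominus>\<^bsub>M\<^esub> x" x] by (simp add: M.l_neg M.minus_equality)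

lemma diff_eq_zero_iff:
  "\<lbrakk>x \<in> carrier M; y \<in> carrier M\<rbrakk> \<Longrightarrow> x \<ominus>\<^bsub>M\<^esub> y = \<zero>\<^bsub>M\<^esub> \<longleftrightarrow> x = y"
  by (metis M.a_inv_closed M.minus_eq M.minus_equality M.minus_minus M.r_neg)

lemma add_diff_cancel_left: "\<lbrakk>x \<in> carrier M; y \<in> carrier M\<rbrakk> \<Longrightarrow> x \<oplus>\<^bsub>M\<^esub> y \<ominus>\<^bsub>M\<^esub> x = y"
  using M.a_comm[of x y] by (simp add: M.minus_eq M.a_assoc M.r_neg)

lemma add_diff_cancel_right: "\<lbrakk>x \<in> carrier M; y \<in> carrier M\<rbrakk> \<Longrightarrow> x \<oplus>\<^bsub>M\<^esub> y \<ominus>\<^bsub>M\<^esub> y = x"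
  by (simp add: M.minus_eq M.a_assoc M.r_neg)

lemma diff_zero: "x \<in> carrier M \<Longrightarrow> x \<ominus>\<^bsub>M\<^esub> \<zero>\<^bsub>M\<^esub> = x"
  using add_diff_cancel_right[of x "\<zero>\<^bsub>M\<^esub>"] by simp

lemma add_diff_eq: "\<lbrakk>x \<in> carrier M; y \<in> carrier M\<rbrakk> \<Longrightarrow> x \<oplus>\<^bsub>M\<^esub> (y \<ominus>\<^bsub>M\<^esub> x) = y"
  by (simp add: M.minus_eq M.a_lcomm[of x y] M.r_neg)

lemma diff_add_eq: "\<lbrakk>x \<in> carrier M; y \<in> carrier M\<rbrakk> \<Longrightarrow> (y \<ominus>\<^bsub>M\<^esub> x) \<oplus>\<^bsub>M\<^esub> x = y"
  by (simp add: M.minus_eq M.a_assoc M.l_neg)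

lemma diff_diff_cancel:
  "\<lbrakk>x \<in> carrier M; y \<in> carrier M; z \<in> carrier M\<rbrakk> \<Longrightarrow> (x \<ominus>\<^bsub>M\<^esub> y) \<ominus>\<^bsub>M\<^esub> (x \<ominus>\<^bsub>M\<^esub> z) = z \<ominus>\<^bsub>M\<^esub> y"
  by (simp add: M.minus_eq M.minus_add M.a_ac M.r_neg1 M.r_neg2)

lemma submoduleI:
  assumes "H \<subseteq> carrier M" "\<zero>\<^bsub>M\<^esub> \<in> H"
    and "\<And>x y. \<lbrakk>x \<in> H; y \<in> H\<rbrakk> \<Longrightarrow> x \<oplus>\<^bsub>M\<^esub> y \<in> H"
    and smult: "\<And>a x. \<lbrakk>a \<in> carrier R; x \<in> H\<rbrakk> \<Longrightarrow> a \<odot>\<^bsub>M\<^esub> x \<in> H"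
  shows "submodule H R M"
proof -
  have "\<ominus>\<^bsub>M\<^esub> x \<in> H" if "x \<in> H" for x
    using smult[of "\<ominus> \<one>" x] that assms(1) by (auto simp: smult_minus_one subset_iff)
  then show ?thesis
    using assms unfolding submodule_def subgroup_def submodule_axioms_def
    by (simp add: a_inv_def)
qed

end

text \<open>Additive inverses do not have to be exhibited: by \<open>distr\<close>,
  \<open>one\<close> and \<open>null\<close> the multiple of \<open>x\<close> by
  \<open>\<ominus> \<one>\<close> is an inverse of \<open>x\<close>.\<close>

lemma left_moduleI:
  fixes R (structure) and M (structure)
  assumes "ring R"
    and "\<And>x y. \<lbrakk>x \<in> carrier M; y \<in> carrier M\<rbrakk> \<Longrightarrow> x \<oplus>\<^bsub>M\<^esub> y \<in> carrier M"
    and "\<zero>\<^bsub>M\<^esub> \<in> carrier M"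
    and "\<And>x y z. \<lbrakk>x \<in> carrier M; y \<in> carrier M; z \<in> carrier M\<rbrakk>
      \<Longrightarrow> (x \<oplus>\<^bsub>M\<^esub> y) \<oplus>\<^bsub>M\<^esub> z = x \<oplus>\<^bsub>M\<^esub> (y \<oplus>\<^bsub>M\<^esub> z)"
    and "\<And>x y. \<lbrakk>x \<in> carrier M; y \<in> carrier M\<rbrakk> \<Longrightarrow> x \<oplus>\<^bsub>M\<^esub> y = y \<oplus>\<^bsub>M\<^esub> x"
    and "\<And>x. x \<in> carrier M \<Longrightarrow> \<zero>\<^bsub>M\<^esub> \<oplus>\<^bsub>M\<^esub> x = x"
    and "\<And>a x. \<lbrakk>a \<in> carrier R; x \<in> carrier M\<rbrakk> \<Longrightarrow> a \<odot>\<^bsub>M\<^esub> x \<in> carrier M"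
    and distr: "\<And>a b x. \<lbrakk>a \<in> carrier R; b \<in> carrier R; x \<in> carrier M\<rbrakk>
      \<Longrightarrow> (a \<oplus> b) \<odot>\<^bsub>M\<^esub> x = a \<odot>\<^bsub>M\<^esub> x \<oplus>\<^bsub>M\<^esub> b \<odot>\<^bsub>M\<^esub> x"
    and "\<And>a x y. \<lbrakk>a \<in> carrier R; x \<in> carrier M; y \<in> carrier M\<rbrakk>
      \<Longrightarrow> a \<odot>\<^bsub>M\<^esub> (x \<oplus>\<^bsub>M\<^esub> y) = a \<odot>\<^bsub>M\<^esub> x \<oplus>\<^bsub>M\<^esub> a \<odot>\<^bsub>M\<^esub> y"
    and "\<And>a b x. \<lbrakk>a \<in> carrier R; b \<in> carrier R; x \<in> carrier M\<rbrakk>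
      \<Longrightarrow> (a \<otimes> b) \<odot>\<^bsub>M\<^esub> x = a \<odot>\<^bsub>M\<^esub> (b \<odot>\<^bsub>M\<^esub> x)"
    and one: "\<And>x. x \<in> carrier M \<Longrightarrow> \<one> \<odot>\<^bsub>M\<^esub> x = x"
    and null: "\<And>x. x \<in> carrier M \<Longrightarrow> \<zero> \<odot>\<^bsub>M\<^esub> x = \<zero>\<^bsub>M\<^esub>"
  shows "left_module R M"
proof -
  interpret R: ring R by fact
  have "abelian_group M"
  proof (rule abelian_groupI)
    fix x assume x: "x \<in> carrier M"
    have "(\<ominus> \<one>) \<odot>\<^bsub>M\<^esub> x \<oplus>\<^bsub>M\<^esub> x = \<zero>\<^bsub>M\<^esub>"
      using distr[of "\<ominus> \<one>" \<one> x] x by (simp add: one null R.l_neg)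
    then show "\<exists>y\<in>carrier M. y \<oplus>\<^bsub>M\<^esub> x = \<zero>\<^bsub>M\<^esub>"
      using x assms(7)[of "\<ominus> \<one>" x] by auto
  qed (use assms in auto)
  then show ?thesis
    using assms by (intro left_module.intro left_module_axioms.intro) auto
qed

lemma left_module_ring: "left_module R M \<Longrightarrow> ring R"
  by (simp add: left_module_def)

lemma submodule_subset: "submodule H R M \<Longrightarrow> H \<subseteq> carrier M"
  by (auto simp: submodule_def subgroup_def)

lemma submodule_carrier: "\<lbrakk>submodule H R M; x \<in> H\<rbrakk> \<Longrightarrow> x \<in> carrier M"
  by (auto simp: submodule_def subgroup_def)

lemma submodule_zero: "submodule H R M \<Longrightarrow> \<zero>\<^bsub>M\<^esub> \<in> H"
  by (auto simp: submodule_def subgroup_def)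

lemma submodule_add: "\<lbrakk>submodule H R M; x \<in> H; y \<in> H\<rbrakk> \<Longrightarrow> x \<oplus>\<^bsub>M\<^esub> y \<in> H"
  by (auto simp: submodule_def subgroup_def)

lemma submodule_smult: "\<lbrakk>submodule H R M; a \<in> carrier R; x \<in> H\<rbrakk> \<Longrightarrow> a \<odot>\<^bsub>M\<^esub> x \<in> H"
  by (rule submodule.smult_closed)

lemma submodule_neg: "\<lbrakk>submodule H R M; x \<in> H\<rbrakk> \<Longrightarrow> \<ominus>\<^bsub>M\<^esub> x \<in> H"
  by (auto simp: submodule_def subgroup_def a_inv_def)

lemma submodule_diff: "\<lbrakk>submodule H R M; x \<in> H; y \<in> H\<rbrakk> \<Longrightarrow> x \<ominus>\<^bsub>M\<^esub> y \<in> H"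
  by (simp add: a_minus_def submodule_add submodule_neg)

lemma submodule_left_module:
  assumes "left_module R M" "submodule H R M"
  shows "left_module R (sub_module M H)"
proof -
  interpret left_module R M by fact
  show ?thesis
    by (rule left_moduleI)
      (simp_all add: submodule_add[OF assms(2)] submodule_zero[OF assms(2)] submodule_smult[OF assms(2)]
        submodule_carrier[OF assms(2)] R.ring_axioms smult_l_distr smult_r_distr smult_assoc1
        M.a_ac)
qed

lemma (in left_module) submodule_self: "submodule (carrier M) R M"
  by (rule submoduleI) auto

lemma (in left_module) submodule_zero_set: "submodule {\<zero>\<^bsub>M\<^esub>} R M"
  by (rule submoduleI) auto

lemma submodule_sub_module_iff:
  assumes "left_module R M" "submodule H R M"
  shows "submodule K R (sub_module M H) \<longleftrightarrow> submodule K R M \<and> K \<subseteq> H" (is "?l = ?r")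
proof -
  interpret M: left_module R M by fact
  interpret H: left_module R "sub_module M H" using assms by (rule submodule_left_module)
  show ?thesis
  proof
    assume l: ?l
    have "submodule K R M"
      by (rule M.submoduleI)
        (use submodule_subset[OF l] submodule_zero[OF l] submodule_add[OF l] submodule_smult[OF l]
          submodule_subset[OF assms(2)] in auto)
    then show ?r using submodule_subset[OF l] by simp
  next
    assume r: ?r
    then have r': "submodule K R M" by simp
    show ?l
      by (rule H.submoduleI)
        (use r submodule_zero[OF r'] submodule_add[OF r'] submodule_smult[OF r'] in auto)
  qed
qed

text \<open>Membership in \<open>mod_hom\<close> without extensionality. Composites, sums and lambda
  terms are then linear maps as they stand, and \<open>restrict\<close> appears only where one of
  the given definitions imposes \<open>mod_hom\<close>.\<close>

definition linear_map ::
  "('a, 'r) ring_scheme \<Rightarrow> ('a, 'm) module \<Rightarrow> ('a, 'n) module \<Rightarrow> ('m \<Rightarrow> 'n) \<Rightarrow> bool" where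
  "linear_map R M N f \<longleftrightarrow> (\<forall>x\<in>carrier M. f x \<in> carrier N) \<and>
     (\<forall>x\<in>carrier M. \<forall>y\<in>carrier M. f (x \<oplus>\<^bsub>M\<^esub> y) = f x \<oplus>\<^bsub>N\<^esub> f y) \<and>
     (\<forall>r\<in>carrier R. \<forall>x\<in>carrier M. f (r \<odot>\<^bsub>M\<^esub> x) = r \<odot>\<^bsub>N\<^esub> f x)"

lemma linear_mapI:
  assumes "\<And>x. x \<in> carrier M \<Longrightarrow> f x \<in> carrier N"
    and "\<And>x y. \<lbrakk>x \<in> carrier M; y \<in> carrier M\<rbrakk> \<Longrightarrow> f (x \<oplus>\<^bsub>M\<^esub> y) = f x \<oplus>\<^bsub>N\<^esub> f y"
    and "\<And>r x. \<lbrakk>r \<in> carrier R; x \<in> carrier M\<rbrakk> \<Longrightarrow> f (r \<odot>\<^bsub>M\<^esub> x) = r \<odot>\<^bsub>N\<^esub> f x"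
  shows "linear_map R M N f"
  using assms by (simp add: linear_map_def)

lemma linear_map_closed: "\<lbrakk>linear_map R M N f; x \<in> carrier M\<rbrakk> \<Longrightarrow> f x \<in> carrier N"
  by (simp add: linear_map_def)

lemma linear_map_add:
  "\<lbrakk>linear_map R M N f; x \<in> carrier M; y \<in> carrier M\<rbrakk> \<Longrightarrow> f (x \<oplus>\<^bsub>M\<^esub> y) = f x \<oplus>\<^bsub>N\<^esub> f y"
  by (simp add: linear_map_def)

lemma linear_map_smult:
  "\<lbrakk>linear_map R M N f; r \<in> carrier R; x \<in> carrier M\<rbrakk> \<Longrightarrow> f (r \<odot>\<^bsub>M\<^esub> x) = r \<odot>\<^bsub>N\<^esub> f x"
  by (simp add: linear_map_def)

lemma mod_hom_iff: "f \<in> mod_hom R M N \<longleftrightarrow> linear_map R M N f \<and> f \<in> extensional (carrier M)"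
  by (auto simp: mod_hom_def linear_map_def PiE_def)

lemma mod_hom_linear: "f \<in> mod_hom R M N \<Longrightarrow> linear_map R M N f"
  by (simp add: mod_hom_iff)

lemma linear_map_cong:
  assumes "left_module R M" "linear_map R M N f" "\<And>x. x \<in> carrier M \<Longrightarrow> f x = g x"
  shows "linear_map R M N g"
proof -
  interpret left_module R M by fact
  show ?thesis
    using assms(2) unfolding linear_map_def by (simp add: assms(3)[symmetric])
qed

lemma restrict_mod_hom:
  assumes "left_module R M" "linear_map R M N f"
  shows "restrict f (carrier M) \<in> mod_hom R M N"
  using linear_map_cong[OF assms, of "restrict f (carrier M)"] by (simp add: mod_hom_iff)

lemma linear_map_comp:
  "\<lbrakk>linear_map R L M f; linear_map R M N g\<rbrakk> \<Longrightarrow> linear_map R L N (\<lambda>x. g (f x))"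
  by (simp add: linear_map_def)

lemma linear_map_id: "linear_map R M M (\<lambda>x. x)"
  by (simp add: linear_map_def)

lemma linear_map_const_zero:
  assumes "left_module R N"
  shows "linear_map R M N (\<lambda>x. \<zero>\<^bsub>N\<^esub>)"
proof -
  interpret left_module R N by fact
  show ?thesis by (simp add: linear_map_def)
qed

lemma linear_map_plus:
  assumes "left_module R N" "linear_map R M N f" "linear_map R M N g"
  shows "linear_map R M N (\<lambda>x. f x \<oplus>\<^bsub>N\<^esub> g x)"
proof -
  interpret left_module R N by fact
  show ?thesis using assms(2,3) by (simp add: linear_map_def M.a_ac smult_r_distr)
qed

lemma linear_map_incl: "submodule H R M \<Longrightarrow> linear_map R (sub_module M H) M (\<lambda>x. x)"
  by (auto simp: linear_map_def submodule_carrier)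

lemma linear_map_sub_dom:
  "\<lbrakk>submodule H R M; linear_map R M N f\<rbrakk> \<Longrightarrow> linear_map R (sub_module M H) N f"
  by (auto simp: linear_map_def submodule_carrier)

lemma linear_map_sub_cod:
  "\<lbrakk>linear_map R M N f; \<And>x. x \<in> carrier M \<Longrightarrow> f x \<in> H\<rbrakk> \<Longrightarrow> linear_map R M (sub_module N H) f"
  by (auto simp: linear_map_def)

lemma linear_map_sub_codD:
  "\<lbrakk>submodule H R N; linear_map R M (sub_module N H) f\<rbrakk> \<Longrightarrow> linear_map R M N f"
  by (auto simp: linear_map_def submodule_carrier)

lemma linear_map_zero:
  assumes "left_module R M" "left_module R N" "linear_map R M N f"
  shows "f \<zero>\<^bsub>M\<^esub> = \<zero>\<^bsub>N\<^esub>"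
proof -
  interpret M: left_module R M by fact
  interpret N: left_module R N by fact
  show ?thesis
    using linear_map_smult[OF assms(3), of "\<zero>\<^bsub>R\<^esub>" "\<zero>\<^bsub>M\<^esub>"] linear_map_closed[OF assms(3), of "\<zero>\<^bsub>M\<^esub>"] by simp
qed

lemma linear_map_neg:
  assumes "left_module R M" "left_module R N" "linear_map R M N f" "x \<in> carrier M"
  shows "f (\<ominus>\<^bsub>M\<^esub> x) = \<ominus>\<^bsub>N\<^esub> f x"
proof -
  interpret M: left_module R M by fact
  interpret N: left_module R N by fact
  show ?thesis
    using linear_map_smult[OF assms(3), of "\<ominus>\<^bsub>R\<^esub> \<one>\<^bsub>R\<^esub>" x] linear_map_closed[OF assms(3), of x] assms(4)
    by (simp add: M.smult_minus_one N.smult_minus_one)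
qed

lemma linear_map_diff:
  assumes "left_module R M" "left_module R N" "linear_map R M N f" "x \<in> carrier M" "y \<in> carrier M"
  shows "f (x \<ominus>\<^bsub>M\<^esub> y) = f x \<ominus>\<^bsub>N\<^esub> f y"
proof -
  interpret M: left_module R M by fact
  show ?thesis
    using assms by (simp add: a_minus_def linear_map_neg linear_map_add)
qed

lemma linear_map_minus:
  assumes "left_module R M" "left_module R N" "linear_map R M N f" "linear_map R M N g"
  shows "linear_map R M N (\<lambda>x. f x \<ominus>\<^bsub>N\<^esub> g x)"
proof -
  interpret M: left_module R M by fact
  interpret N: left_module R N by fact
  have "linear_map R N N (\<lambda>x. \<ominus>\<^bsub>N\<^esub> x)"
    by (rule linear_mapI)
      (simp_all add: N.M.minus_add N.smult_r_minus)
  then have "linear_map R M N (\<lambda>x. \<ominus>\<^bsub>N\<^esub> g x)"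
    using assms(4) linear_map_comp by blast
  then show ?thesis
    unfolding a_minus_def by (rule linear_map_plus[OF assms(2,3)])
qed

lemma linear_map_finsum:
  assumes "left_module R M" "left_module R N" "linear_map R M N f" "finite I"
    "\<And>i. i \<in> I \<Longrightarrow> g i \<in> carrier M"
  shows "f (\<Oplus>\<^bsub>M\<^esub>i\<in>I. g i) = (\<Oplus>\<^bsub>N\<^esub>i\<in>I. f (g i))"
  using assms(4,5)
proof (induction I rule: finite_induct)
  interpret M: left_module R M by fact
  interpret N: left_module R N by fact
  { case empty
    show ?case by (simp add: linear_map_zero[OF assms(1-3)])
  next
    case (insert i I)
    then show ?case
      using assms(3) by (simp add: Pi_def linear_map_add linear_map_closed M.M.finsum_closed) }
qed

lemma linear_map_kernel:
  assumes "left_module R M" "left_module R N" "linear_map R M N f"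
  shows "submodule (a_kernel M N f) R M"
proof -
  interpret M: left_module R M by fact
  interpret N: left_module R N by fact
  show ?thesis
    by (rule M.submoduleI)
      (use assms linear_map_zero[OF assms] in \<open>auto simp: a_kernel_def' linear_map_add linear_map_smult\<close>)
qed

lemma linear_map_image:
  assumes "left_module R M" "left_module R N" "linear_map R M N f" "submodule H R M"
  shows "submodule (f ` H) R N"
proof -
  interpret M: left_module R M by fact
  interpret N: left_module R N by fact
  note c = submodule_carrier[OF assms(4)]
  show ?thesis
  proof (rule N.submoduleI)
    show "f ` H \<subseteq> carrier N" using c linear_map_closed[OF assms(3)] by auto
    show "\<zero>\<^bsub>N\<^esub> \<in> f ` H"
      using image_eqI[of "\<zero>\<^bsub>N\<^esub>" f "\<zero>\<^bsub>M\<^esub>"] linear_map_zero[OF assms(1-3)] submodule_zero[OF assms(4)]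
      by simp
    show "x \<oplus>\<^bsub>N\<^esub> y \<in> f ` H" if xy: "x \<in> f ` H" "y \<in> f ` H" for x y
    proof -
      from xy obtain u v where "u \<in> H" "x = f u" "v \<in> H" "y = f v" by blast
      then show ?thesis
        by (intro image_eqI[of _ _ "u \<oplus>\<^bsub>M\<^esub> v"])
          (simp_all add: c linear_map_add[OF assms(3)] submodule_add[OF assms(4)])
    qed
    show "a \<odot>\<^bsub>N\<^esub> x \<in> f ` H" if ax: "a \<in> carrier R" "x \<in> f ` H" for a x
    proof -
      from ax obtain u where "u \<in> H" "x = f u" by blast
      then show ?thesis
        by (intro image_eqI[of _ _ "a \<odot>\<^bsub>M\<^esub> u"])
          (simp_all add: ax c linear_map_smult[OF assms(3)] submodule_smult[OF assms(4)])
    qed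
  qed
qed

lemma linear_map_vimage:
  assumes "left_module R M" "left_module R N" "linear_map R M N f" "submodule H R N"
  shows "submodule {x \<in> carrier M. f x \<in> H} R M"
proof -
  interpret M: left_module R M by fact
  show ?thesis
    by (rule M.submoduleI)
      (use assms linear_map_zero[OF assms(1-3)] in \<open>auto simp: linear_map_add linear_map_smult
        submodule_zero submodule_add submodule_smult\<close>)
qed

lemma submodule_Int:
  assumes "left_module R M" "submodule H R M" "submodule K R M"
  shows "submodule (H \<inter> K) R M"
proof -
  interpret M: left_module R M by fact
  show ?thesis
    by (rule M.submoduleI)
      (use assms submodule_subset in \<open>auto simp: submodule_zero submodule_add submodule_smult\<close>)
qed

lemma set_add_iff: "x \<in> H <+>\<^bsub>M\<^esub> K \<longleftrightarrow> (\<exists>h\<in>H. \<exists>k\<in>K. x = h \<oplus>\<^bsub>M\<^esub> k)"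
  by (simp add: set_add_def set_mult_def)

lemma submodule_set_add:
  assumes "left_module R M" "submodule H R M" "submodule K R M"
  shows "submodule (H <+>\<^bsub>M\<^esub> K) R M"
proof -
  interpret M: left_module R M by fact
  note c = submodule_carrier[OF assms(2)] submodule_carrier[OF assms(3)]
  show ?thesis
  proof (rule M.submoduleI)
    show "H <+>\<^bsub>M\<^esub> K \<subseteq> carrier M" using c by (auto simp: set_add_iff)
    show "\<zero>\<^bsub>M\<^esub> \<in> H <+>\<^bsub>M\<^esub> K"
      unfolding set_add_iff
      by (rule bexI[OF bexI[OF _ submodule_zero[OF assms(3)]] submodule_zero[OF assms(2)]]) simp
  next
    fix x y assume "x \<in> H <+>\<^bsub>M\<^esub> K" "y \<in> H <+>\<^bsub>M\<^esub> K"
    then obtain h k h' k' where *: "h \<in> H" "k \<in> K" "x = h \<oplus>\<^bsub>M\<^esub> k" "h' \<in> H" "k' \<in> K" "y = h' \<oplus>\<^bsub>M\<^esub> k'"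
      unfolding set_add_iff by blast
    then have "x \<oplus>\<^bsub>M\<^esub> y = (h \<oplus>\<^bsub>M\<^esub> h') \<oplus>\<^bsub>M\<^esub> (k \<oplus>\<^bsub>M\<^esub> k')" by (simp add: c M.M.a_ac)
    then show "x \<oplus>\<^bsub>M\<^esub> y \<in> H <+>\<^bsub>M\<^esub> K"
      using * submodule_add assms unfolding set_add_iff by metis
  next
    fix a x assume a: "a \<in> carrier R" and "x \<in> H <+>\<^bsub>M\<^esub> K"
    then obtain h k where *: "h \<in> H" "k \<in> K" "x = h \<oplus>\<^bsub>M\<^esub> k"
      unfolding set_add_iff by blast
    then have "a \<odot>\<^bsub>M\<^esub> x = a \<odot>\<^bsub>M\<^esub> h \<oplus>\<^bsub>M\<^esub> a \<odot>\<^bsub>M\<^esub> k" using a by (simp add: c M.smult_r_distr)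
    then show "a \<odot>\<^bsub>M\<^esub> x \<in> H <+>\<^bsub>M\<^esub> K"
      using * a submodule_smult assms unfolding set_add_iff by metis
  qed
qed

lemma submodule_subset_set_add:
  assumes "left_module R M" "submodule H R M" "submodule K R M"
  shows "H \<subseteq> H <+>\<^bsub>M\<^esub> K" "K \<subseteq> H <+>\<^bsub>M\<^esub> K"
proof -
  interpret M: left_module R M by fact
  show "H \<subseteq> H <+>\<^bsub>M\<^esub> K"
  proof
    fix x assume x: "x \<in> H"
    then have "x = x \<oplus>\<^bsub>M\<^esub> \<zero>\<^bsub>M\<^esub>" using submodule_carrier[OF assms(2)] by simp
    then show "x \<in> H <+>\<^bsub>M\<^esub> K" unfolding set_add_iff using x submodule_zero[OF assms(3)] by blast
  qed
  show "K \<subseteq> H <+>\<^bsub>M\<^esub> K"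
  proof
    fix x assume x: "x \<in> K"
    then have "x = \<zero>\<^bsub>M\<^esub> \<oplus>\<^bsub>M\<^esub> x" using submodule_carrier[OF assms(3)] by simp
    then show "x \<in> H <+>\<^bsub>M\<^esub> K" unfolding set_add_iff using x submodule_zero[OF assms(2)] by blast
  qed
qed

lemma linear_map_eq_iff_kernel:
  assumes "left_module R M" "left_module R N" "linear_map R M N f" "x \<in> carrier M" "y \<in> carrier M"
  shows "f x = f y \<longleftrightarrow> x \<ominus>\<^bsub>M\<^esub> y \<in> a_kernel M N f"
proof -
  interpret M: left_module R M by fact
  interpret N: left_module R N by fact
  show ?thesis
    using assms by (simp add: a_kernel_def' linear_map_diff linear_map_closed N.diff_eq_zero_iff)
qed

lemma linear_map_inj_iff:
  assumes "left_module R M" "left_module R N" "linear_map R M N f"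
  shows "inj_on f (carrier M) \<longleftrightarrow> (\<forall>x\<in>carrier M. f x = \<zero>\<^bsub>N\<^esub> \<longrightarrow> x = \<zero>\<^bsub>M\<^esub>)"
proof -
  interpret M: left_module R M by fact
  interpret N: left_module R N by fact
  show ?thesis
  proof
    assume "inj_on f (carrier M)"
    then show "\<forall>x\<in>carrier M. f x = \<zero>\<^bsub>N\<^esub> \<longrightarrow> x = \<zero>\<^bsub>M\<^esub>"
      using linear_map_zero[OF assms] by (metis M.M.zero_closed inj_onD)
  next
    assume *: "\<forall>x\<in>carrier M. f x = \<zero>\<^bsub>N\<^esub> \<longrightarrow> x = \<zero>\<^bsub>M\<^esub>"
    show "inj_on f (carrier M)"
    proof (rule inj_onI)
      fix x y assume xy: "x \<in> carrier M" "y \<in> carrier M" "f x = f y"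
      then have "x \<ominus>\<^bsub>M\<^esub> y \<in> a_kernel M N f"
        using linear_map_eq_iff_kernel[OF assms] by blast
      then show "x = y" using * xy M.diff_eq_zero_iff by (auto simp: a_kernel_def')
    qed
  qed
qed

lemma linear_map_inv:
  assumes "left_module R M" "linear_map R M N f" "bij_betw f (carrier M) (carrier N)"
  shows "linear_map R N M (inv_into (carrier M) f)"
proof -
  interpret M: left_module R M by fact
  have inj: "inj_on f (carrier M)" and im: "f ` carrier M = carrier N"
    using assms(3) by (auto simp: bij_betw_def)
  have ex: "\<exists>u\<in>carrier M. y = f u" if "y \<in> carrier N" for y
    using that im by auto
  show ?thesis
  proof (rule linear_mapI)
    show "inv_into (carrier M) f y \<in> carrier M" if "y \<in> carrier N" for y
      using that im by (metis inv_into_into)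
    show "inv_into (carrier M) f (x \<oplus>\<^bsub>N\<^esub> y) = inv_into (carrier M) f x \<oplus>\<^bsub>M\<^esub> inv_into (carrier M) f y"
      if xy: "x \<in> carrier N" "y \<in> carrier N" for x y
    proof -
      obtain u v where "u \<in> carrier M" "x = f u" "v \<in> carrier M" "y = f v"
        using xy ex by meson
      then show ?thesis
        by (simp add: linear_map_add[OF assms(2), symmetric] inv_into_f_f[OF inj])
    qed
    show "inv_into (carrier M) f (r \<odot>\<^bsub>N\<^esub> x) = r \<odot>\<^bsub>M\<^esub> inv_into (carrier M) f x"
      if rx: "r \<in> carrier R" "x \<in> carrier N" for r x
    proof -
      obtain u where "u \<in> carrier M" "x = f u"
        using rx ex by meson
      then show ?thesis
        by (simp add: rx linear_map_smult[OF assms(2), symmetric] inv_into_f_f[OF inj])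
    qed
  qed
qed

text \<open>Universal property of a cokernel. The value at a point of N is the value of
  \<open>h\<close> at a chosen preimage under \<open>g\<close>; two preimages differ by an element
  of the kernel of \<open>g\<close>, where \<open>h\<close> vanishes, so the choice does not matter
  and linearity is inherited.\<close>

lemma linear_map_factor:
  assumes "left_module R M" "left_module R N" "left_module R Y"
    and g: "linear_map R M N g" "g ` carrier M = carrier N"
    and h: "linear_map R M Y h" "\<And>x. \<lbrakk>x \<in> carrier M; g x = \<zero>\<^bsub>N\<^esub>\<rbrakk> \<Longrightarrow> h x = \<zero>\<^bsub>Y\<^esub>"
  obtains h' where "linear_map R N Y h'" "\<And>x. x \<in> carrier M \<Longrightarrow> h' (g x) = h x"
proof
  interpret M: left_module R M by fact
  interpret N: left_module R N by fact
  interpret Y: left_module R Y by fact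
  define s where "s = inv_into (carrier M) g"
  have s: "s y \<in> carrier M" "g (s y) = y" if "y \<in> carrier N" for y
    using that g(2) unfolding s_def by (auto intro: inv_into_into f_inv_into_f)
  have eq: "h x = h y" if "x \<in> carrier M" "y \<in> carrier M" "g x = g y" for x y
  proof -
    have "x \<ominus>\<^bsub>M\<^esub> y \<in> a_kernel M N g"
      using that linear_map_eq_iff_kernel[OF assms(1,2) g(1)] by blast
    then have "x \<ominus>\<^bsub>M\<^esub> y \<in> a_kernel M Y h"
      using h(2) by (auto simp: a_kernel_def')
    then show ?thesis
      using that linear_map_eq_iff_kernel[OF assms(1,3) h(1)] by blast
  qed
  show gx: "h (s (g x)) = h x" if "x \<in> carrier M" for x
    using that s[of "g x"] linear_map_closed[OF g(1)] by (intro eq) auto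
  have ex: "\<exists>u\<in>carrier M. y = g u" if "y \<in> carrier N" for y
    using that g(2) by auto
  show "linear_map R N Y (\<lambda>y. h (s y))"
  proof (rule linear_mapI)
    show "h (s x) \<in> carrier Y" if "x \<in> carrier N" for x
      using s that linear_map_closed[OF h(1)] by blast
    show "h (s (x \<oplus>\<^bsub>N\<^esub> y)) = h (s x) \<oplus>\<^bsub>Y\<^esub> h (s y)" if xy: "x \<in> carrier N" "y \<in> carrier N" for x y
    proof -
      obtain u v where "u \<in> carrier M" "x = g u" "v \<in> carrier M" "y = g v"
        using xy ex by meson
      then show ?thesis
        by (simp add: linear_map_add[OF g(1), symmetric] gx linear_map_add[OF h(1)])
    qed
    show "h (s (r \<odot>\<^bsub>N\<^esub> x)) = r \<odot>\<^bsub>Y\<^esub> h (s x)" if rx: "r \<in> carrier R" "x \<in> carrier N" for r x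
    proof -
      obtain u where "u \<in> carrier M" "x = g u"
        using rx ex by meson
      then show ?thesis
        by (simp add: rx linear_map_smult[OF g(1), symmetric] gx linear_map_smult[OF h(1)])
    qed
  qed
qed

lemma mod_isomorphic_iff:
  assumes "left_module R M"
  shows "mod_isomorphic R M N \<longleftrightarrow> (\<exists>f. linear_map R M N f \<and> bij_betw f (carrier M) (carrier N))"
proof
  assume "mod_isomorphic R M N"
  then show "\<exists>f. linear_map R M N f \<and> bij_betw f (carrier M) (carrier N)"
    by (auto simp: mod_isomorphic_def mod_hom_iff)
next
  assume "\<exists>f. linear_map R M N f \<and> bij_betw f (carrier M) (carrier N)"
  then obtain f where f: "linear_map R M N f" "bij_betw f (carrier M) (carrier N)" by blast
  then have "restrict f (carrier M) \<in> mod_hom R M N"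
    "bij_betw (restrict f (carrier M)) (carrier M) (carrier N)"
    using restrict_mod_hom[OF assms f(1)] by auto
  then show "mod_isomorphic R M N" unfolding mod_isomorphic_def by blast
qed

section \<open>Powers, free modules and direct summands\<close>

lemma (in left_module) smult_finsum:
  assumes "a \<in> carrier R" "finite I" "\<And>i. i \<in> I \<Longrightarrow> f i \<in> carrier M"
  shows "a \<odot>\<^bsub>M\<^esub> (\<Oplus>\<^bsub>M\<^esub>i\<in>I. f i) = (\<Oplus>\<^bsub>M\<^esub>i\<in>I. a \<odot>\<^bsub>M\<^esub> f i)"
  using assms(2,3)
proof (induction I rule: finite_induct)
  case (insert i I)
  then show ?case using assms(1) by (simp add: Pi_def smult_r_distr)
qed (simp add: assms(1))

section \<open>Finite powers of a module and their coordinate maps\<close>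

lemma power_module_carrier [simp]: "carrier (power_module M n) = {..<n} \<rightarrow>\<^sub>E carrier M"
  and power_module_zero [simp]: "\<zero>\<^bsub>power_module M n\<^esub> = (\<lambda>i\<in>{..<n}. \<zero>\<^bsub>M\<^esub>)"
  and power_module_add [simp]: "u \<oplus>\<^bsub>power_module M n\<^esub> v = (\<lambda>i\<in>{..<n}. u i \<oplus>\<^bsub>M\<^esub> v i)"
  and power_module_smult [simp]: "r \<odot>\<^bsub>power_module M n\<^esub> u = (\<lambda>i\<in>{..<n}. r \<odot>\<^bsub>M\<^esub> u i)"
  by (simp_all add: power_module_def)

lemma PiE_nth: "\<lbrakk>u \<in> {..<n} \<rightarrow>\<^sub>E A; i < n\<rbrakk> \<Longrightarrow> u i \<in> A"
  by (auto simp: PiE_def Pi_def)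

lemma PiE_eqI:
  assumes "u \<in> {..<n} \<rightarrow>\<^sub>E A" "v \<in> {..<n} \<rightarrow>\<^sub>E B" "\<And>i. i < n \<Longrightarrow> u i = v i"
  shows "u = v"
  by (rule extensionalityI[of _ "{..<n}"]) (use assms in \<open>auto simp: PiE_def\<close>)

lemma power_left_module:
  assumes "left_module R M"
  shows "left_module R (power_module M n)"
proof -
  interpret left_module R M by fact
  show ?thesis
  proof (rule left_moduleI)
    fix x assume "x \<in> carrier (power_module M n)"
    then have x: "x \<in> {..<n} \<rightarrow>\<^sub>E carrier M" by simp
    note nth = PiE_nth[OF x]
    show "\<zero>\<^bsub>power_module M n\<^esub> \<oplus>\<^bsub>power_module M n\<^esub> x = x"
      by (rule PiE_eqI[of _ n "carrier M" x "carrier M"]) (simp_all add: nth x del: PiE_iff)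
    show "\<one>\<^bsub>R\<^esub> \<odot>\<^bsub>power_module M n\<^esub> x = x"
      by (rule PiE_eqI[of _ n "carrier M" x "carrier M"]) (simp_all add: nth x del: PiE_iff)
  next
    fix x y assume "x \<in> carrier (power_module M n)" "y \<in> carrier (power_module M n)"
    then have x: "x \<in> {..<n} \<rightarrow>\<^sub>E carrier M" and y: "y \<in> {..<n} \<rightarrow>\<^sub>E carrier M" by simp_all
    show "x \<oplus>\<^bsub>power_module M n\<^esub> y = y \<oplus>\<^bsub>power_module M n\<^esub> x"
      using PiE_nth[OF x] PiE_nth[OF y] by (simp add: M.a_comm cong: restrict_cong)
  qed (use R.ring_axioms in \<open>simp_all add: PiE_nth M.a_assoc smult_l_distr smult_r_distr smult_assoc1
          cong: restrict_cong\<close>)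
qed

lemma linear_map_nth: "i < n \<Longrightarrow> linear_map R (power_module M n) M (\<lambda>u. u i)"
  by (rule linear_mapI) (auto simp: PiE_nth)

lemma linear_map_tuple:
  assumes "\<And>i. i < n \<Longrightarrow> linear_map R A M (f i)"
  shows "linear_map R A (power_module M n) (\<lambda>x. \<lambda>i\<in>{..<n}. f i x)"
  by (rule linear_mapI)
    (auto simp: linear_map_closed[OF assms] linear_map_add[OF assms] linear_map_smult[OF assms]
      cong: restrict_cong)

text \<open>The embedding of the i-th coordinate. For \<open>i \<ge> n\<close> it is the zero map,
  so its linearity holds without a bound on \<open>i\<close>.\<close>

definition power_incl :: "('a, 'm) module \<Rightarrow> nat \<Rightarrow> nat \<Rightarrow> 'm \<Rightarrow> nat \<Rightarrow> 'm" where
  "power_incl M n i x = (\<lambda>j\<in>{..<n}. if j = i then x else \<zero>\<^bsub>M\<^esub>)"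

lemma linear_map_power_incl:
  assumes "left_module R M"
  shows "linear_map R M (power_module M n) (power_incl M n i)"
proof -
  interpret left_module R M by fact
  show ?thesis
    unfolding power_incl_def[abs_def]
  proof (rule linear_map_tuple)
    show "linear_map R M M (\<lambda>x. if j = i then x else \<zero>\<^bsub>M\<^esub>)" for j
      by (cases "j = i") (simp_all add: linear_map_id linear_map_const_zero[OF assms])
  qed
qed

lemma power_incl_closed:
  assumes "left_module R M" "x \<in> carrier M"
  shows "power_incl M n i x \<in> {..<n} \<rightarrow>\<^sub>E carrier M"
  using linear_map_closed[OF linear_map_power_incl[OF assms(1)] assms(2)] by simp

lemma power_module_decomp:
  assumes "left_module R M" "u \<in> {..<n} \<rightarrow>\<^sub>E carrier M"
  shows "u = (\<Oplus>\<^bsub>power_module M n\<^esub>i\<in>{..<n}. power_incl M n i (u i))"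
proof -
  interpret M: left_module R M by fact
  interpret P: left_module R "power_module M n" using assms(1) by (rule power_left_module)
  note u = PiE_nth[OF assms(2)]
  have incl: "power_incl M n i (u i) \<in> {..<n} \<rightarrow>\<^sub>E carrier M" if "i < n" for i
    using power_incl_closed[OF assms(1) u[OF that]] .
  have "(\<Oplus>\<^bsub>power_module M n\<^esub>i\<in>{..<n}. power_incl M n i (u i)) \<in> carrier (power_module M n)"
    using incl by (intro P.M.finsum_closed) (auto simp del: PiE_iff)
  then have c: "(\<Oplus>\<^bsub>power_module M n\<^esub>i\<in>{..<n}. power_incl M n i (u i)) \<in> {..<n} \<rightarrow>\<^sub>E carrier M"
    by simp
  show ?thesis
  proof (rule PiE_eqI[OF assms(2) c])
    fix j assume j: "j < n"
    have "(\<Oplus>\<^bsub>power_module M n\<^esub>i\<in>{..<n}. power_incl M n i (u i)) j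
        = (\<Oplus>\<^bsub>M\<^esub>i\<in>{..<n}. power_incl M n i (u i) j)"
      using incl
      by (intro linear_map_finsum[OF power_left_module[OF assms(1)] assms(1) linear_map_nth[OF j]])
        auto
    also have "\<dots> = (\<Oplus>\<^bsub>M\<^esub>i\<in>{..<n}. if j = i then u i else \<zero>\<^bsub>M\<^esub>)"
      using j u by (intro M.M.finsum_cong') (auto simp: power_incl_def)
    also have "\<dots> = u j"
      using j u by (intro M.M.finsum_singleton) auto
    finally show "u j = (\<Oplus>\<^bsub>power_module M n\<^esub>i\<in>{..<n}. power_incl M n i (u i)) j" by simp
  qed
qed

text \<open>Together with \<open>linear_map_copair\<close> this identifies maps out of a power with
  tuples of maps, which is how arguments about powers are reduced to single coordinates.\<close>

lemma linear_map_power_eq: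
  assumes "left_module R M" "left_module R Y" "linear_map R (power_module M n) Y h"
    and "u \<in> {..<n} \<rightarrow>\<^sub>E carrier M"
  shows "h u = (\<Oplus>\<^bsub>Y\<^esub>i\<in>{..<n}. h (power_incl M n i (u i)))"
proof -
  have "h u = h (\<Oplus>\<^bsub>power_module M n\<^esub>i\<in>{..<n}. power_incl M n i (u i))"
    using power_module_decomp[OF assms(1,4)] by simp
  also have "\<dots> = (\<Oplus>\<^bsub>Y\<^esub>i\<in>{..<n}. h (power_incl M n i (u i)))"
    using power_incl_closed[OF assms(1)] PiE_nth[OF assms(4)]
    by (intro linear_map_finsum[OF power_left_module[OF assms(1)] assms(2,3)]) auto
  finally show ?thesis .
qed

lemma linear_map_copair:
  assumes "left_module R Y" "\<And>i. i < n \<Longrightarrow> linear_map R M Y (f i)"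
  shows "linear_map R (power_module M n) Y (\<lambda>u. \<Oplus>\<^bsub>Y\<^esub>i\<in>{..<n}. f i (u i))"
proof -
  interpret Y: left_module R Y by fact
  note nth = linear_map_closed[OF assms(2)]
  show ?thesis
  proof (rule linear_mapI)
    fix u assume "u \<in> carrier (power_module M n)"
    then have u: "f i (u i) \<in> carrier Y" "u i \<in> carrier M" if "i < n" for i
      using nth that by (auto simp: PiE_nth)
    show "(\<Oplus>\<^bsub>Y\<^esub>i\<in>{..<n}. f i (u i)) \<in> carrier Y"
      using u by (intro Y.M.finsum_closed) auto
    { fix v assume "v \<in> carrier (power_module M n)"
      then have v: "f i (v i) \<in> carrier Y" "v i \<in> carrier M" if "i < n" for i
        using nth that by (auto simp: PiE_nth)
      have "(\<Oplus>\<^bsub>Y\<^esub>i\<in>{..<n}. f i ((u \<oplus>\<^bsub>power_module M n\<^esub> v) i))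
          = (\<Oplus>\<^bsub>Y\<^esub>i\<in>{..<n}. f i (u i) \<oplus>\<^bsub>Y\<^esub> f i (v i))"
        using u v by (intro Y.M.finsum_cong') (auto simp: linear_map_add[OF assms(2)])
      also have "\<dots> = (\<Oplus>\<^bsub>Y\<^esub>i\<in>{..<n}. f i (u i)) \<oplus>\<^bsub>Y\<^esub> (\<Oplus>\<^bsub>Y\<^esub>i\<in>{..<n}. f i (v i))"
        using u v by (intro Y.M.finsum_addf) auto
      finally show "(\<Oplus>\<^bsub>Y\<^esub>i\<in>{..<n}. f i ((u \<oplus>\<^bsub>power_module M n\<^esub> v) i))
          = (\<Oplus>\<^bsub>Y\<^esub>i\<in>{..<n}. f i (u i)) \<oplus>\<^bsub>Y\<^esub> (\<Oplus>\<^bsub>Y\<^esub>i\<in>{..<n}. f i (v i))" . }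
    fix r assume r: "r \<in> carrier R"
    have "(\<Oplus>\<^bsub>Y\<^esub>i\<in>{..<n}. f i ((r \<odot>\<^bsub>power_module M n\<^esub> u) i))
        = (\<Oplus>\<^bsub>Y\<^esub>i\<in>{..<n}. r \<odot>\<^bsub>Y\<^esub> f i (u i))"
      using u r by (intro Y.M.finsum_cong') (auto simp: linear_map_smult[OF assms(2)])
    also have "\<dots> = r \<odot>\<^bsub>Y\<^esub> (\<Oplus>\<^bsub>Y\<^esub>i\<in>{..<n}. f i (u i))"
      using u r by (intro Y.smult_finsum[symmetric]) auto
    finally show "(\<Oplus>\<^bsub>Y\<^esub>i\<in>{..<n}. f i ((r \<odot>\<^bsub>power_module M n\<^esub> u) i))
        = r \<odot>\<^bsub>Y\<^esub> (\<Oplus>\<^bsub>Y\<^esub>i\<in>{..<n}. f i (u i))" .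
  qed
qed

lemma copair_power_incl:
  assumes "left_module R Y" "left_module R M" "\<And>i. i < n \<Longrightarrow> linear_map R M Y (f i)" "j < n" "x \<in> carrier M"
  shows "(\<Oplus>\<^bsub>Y\<^esub>i\<in>{..<n}. f i (power_incl M n j x i)) = f j x"
proof -
  interpret Y: left_module R Y by fact
  interpret M: left_module R M by fact
  have "(\<Oplus>\<^bsub>Y\<^esub>i\<in>{..<n}. f i (power_incl M n j x i)) = (\<Oplus>\<^bsub>Y\<^esub>i\<in>{..<n}. if j = i then f i x else \<zero>\<^bsub>Y\<^esub>)"
    using assms(5) linear_map_zero[OF assms(2,1) assms(3)] linear_map_closed[OF assms(3)]
    by (intro Y.M.finsum_cong') (auto simp: power_incl_def)
  also have "\<dots> = f j x"
    using assms(4,5) linear_map_closed[OF assms(3)] by (intro Y.M.finsum_singleton) auto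
  finally show ?thesis .
qed

section \<open>The regular module and finite generation\<close>

lemma regular_module_simps [simp]:
  "carrier (regular_module R) = carrier R"
  "\<zero>\<^bsub>regular_module R\<^esub> = \<zero>\<^bsub>R\<^esub>"
  "x \<oplus>\<^bsub>regular_module R\<^esub> y = x \<oplus>\<^bsub>R\<^esub> y"
  "r \<odot>\<^bsub>regular_module R\<^esub> x = r \<otimes>\<^bsub>R\<^esub> x"
  by (simp_all add: regular_module_def scalar_module_def)

lemma regular_left_module:
  assumes "ring R"
  shows "left_module R (regular_module R)"
proof -
  interpret ring R by fact
  show ?thesis
    by (rule left_moduleI) (simp_all add: assms a_ac l_distr r_distr m_assoc)
qed

lemma linear_map_regular:
  assumes "left_module R M" "x \<in> carrier M"
  shows "linear_map R (regular_module R) M (\<lambda>r. r \<odot>\<^bsub>M\<^esub> x)"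
proof -
  interpret left_module R M by fact
  show ?thesis
    by (rule linear_mapI) (simp_all add: assms smult_l_distr smult_assoc1)
qed

lemma linear_map_regular_eq:
  assumes "ring R" "linear_map R (regular_module R) M h" "r \<in> carrier R"
  shows "h r = r \<odot>\<^bsub>M\<^esub> h \<one>\<^bsub>R\<^esub>"
proof -
  interpret ring R by fact
  show ?thesis using linear_map_smult[OF assms(2,3), of "\<one>\<^bsub>R\<^esub>"] assms(3) by simp
qed

lemma finitely_generated_surj:
  assumes "left_module R M" "finitely_generated R M"
  obtains n g where "linear_map R (power_module (regular_module R) n) M g"
    "g ` carrier (power_module (regular_module R) n) = carrier M"
proof -
  interpret M: left_module R M by fact
  have reg: "left_module R (regular_module R)" by (rule regular_left_module) (rule M.R.ring_axioms)
  obtain S where S: "finite S" "S \<subseteq> carrier M" "\<And>H. submodule H R M \<and> S \<subseteq> H \<Longrightarrow> H = carrier M"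
    using assms(2) unfolding finitely_generated_def by blast
  obtain n :: nat and s where s: "S = s ` {i. i < n}"
    using finite_imp_nat_seg_image_inj_on[OF S(1)] by blast
  have sM: "s i \<in> carrier M" if "i < n" for i using s S(2) that by auto
  define g where "g = (\<lambda>u. \<Oplus>\<^bsub>M\<^esub>i\<in>{..<n}. u i \<odot>\<^bsub>M\<^esub> s i)"
  have lin: "linear_map R (regular_module R) M (\<lambda>r. r \<odot>\<^bsub>M\<^esub> s i)" if "i < n" for i
    by (rule linear_map_regular[OF assms(1) sM[OF that]])
  have g: "linear_map R (power_module (regular_module R) n) M g"
    unfolding g_def by (rule linear_map_copair[OF assms(1) lin])
  let ?P = "power_module (regular_module R) n"
  interpret P: left_module R ?P using reg by (rule power_left_module)
  have "submodule (g ` carrier ?P) R M"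
    by (rule linear_map_image[OF power_left_module[OF reg] assms(1) g P.submodule_self])
  moreover have "S \<subseteq> g ` carrier ?P"
  proof
    fix x assume "x \<in> S"
    then obtain i where i: "i < n" "x = s i" using s by auto
    have "g (power_incl (regular_module R) n i \<one>\<^bsub>R\<^esub>) = \<one>\<^bsub>R\<^esub> \<odot>\<^bsub>M\<^esub> s i"
      unfolding g_def by (rule copair_power_incl[OF assms(1) reg lin i(1)]) simp_all
    moreover have "power_incl (regular_module R) n i \<one>\<^bsub>R\<^esub> \<in> carrier ?P"
      using power_incl_closed[OF reg, of "\<one>\<^bsub>R\<^esub>"] by (simp del: PiE_iff)
    ultimately show "x \<in> g ` carrier ?P" using i sM by (metis M.smult_one imageI)
  qed
  ultimately have "g ` carrier ?P = carrier M" using S(3) by blast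
  then show thesis using that g by blast
qed

lemma finitely_generated_image:
  assumes M: "left_module R M" and N: "left_module R N"
    and g: "linear_map R M N g" "g ` carrier M = carrier N" and "finitely_generated R M"
  shows "finitely_generated R N"
proof -
  obtain G where G: "finite G" "G \<subseteq> carrier M" "\<And>H. submodule H R M \<and> G \<subseteq> H \<Longrightarrow> H = carrier M"
    using assms(5) unfolding finitely_generated_def by blast
  have "H = carrier N" if H: "submodule H R N" "g ` G \<subseteq> H" for H
  proof (rule antisym[OF submodule_subset[OF H(1)]])
    have "submodule {x \<in> carrier M. g x \<in> H} R M" by (rule linear_map_vimage[OF M N g(1) H(1)])
    moreover have "G \<subseteq> {x \<in> carrier M. g x \<in> H}" using G(2) H(2) by blast
    ultimately have "{x \<in> carrier M. g x \<in> H} = carrier M" using G(3) by blast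
    then show "carrier N \<subseteq> H" using g(2) by force
  qed
  then show ?thesis unfolding finitely_generated_def
    using G(1,2) linear_map_closed[OF g(1)] by (intro exI[of _ "g ` G"]) auto
qed

text \<open>The projection takes \<open>x\<close> to a chosen \<open>h\<close> in \<open>H\<close>
  with \<open>x - h\<close> in \<open>K\<close>. As \<open>H\<close> and \<open>K\<close> meet only
  in zero there is a single such \<open>h\<close>, and this uniqueness proves additivity and
  compatibility with scalars.\<close>

lemma direct_sum_projection:
  assumes "left_module R M" "submodule H R M" "submodule K R M"
    and int: "H \<inter> K = {\<zero>\<^bsub>M\<^esub>}" and sum: "H <+>\<^bsub>M\<^esub> K = carrier M"
  obtains p where "linear_map R M (sub_module M H) p" "\<And>x. x \<in> H \<Longrightarrow> p x = x"
    "\<And>x. x \<in> K \<Longrightarrow> p x = \<zero>\<^bsub>M\<^esub>" "\<And>x. x \<in> carrier M \<Longrightarrow> x \<ominus>\<^bsub>M\<^esub> p x \<in> K"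
proof -
  interpret M: left_module R M by fact
  note Hc = submodule_carrier[OF assms(2)] and Kc = submodule_carrier[OF assms(3)]
  define p where "p x = (SOME h. h \<in> H \<and> x \<ominus>\<^bsub>M\<^esub> h \<in> K)" for x
  have p: "p x \<in> H" "x \<ominus>\<^bsub>M\<^esub> p x \<in> K" if x: "x \<in> carrier M" for x
  proof -
    have "x \<in> H <+>\<^bsub>M\<^esub> K" using sum x by simp
    then obtain h k where hk: "h \<in> H" "k \<in> K" "x = h \<oplus>\<^bsub>M\<^esub> k" unfolding set_add_iff by blast
    then have "x \<ominus>\<^bsub>M\<^esub> h = k" by (simp add: Hc Kc M.add_diff_cancel_left)
    then have "\<exists>h. h \<in> H \<and> x \<ominus>\<^bsub>M\<^esub> h \<in> K" using hk by blast
    then show "p x \<in> H" "x \<ominus>\<^bsub>M\<^esub> p x \<in> K" unfolding p_def by (metis (mono_tags, lifting) someI_ex)+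
  qed
  have eqI: "h = h'" if "h \<in> H" "h' \<in> H" "h \<ominus>\<^bsub>M\<^esub> h' \<in> K" for h h'
  proof -
    have "h \<ominus>\<^bsub>M\<^esub> h' \<in> H \<inter> K" using that submodule_diff[OF assms(2)] by blast
    then show ?thesis using int that Hc M.diff_eq_zero_iff by blast
  qed
  have eq: "p x = h" if "x \<in> carrier M" "h \<in> H" "x \<ominus>\<^bsub>M\<^esub> h \<in> K" for x h
  proof (rule eqI)
    have "p x \<ominus>\<^bsub>M\<^esub> h = (x \<ominus>\<^bsub>M\<^esub> h) \<ominus>\<^bsub>M\<^esub> (x \<ominus>\<^bsub>M\<^esub> p x)"
      using that p(1)[of x] by (simp add: Hc M.diff_diff_cancel)
    then show "p x \<ominus>\<^bsub>M\<^esub> h \<in> K" using submodule_diff[OF assms(3)] that p by simp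
  qed (use that p in auto)
  have lin: "linear_map R M (sub_module M H) p"
  proof (rule linear_mapI)
    fix x y assume xy: "x \<in> carrier M" "y \<in> carrier M"
    have "(x \<oplus>\<^bsub>M\<^esub> y) \<ominus>\<^bsub>M\<^esub> (p x \<oplus>\<^bsub>M\<^esub> p y) = (x \<ominus>\<^bsub>M\<^esub> p x) \<oplus>\<^bsub>M\<^esub> (y \<ominus>\<^bsub>M\<^esub> p y)"
      using xy p(1) by (simp add: Hc M.M.minus_eq M.M.minus_add M.M.a_ac)
    then show "p (x \<oplus>\<^bsub>M\<^esub> y) = p x \<oplus>\<^bsub>sub_module M H\<^esub> p y"
      using xy p submodule_add[OF assms(2)] submodule_add[OF assms(3)]
      by (simp, intro eq) auto
  next
    fix r x assume rx: "r \<in> carrier R" "x \<in> carrier M"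
    have "r \<odot>\<^bsub>M\<^esub> x \<ominus>\<^bsub>M\<^esub> r \<odot>\<^bsub>M\<^esub> p x = r \<odot>\<^bsub>M\<^esub> (x \<ominus>\<^bsub>M\<^esub> p x)"
      using rx p(1) by (simp add: Hc M.M.minus_eq M.smult_r_distr M.smult_r_minus)
    then show "p (r \<odot>\<^bsub>M\<^esub> x) = r \<odot>\<^bsub>sub_module M H\<^esub> p x"
      using rx p submodule_smult[OF assms(2)] submodule_smult[OF assms(3)]
      by (simp, intro eq) auto
  qed (use p in simp)
  show thesis
  proof (rule that[OF lin])
    show "p x = x" if "x \<in> H" for x
      using that submodule_zero[OF assms(3)] Hc by (intro eq) (auto simp: M.M.minus_eq M.M.r_neg)
    show "p x = \<zero>\<^bsub>M\<^esub>" if "x \<in> K" for x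
      using that submodule_zero[OF assms(2)] Kc by (intro eq) (auto simp: M.diff_zero)
    show "x \<ominus>\<^bsub>M\<^esub> p x \<in> K" if "x \<in> carrier M" for x
      using p that by simp
  qed
qed

text \<open>Each \<open>x\<close> is the sum of \<open>q (p x)\<close> and
  \<open>x - q (p x)\<close>, the latter killed by \<open>p\<close>. The complement is named
  explicitly because a decomposition of T is later refined with both pieces.\<close>

lemma direct_summandI:
  assumes "left_module R M" "left_module R N" "linear_map R N M p" "linear_map R M N q"
    and pq: "\<And>x. x \<in> carrier M \<Longrightarrow> p (q x) = x"
  shows "direct_summand R (q ` carrier M) N"
    and "q ` carrier M \<inter> a_kernel N M p = {\<zero>\<^bsub>N\<^esub>}"
    and "q ` carrier M <+>\<^bsub>N\<^esub> a_kernel N M p = carrier N"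
proof -
  interpret M: left_module R M by fact
  interpret N: left_module R N by fact
  note pc = linear_map_closed[OF assms(3)] and qc = linear_map_closed[OF assms(4)]
  have sub: "submodule (q ` carrier M) R N" "submodule (a_kernel N M p) R N"
    using linear_map_image[OF assms(1,2,4) M.submodule_self] linear_map_kernel[OF assms(2,1,3)] by auto
  show int: "q ` carrier M \<inter> a_kernel N M p = {\<zero>\<^bsub>N\<^esub>}"
  proof (intro equalityI subsetI)
    fix x assume "x \<in> q ` carrier M \<inter> a_kernel N M p"
    then obtain y where "y \<in> carrier M" "x = q y" "p x = \<zero>\<^bsub>M\<^esub>" by (auto simp: a_kernel_def')
    then show "x \<in> {\<zero>\<^bsub>N\<^esub>}" using pq linear_map_zero[OF assms(1,2,4)] by simp
  qed (use submodule_zero[OF sub(1)] submodule_zero[OF sub(2)] in auto)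
  show sum: "q ` carrier M <+>\<^bsub>N\<^esub> a_kernel N M p = carrier N"
  proof (intro equalityI subsetI)
    fix x assume x: "x \<in> carrier N"
    have "p (x \<ominus>\<^bsub>N\<^esub> q (p x)) = p x \<ominus>\<^bsub>M\<^esub> p (q (p x))"
      using x by (intro linear_map_diff[OF assms(2,1,3)]) (auto simp: pc qc)
    then have "x \<ominus>\<^bsub>N\<^esub> q (p x) \<in> a_kernel N M p"
      using x by (simp add: pc qc pq a_kernel_def' M.diff_eq_zero_iff)
    moreover have "x = q (p x) \<oplus>\<^bsub>N\<^esub> (x \<ominus>\<^bsub>N\<^esub> q (p x))"
      using x by (simp add: pc qc N.add_diff_eq)
    ultimately show "x \<in> q ` carrier M <+>\<^bsub>N\<^esub> a_kernel N M p"
      using pc[OF x] unfolding set_add_iff by blast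
  qed (use submodule_subset[OF submodule_set_add[OF assms(2) sub]] in auto)
  show "direct_summand R (q ` carrier M) N"
    unfolding direct_summand_def using sub int sum by blast
qed

text \<open>Membership of \<open>X\<close> in \<open>add(M)\<close>, expressed by a pair of maps instead of a submodule of a
  power of \<open>M\<close>.\<close>

definition retract_of_power ::
  "('a, 'r) ring_scheme \<Rightarrow> ('a, 'm) module \<Rightarrow> ('a, 'x) module \<Rightarrow> bool" where
  "retract_of_power R M X \<longleftrightarrow> (\<exists>n p q. linear_map R (power_module M n) X p \<and>
     linear_map R X (power_module M n) q \<and> (\<forall>x\<in>carrier X. p (q x) = x))"

lemma retract_of_powerE:
  assumes "retract_of_power R M X"
  obtains n p q where "linear_map R (power_module M n) X p" "linear_map R X (power_module M n) q"
    "\<And>x. x \<in> carrier X \<Longrightarrow> p (q x) = x"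
  using assms unfolding retract_of_power_def by blast

lemma add_subcat_retract_of_power:
  assumes "left_module R M" "X \<in> add_subcat R M"
  shows "retract_of_power R M X"
proof -
  have X: "left_module R X" using assms(2) by (simp add: add_subcat_def)
  obtain n H f where H: "direct_summand R H (power_module M n)"
    and f: "linear_map R X (sub_module (power_module M n) H) f"
      "bij_betw f (carrier X) (carrier (sub_module (power_module M n) H))"
    using assms(2) X by (auto simp: add_subcat_def mod_isomorphic_iff)
  obtain K where HK: "submodule H R (power_module M n)" "submodule K R (power_module M n)"
    "H \<inter> K = {\<zero>\<^bsub>power_module M n\<^esub>}" "H <+>\<^bsub>power_module M n\<^esub> K = carrier (power_module M n)"
    using H unfolding direct_summand_def by blast
  obtain p where p: "linear_map R (power_module M n) (sub_module (power_module M n) H) p"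
    "\<And>x. x \<in> H \<Longrightarrow> p x = x"
    using direct_sum_projection[OF power_left_module[OF assms(1)] HK] by metis
  let ?g = "inv_into (carrier X) f"
  have "linear_map R (power_module M n) X (\<lambda>u. ?g (p u))"
    by (rule linear_map_comp[OF p(1) linear_map_inv[OF X f]])
  moreover have "linear_map R X (power_module M n) f"
    by (rule linear_map_sub_codD[OF HK(1) f(1)])
  moreover have "?g (p (f x)) = x" if "x \<in> carrier X" for x
    using that linear_map_closed[OF f(1) that] f(2) p(2) by (simp add: bij_betw_def)
  ultimately show ?thesis unfolding retract_of_power_def by blast
qed

lemma retract_of_powerI:
  assumes "left_module R M" "linear_map R M X p" "linear_map R X M q"
    and "\<And>x. x \<in> carrier X \<Longrightarrow> p (q x) = x"
  shows "retract_of_power R M X"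
proof -
  have "linear_map R (power_module M 1) X (\<lambda>u. p (u 0))"
    by (rule linear_map_comp[OF linear_map_nth assms(2)]) simp
  moreover have "linear_map R X (power_module M 1) (\<lambda>x. power_incl M 1 0 (q x))"
    by (rule linear_map_comp[OF assms(3) linear_map_power_incl[OF assms(1)]])
  ultimately show ?thesis
    unfolding retract_of_power_def
    by (intro exI[of _ 1] exI[of _ "\<lambda>u. p (u 0)"] exI[of _ "\<lambda>x. power_incl M 1 0 (q x)"])
      (simp add: power_incl_def assms(4))
qed

lemma retract_of_power_self: "left_module R M \<Longrightarrow> retract_of_power R M M"
  by (rule retract_of_powerI[OF _ linear_map_id linear_map_id refl])

lemma retract_of_power_power: "retract_of_power R M (power_module M n)"
  unfolding retract_of_power_def
  by (intro exI[of _ n] exI[of _ "\<lambda>x. x"]) (simp add: linear_map_id)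

text \<open>The basis vectors \<open>e i\<close> of a free module that retracts onto P are lifted
  one by one, and the lift is their linear extension preceded by \<open>q\<close>. The inclusion of
  images in place of surjectivity of \<open>g\<close> lets the lemma serve for maps onto a part of
  X.\<close>

lemma fg_projective_lift:
  assumes "ring R" "left_module R P" "fg_projective R P"
    and "left_module R A" "left_module R X" "linear_map R A X g" "linear_map R P X h"
    and sub: "h ` carrier P \<subseteq> g ` carrier A"
  obtains l where "linear_map R P A l" "\<And>x. x \<in> carrier P \<Longrightarrow> g (l x) = h x"
proof -
  interpret A: left_module R A by fact
  interpret X: left_module R X by fact
  let ?\<Lambda> = "regular_module R"
  have reg: "left_module R ?\<Lambda>" using assms(1) by (rule regular_left_module)
  obtain n p q where p: "linear_map R (power_module ?\<Lambda> n) P p"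
    and q: "linear_map R P (power_module ?\<Lambda> n) q" and pq: "\<And>x. x \<in> carrier P \<Longrightarrow> p (q x) = x"
    using retract_of_powerE[OF add_subcat_retract_of_power[OF reg assms(3)[unfolded fg_projective_def]]]
    by metis
  define e where "e i = power_incl ?\<Lambda> n i \<one>\<^bsub>R\<^esub>" for i
  have e: "e i \<in> carrier (power_module ?\<Lambda> n)" for i
    using power_incl_closed[OF reg, of "\<one>\<^bsub>R\<^esub>"] by (simp add: e_def)
  have "\<exists>a\<in>carrier A. g a = h (p (e i))" for i
    using subsetD[OF sub imageI[OF linear_map_closed[OF p e]]] by (metis imageE)
  then obtain a where a: "\<And>i. a i \<in> carrier A" "\<And>i. g (a i) = h (p (e i))" by metis
  define l where "l x = (\<Oplus>\<^bsub>A\<^esub>i\<in>{..<n}. (q x i) \<odot>\<^bsub>A\<^esub> a i)" for x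
  have cop: "linear_map R (power_module ?\<Lambda> n) A (\<lambda>u. \<Oplus>\<^bsub>A\<^esub>i\<in>{..<n}. u i \<odot>\<^bsub>A\<^esub> a i)"
    by (rule linear_map_copair[OF assms(4) linear_map_regular[OF assms(4) a(1)]])
  have "linear_map R P A l"
    unfolding l_def by (rule linear_map_comp[OF q cop])
  moreover have "g (l x) = h x" if x: "x \<in> carrier P" for x
  proof -
    have qx: "q x \<in> {..<n} \<rightarrow>\<^sub>E carrier ?\<Lambda>" using linear_map_closed[OF q x] by simp
    have qxi: "q x i \<in> carrier R" if "i < n" for i using PiE_nth[OF qx that] by simp
    have hp: "linear_map R (power_module ?\<Lambda> n) X (\<lambda>u. h (p u))"
      by (rule linear_map_comp[OF p assms(7)])
    have "g (l x) = (\<Oplus>\<^bsub>X\<^esub>i\<in>{..<n}. g (q x i \<odot>\<^bsub>A\<^esub> a i))"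
      unfolding l_def by (rule linear_map_finsum[OF assms(4-6)]) (auto simp: qxi a)
    also have "\<dots> = (\<Oplus>\<^bsub>X\<^esub>i\<in>{..<n}. h (p (power_incl ?\<Lambda> n i (q x i))))"
    proof (rule X.M.finsum_cong')
      have pi: "power_incl ?\<Lambda> n i (q x i) \<in> carrier (power_module ?\<Lambda> n)" if "i < n" for i
        using power_incl_closed[OF reg, of "q x i"] qxi[OF that] by simp
      show "(\<lambda>i. h (p (power_incl ?\<Lambda> n i (q x i)))) \<in> {..<n} \<rightarrow> carrier X"
        using linear_map_closed[OF hp pi] by auto
      fix i assume "i \<in> {..<n}"
      then have i: "q x i \<in> carrier R" using qxi by simp
      have "g (q x i \<odot>\<^bsub>A\<^esub> a i) = q x i \<odot>\<^bsub>X\<^esub> h (p (e i))"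
        using linear_map_smult[OF assms(6) i a(1)] a(2) by simp
      also have "\<dots> = h (p (power_incl ?\<Lambda> n i (q x i)))"
        using linear_map_regular_eq[OF assms(1) linear_map_comp[OF linear_map_power_incl[OF reg] hp] i]
        by (simp add: e_def)
      finally show "g (q x i \<odot>\<^bsub>A\<^esub> a i) = h (p (power_incl ?\<Lambda> n i (q x i)))" .
    qed simp
    also have "\<dots> = h (p (q x))"
      using linear_map_power_eq[OF reg assms(5) hp qx] by simp
    finally show ?thesis using pq x by simp
  qed
  ultimately show thesis using that by blast
qed

section \<open>The canonical free cover of a module\<close>

lemma free_cover_carrier:
  "carrier (free_cover R M) =
     {u \<in> carrier M \<rightarrow>\<^sub>E carrier R. finite {x \<in> carrier M. u x \<noteq> \<zero>\<^bsub>R\<^esub>}}"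
  by (simp add: free_cover_def)

lemma free_cover_simps [simp]:
  "\<zero>\<^bsub>free_cover R M\<^esub> = (\<lambda>x\<in>carrier M. \<zero>\<^bsub>R\<^esub>)"
  "u \<oplus>\<^bsub>free_cover R M\<^esub> v = (\<lambda>x\<in>carrier M. u x \<oplus>\<^bsub>R\<^esub> v x)"
  "r \<odot>\<^bsub>free_cover R M\<^esub> u = (\<lambda>x\<in>carrier M. r \<otimes>\<^bsub>R\<^esub> u x)"
  by (simp_all add: free_cover_def)

lemma free_cover_closed: "\<lbrakk>u \<in> carrier (free_cover R M); x \<in> carrier M\<rbrakk> \<Longrightarrow> u x \<in> carrier R"
  by (auto simp: free_cover_carrier PiE_def Pi_def)

lemma free_cover_finite:
  "u \<in> carrier (free_cover R M) \<Longrightarrow> finite {x \<in> carrier M. u x \<noteq> \<zero>\<^bsub>R\<^esub>}"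
  by (simp add: free_cover_carrier)

lemma free_cover_left_module:
  fixes M :: "('a, 'm) module"
  assumes "ring R"
  shows "left_module R (free_cover R M)"
proof -
  interpret ring R by fact
  let ?F = "free_cover R M"
  note c = free_cover_closed[where R = R and M = M]
  show ?thesis
  proof (rule left_moduleI)
    fix x y assume xy: "x \<in> carrier ?F" "y \<in> carrier ?F"
    have "finite {z \<in> carrier M. x z \<oplus>\<^bsub>R\<^esub> y z \<noteq> \<zero>\<^bsub>R\<^esub>}"
      by (rule finite_subset[OF _ finite_UnI[OF free_cover_finite[OF xy(1)] free_cover_finite[OF xy(2)]]])
        auto
    then show "x \<oplus>\<^bsub>?F\<^esub> y \<in> carrier ?F"
      using c[OF xy(1)] c[OF xy(2)] by (auto simp: free_cover_carrier cong: conj_cong)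
    show "x \<oplus>\<^bsub>?F\<^esub> y = y \<oplus>\<^bsub>?F\<^esub> x"
      using c[OF xy(1)] c[OF xy(2)] by (simp add: a_comm cong: restrict_cong)
  next
    fix r x assume rx: "r \<in> carrier R" "x \<in> carrier ?F"
    have "finite {z \<in> carrier M. r \<otimes>\<^bsub>R\<^esub> x z \<noteq> \<zero>\<^bsub>R\<^esub>}"
      by (rule finite_subset[OF _ free_cover_finite[OF rx(2)]]) (use rx in auto)
    then show "r \<odot>\<^bsub>?F\<^esub> x \<in> carrier ?F"
      using c[OF rx(2)] rx(1) by (auto simp: free_cover_carrier cong: conj_cong)
  next
    fix x assume x: "x \<in> carrier ?F"
    have ext: "(\<lambda>z\<in>carrier M. x z) = x"
      using x by (auto simp: free_cover_carrier PiE_def extensional_restrict)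
    show "\<zero>\<^bsub>?F\<^esub> \<oplus>\<^bsub>?F\<^esub> x = x" "\<one>\<^bsub>R\<^esub> \<odot>\<^bsub>?F\<^esub> x = x"
      using c[OF x] by (simp_all add: ext cong: restrict_cong)
  qed (simp_all add: c a_assoc l_distr r_distr m_assoc assms free_cover_carrier cong: restrict_cong)
qed

text \<open>The linear extension of a map of sets \<open>a\<close> given on the basis that the
  elements of M form; the sum runs over the support of \<open>u\<close>. For the identity of M it is
  the covering map itself.\<close>

definition free_cover_ext ::
  "('a, 'r) ring_scheme \<Rightarrow> ('a, 'm) module \<Rightarrow> ('a, 'n) module \<Rightarrow> ('m \<Rightarrow> 'n) \<Rightarrow> ('m \<Rightarrow> 'a) \<Rightarrow> 'n" where
  "free_cover_ext R M N a u = (\<Oplus>\<^bsub>N\<^esub>x\<in>{x \<in> carrier M. u x \<noteq> \<zero>\<^bsub>R\<^esub>}. u x \<odot>\<^bsub>N\<^esub> a x)"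

text \<open>Cancellation can make the support of a sum or of a multiple smaller than expected, so
  linearity is proved by summing over a common finite set on which the extra terms are zero.\<close>

lemma free_cover_ext_superset:
  assumes "left_module R N" "\<And>x. x \<in> carrier M \<Longrightarrow> a x \<in> carrier N"
    and "u \<in> carrier (free_cover R M)" "finite S" "{x \<in> carrier M. u x \<noteq> \<zero>\<^bsub>R\<^esub>} \<subseteq> S" "S \<subseteq> carrier M"
  shows "free_cover_ext R M N a u = (\<Oplus>\<^bsub>N\<^esub>x\<in>S. u x \<odot>\<^bsub>N\<^esub> a x)"
proof -
  interpret N: left_module R N by fact
  show ?thesis
    unfolding free_cover_ext_def
    by (rule N.M.add.finprod_mono_neutral_cong_left[OF assms(4,5)])
      (use assms(2,6) free_cover_closed[OF assms(3)] in \<open>auto simp: subset_iff\<close>)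
qed

lemma free_cover_ext_linear:
  assumes "left_module R N" "\<And>x. x \<in> carrier M \<Longrightarrow> a x \<in> carrier N"
  shows "linear_map R (free_cover R M) N (free_cover_ext R M N a)"
proof -
  interpret N: left_module R N by fact
  interpret F: left_module R "free_cover R M" by (rule free_cover_left_module) (rule N.R.ring_axioms)
  note c = free_cover_closed[where R = R and M = M]
  note ext = free_cover_ext_superset[where a = a, OF assms]
  show ?thesis
  proof (rule linear_mapI)
    fix u assume u: "u \<in> carrier (free_cover R M)"
    show "free_cover_ext R M N a u \<in> carrier N"
      unfolding free_cover_ext_def using c[OF u] assms(2) by (intro N.M.finsum_closed) auto
    { fix v assume v: "v \<in> carrier (free_cover R M)"
      define S where "S = {x \<in> carrier M. u x \<noteq> \<zero>\<^bsub>R\<^esub>} \<union> {x \<in> carrier M. v x \<noteq> \<zero>\<^bsub>R\<^esub>}"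
      have S: "finite S" "S \<subseteq> carrier M"
        using free_cover_finite[OF u] free_cover_finite[OF v] by (auto simp: S_def)
      have "free_cover_ext R M N a (u \<oplus>\<^bsub>free_cover R M\<^esub> v)
          = (\<Oplus>\<^bsub>N\<^esub>x\<in>S. (u \<oplus>\<^bsub>free_cover R M\<^esub> v) x \<odot>\<^bsub>N\<^esub> a x)"
        using F.M.a_closed[OF u v] S by (intro ext) (auto simp: S_def)
      also have "\<dots> = (\<Oplus>\<^bsub>N\<^esub>x\<in>S. u x \<odot>\<^bsub>N\<^esub> a x \<oplus>\<^bsub>N\<^esub> v x \<odot>\<^bsub>N\<^esub> a x)"
        using S c[OF u] c[OF v] assms(2)
        by (intro N.M.finsum_cong') (auto simp: subset_iff N.smult_l_distr)
      also have "\<dots> = (\<Oplus>\<^bsub>N\<^esub>x\<in>S. u x \<odot>\<^bsub>N\<^esub> a x) \<oplus>\<^bsub>N\<^esub> (\<Oplus>\<^bsub>N\<^esub>x\<in>S. v x \<odot>\<^bsub>N\<^esub> a x)"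
        using S c[OF u] c[OF v] assms(2) by (intro N.M.finsum_addf) (auto simp: subset_iff)
      also have "(\<Oplus>\<^bsub>N\<^esub>x\<in>S. u x \<odot>\<^bsub>N\<^esub> a x) = free_cover_ext R M N a u"
        using S by (intro ext[symmetric] u) (auto simp: S_def)
      also have "(\<Oplus>\<^bsub>N\<^esub>x\<in>S. v x \<odot>\<^bsub>N\<^esub> a x) = free_cover_ext R M N a v"
        using S by (intro ext[symmetric] v) (auto simp: S_def)
      finally show "free_cover_ext R M N a (u \<oplus>\<^bsub>free_cover R M\<^esub> v)
        = free_cover_ext R M N a u \<oplus>\<^bsub>N\<^esub> free_cover_ext R M N a v" . }
    fix r assume r: "r \<in> carrier R"
    define S where "S = {x \<in> carrier M. u x \<noteq> \<zero>\<^bsub>R\<^esub>}"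
    have S: "finite S" "S \<subseteq> carrier M" using free_cover_finite[OF u] by (auto simp: S_def)
    have "free_cover_ext R M N a (r \<odot>\<^bsub>free_cover R M\<^esub> u)
        = (\<Oplus>\<^bsub>N\<^esub>x\<in>S. (r \<odot>\<^bsub>free_cover R M\<^esub> u) x \<odot>\<^bsub>N\<^esub> a x)"
      using F.smult_closed[OF r u] S r by (intro ext) (auto simp: S_def)
    also have "\<dots> = (\<Oplus>\<^bsub>N\<^esub>x\<in>S. r \<odot>\<^bsub>N\<^esub> (u x \<odot>\<^bsub>N\<^esub> a x))"
      using S c[OF u] assms(2) r
      by (intro N.M.finsum_cong') (auto simp: subset_iff N.smult_assoc1)
    also have "\<dots> = r \<odot>\<^bsub>N\<^esub> (\<Oplus>\<^bsub>N\<^esub>x\<in>S. u x \<odot>\<^bsub>N\<^esub> a x)"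
      using S c[OF u] assms(2) r by (intro N.smult_finsum[symmetric]) (auto simp: subset_iff)
    finally show "free_cover_ext R M N a (r \<odot>\<^bsub>free_cover R M\<^esub> u)
        = r \<odot>\<^bsub>N\<^esub> free_cover_ext R M N a u"
      by (simp add: free_cover_ext_def S_def)
  qed
qed

lemma free_cover_ext_comp:
  assumes "left_module R N" "left_module R Y" "linear_map R N Y g"
    and "\<And>x. x \<in> carrier M \<Longrightarrow> a x \<in> carrier N" "u \<in> carrier (free_cover R M)"
  shows "g (free_cover_ext R M N a u) = free_cover_ext R M Y (\<lambda>x. g (a x)) u"
proof -
  interpret N: left_module R N by fact
  interpret Y: left_module R Y by fact
  note c = free_cover_closed[OF assms(5)] and gc = linear_map_closed[OF assms(3)]
  have "g (free_cover_ext R M N a u) = (\<Oplus>\<^bsub>Y\<^esub>x\<in>{x \<in> carrier M. u x \<noteq> \<zero>\<^bsub>R\<^esub>}. g (u x \<odot>\<^bsub>N\<^esub> a x))"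
    unfolding free_cover_ext_def
    by (rule linear_map_finsum[OF assms(1-3) free_cover_finite[OF assms(5)]]) (use c assms(4) in auto)
  also have "\<dots> = free_cover_ext R M Y (\<lambda>x. g (a x)) u"
    unfolding free_cover_ext_def
    using c assms(4) by (intro Y.M.finsum_cong') (auto simp: linear_map_smult[OF assms(3)] gc)
  finally show ?thesis .
qed

lemma free_cover_map_eq:
  "u \<in> carrier (free_cover R M) \<Longrightarrow> free_cover_map R M u = free_cover_ext R M M (\<lambda>x. x) u"
  by (simp add: free_cover_map_def free_cover_ext_def)

lemma free_cover_map_linear:
  assumes "left_module R M"
  shows "linear_map R (free_cover R M) M (free_cover_map R M)"
  by (rule linear_map_cong[OF free_cover_left_module[OF left_module_ring[OF assms]]
      free_cover_ext_linear[OF assms]]) (auto simp: free_cover_map_eq)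

lemma free_cover_map_surj:
  assumes "left_module R M"
  shows "free_cover_map R M ` carrier (free_cover R M) = carrier M"
proof (intro equalityI subsetI)
  interpret M: left_module R M by fact
  fix x assume x: "x \<in> carrier M"
  define u where "u = (\<lambda>y\<in>carrier M. if y = x then \<one>\<^bsub>R\<^esub> else \<zero>\<^bsub>R\<^esub>)"
  have "finite {y \<in> carrier M. u y \<noteq> \<zero>\<^bsub>R\<^esub>}"
    by (rule finite_subset[of _ "{x}"]) (auto simp: u_def)
  then have u: "u \<in> carrier (free_cover R M)" by (auto simp: free_cover_carrier u_def)
  \<comment> \<open>The sum is taken over \<open>{x}\<close> instead of the support of
    \<open>u\<close>, which is empty when \<open>\<one>\<close> equals
    \<open>\<zero>\<close>.\<close>
  have "free_cover_map R M u = (\<Oplus>\<^bsub>M\<^esub>y\<in>{x}. u y \<odot>\<^bsub>M\<^esub> y)"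
    unfolding free_cover_map_eq[OF u]
    by (rule free_cover_ext_superset[OF assms _ u]) (use x in \<open>auto simp: u_def\<close>)
  also have "\<dots> = x" using x by (simp add: u_def)
  finally show "x \<in> free_cover_map R M ` carrier (free_cover R M)" using u by (metis imageI)
qed (use linear_map_closed[OF free_cover_map_linear[OF assms]] in auto)

section \<open>Vanishing of $\mathrm{Ext}^1$\<close>

lemma linear_map_sum:
  assumes "left_module R A" "left_module R Y" "\<And>i. i < n \<Longrightarrow> linear_map R A Y (f i)"
  shows "linear_map R A Y (\<lambda>x. \<Oplus>\<^bsub>Y\<^esub>i\<in>{..<n::nat}. f i x)"
proof -
  interpret Y: left_module R Y by fact
  have "linear_map R A (power_module A n) (\<lambda>x. \<lambda>i\<in>{..<n}. x)"
    by (rule linear_map_tuple) (rule linear_map_id)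
  then have "linear_map R A Y (\<lambda>x. \<Oplus>\<^bsub>Y\<^esub>i\<in>{..<n}. f i ((\<lambda>i\<in>{..<n}. x) i))"
    by (rule linear_map_comp[OF _ linear_map_copair[OF assms(2,3)]])
  then show ?thesis
    by (rule linear_map_cong[OF assms(1)])
      (use linear_map_closed[OF assms(3)] in \<open>auto intro!: Y.M.finsum_cong'\<close>)
qed

lemma sub_module_finsum:
  assumes "left_module R M" "submodule H R M" "finite I" "\<And>i. i \<in> I \<Longrightarrow> f i \<in> H"
  shows "(\<Oplus>\<^bsub>sub_module M H\<^esub>i\<in>I. f i) = (\<Oplus>\<^bsub>M\<^esub>i\<in>I. f i)"
  using linear_map_finsum[OF submodule_left_module[OF assms(1,2)] assms(1) linear_map_incl[OF assms(2)]
      assms(3), of f] assms(4) by simp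

text \<open>Surjectivity of the restriction map whose cokernel is \<open>Ext1 R X Y\<close>, said
  with plain linear maps. After \<open>classical_tiltingD\<close> it is the only form in which Ext
  occurs.\<close>

definition ext_zero ::
  "('a, 'r) ring_scheme \<Rightarrow> ('a, 'm) module \<Rightarrow> ('a, 'n) module \<Rightarrow> bool" where
  "ext_zero R X Y \<longleftrightarrow> (\<forall>u. linear_map R (syzygy R X) Y u \<longrightarrow>
     (\<exists>e. linear_map R (free_cover R X) Y e \<and> (\<forall>z\<in>carrier (syzygy R X). e z = u z)))"

text \<open>In a trivial factor group the coset of the restricted \<open>u\<close> equals the set
  \<open>?H\<close> of restrictions. That coset contains \<open>u\<close>, since the zero map lies
  in \<open>?H\<close>; so \<open>u\<close> is itself a restriction. All of this is read off the
  carrier and the unit of the factor group.\<close>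

lemma Ext1_trivial_ext_zero:
  assumes "left_module R X" "left_module R Y" "trivial_group (Ext1 R X Y)"
  shows "ext_zero R X Y"
  unfolding ext_zero_def
proof (intro allI impI)
  interpret Y: left_module R Y by fact
  let ?F = "free_cover R X" and ?S = "syzygy R X"
  let ?G = "hom_group R ?S Y"
  let ?H = "(\<lambda>h. restrict h (carrier ?S)) ` mod_hom R ?F Y"
  have F: "left_module R ?F" by (rule free_cover_left_module) (rule Y.R.ring_axioms)
  have sub: "submodule (a_kernel ?F X (free_cover_map R X)) R ?F"
    by (rule linear_map_kernel[OF F assms(1) free_cover_map_linear[OF assms(1)]])
  have S: "left_module R ?S"
    unfolding syzygy_def by (rule submodule_left_module[OF F sub])
  have SF: "carrier ?S \<subseteq> carrier ?F" using submodule_subset[OF sub] by (simp add: syzygy_def)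
  fix u assume u: "linear_map R ?S Y u"
  let ?u = "restrict u (carrier ?S)"
  have uG: "?u \<in> carrier ?G" using restrict_mod_hom[OF S u] by (simp add: hom_group_def)
  have triv: "carrier (?G Mod ?H) = {\<one>\<^bsub>?G Mod ?H\<^esub>}"
    using assms(3) by (simp add: trivial_group_def Ext1_def)
  have "?H #>\<^bsub>?G\<^esub> ?u \<in> carrier (?G Mod ?H)"
    using uG by (auto simp: FactGroup_def RCOSETS_def)
  then have eq: "?H #>\<^bsub>?G\<^esub> ?u = ?H" using triv by (simp add: FactGroup_def)
  have zero: "restrict (restrict (\<lambda>x. \<zero>\<^bsub>Y\<^esub>) (carrier ?F)) (carrier ?S) \<in> ?H"
    by (rule imageI) (rule restrict_mod_hom[OF F linear_map_const_zero[OF assms(2)]])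
  have "restrict (restrict (\<lambda>x. \<zero>\<^bsub>Y\<^esub>) (carrier ?F)) (carrier ?S) \<otimes>\<^bsub>?G\<^esub> ?u = ?u"
    using linear_map_closed[OF u] SF
    by (auto simp: hom_group_def fun_eq_iff restrict_def subset_iff)
  then have "?u \<in> ?H #>\<^bsub>?G\<^esub> ?u" using zero unfolding r_coset_def by force
  then have "?u \<in> ?H" using eq by simp
  then obtain e where e: "e \<in> mod_hom R ?F Y" "?u = restrict e (carrier ?S)" by blast
  have "e z = u z" if "z \<in> carrier ?S" for z
    using fun_cong[OF e(2), of z] that by simp
  then show "\<exists>e. linear_map R ?F Y e \<and> (\<forall>z\<in>carrier ?S. e z = u z)"
    using mod_hom_linear[OF e(1)] by blast
qed

text \<open>The extension is given by \<open>h x = u (x - l z) + e z\<close> for any \<open>z\<close> with \<open>c z = q (g x)\<close>.\<close>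

lemma extend_from_kernel:
  assumes A: "left_module R A" and X: "left_module R X" and B: "left_module R B"
    and F: "left_module R F" and Y: "left_module R Y"
    and g: "linear_map R A X g"
    and c: "linear_map R F B c" "c ` carrier F = carrier B"
    and q: "linear_map R X B q" and p: "linear_map R B X p" "\<And>x. x \<in> carrier X \<Longrightarrow> p (q x) = x"
    and l: "linear_map R F A l" "\<And>z. z \<in> carrier F \<Longrightarrow> g (l z) = p (c z)"
    and u: "linear_map R (sub_module A (a_kernel A X g)) Y u"
    and e: "linear_map R F Y e" "\<And>z. \<lbrakk>z \<in> carrier F; c z = \<zero>\<^bsub>B\<^esub>\<rbrakk> \<Longrightarrow> e z = u (l z)"
  shows "\<exists>h. linear_map R A Y h \<and> (\<forall>x\<in>a_kernel A X g. h x = u x)"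
proof -
  interpret A: left_module R A by fact
  interpret X: left_module R X by fact
  interpret B: left_module R B by fact
  interpret F: left_module R F by fact
  interpret Y: left_module R Y by fact
  let ?K = "a_kernel A X g"
  have K: "submodule ?K R A" by (rule linear_map_kernel[OF A X g])
  note gc = linear_map_closed[OF g] and qc = linear_map_closed[OF q] and lc = linear_map_closed[OF l(1)]
    and ec = linear_map_closed[OF e(1)] and cc = linear_map_closed[OF c(1)]
  note Kc = submodule_carrier[OF K]
  have uc: "u x \<in> carrier Y" if "x \<in> ?K" for x using linear_map_closed[OF u] that by simp
  have uadd: "u (x \<oplus>\<^bsub>A\<^esub> y) = u x \<oplus>\<^bsub>Y\<^esub> u y" if "x \<in> ?K" "y \<in> ?K" for x y
    using linear_map_add[OF u] that by simp
  have usmult: "u (r \<odot>\<^bsub>A\<^esub> x) = r \<odot>\<^bsub>Y\<^esub> u x" if "r \<in> carrier R" "x \<in> ?K" for r x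
    using linear_map_smult[OF u] that by simp
  \<comment> \<open>\<open>g (l z) = p (c z) = p (q (g x)) = g x\<close>, so the difference lies in
    the kernel, where \<open>u\<close> is defined.\<close>
  have dK: "x \<ominus>\<^bsub>A\<^esub> l z \<in> ?K" if "x \<in> carrier A" "z \<in> carrier F" "c z = q (g x)" for x z
    using that p(2)[of "g x"] by (simp add: a_kernel_def' linear_map_diff[OF A X g] lc l(2) gc
        X.diff_eq_zero_iff)
  define s where "s b = (SOME z. z \<in> carrier F \<and> c z = b)" for b
  have s: "s b \<in> carrier F" "c (s b) = b" if "b \<in> carrier B" for b
  proof -
    have "\<exists>z. z \<in> carrier F \<and> c z = b" using that c(2) by (metis imageE)
    then show "s b \<in> carrier F" "c (s b) = b" unfolding s_def by (metis (mono_tags, lifting) someI_ex)+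
  qed
  define h where "h x = u (x \<ominus>\<^bsub>A\<^esub> l (s (q (g x)))) \<oplus>\<^bsub>Y\<^esub> e (s (q (g x)))" for x
  \<comment> \<open>Independence of the lift \<open>z\<close>: it differs from the chosen lift
    \<open>w\<close> by an element \<open>d\<close> killed by \<open>c\<close>, and
    \<open>e d = u (l d)\<close> makes the changes in the two summands cancel. Linearity then
    follows by choosing lifts that add up.\<close>
  have h: "h x = u (x \<ominus>\<^bsub>A\<^esub> l z) \<oplus>\<^bsub>Y\<^esub> e z"
    if x: "x \<in> carrier A" and z: "z \<in> carrier F" "c z = q (g x)" for x z
  proof -
    define w where "w = s (q (g x))"
    have w: "w \<in> carrier F" "c w = q (g x)" using s x by (simp_all add: w_def gc qc)
    define d where "d = w \<ominus>\<^bsub>F\<^esub> z"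
    have d: "d \<in> carrier F" "c d = \<zero>\<^bsub>B\<^esub>"
      using w z x by (simp_all add: d_def linear_map_diff[OF F B c(1)] B.diff_eq_zero_iff gc qc)
    have ld: "l d \<in> ?K"
      using d linear_map_zero[OF B X p(1)] by (simp add: a_kernel_def' lc l(2))
    have wd: "w = z \<oplus>\<^bsub>F\<^esub> d" using w z by (simp add: d_def F.add_diff_eq)
    have "x \<ominus>\<^bsub>A\<^esub> l z = (x \<ominus>\<^bsub>A\<^esub> l w) \<oplus>\<^bsub>A\<^esub> l d"
      using x z(1) d(1) unfolding wd linear_map_add[OF l(1) z(1) d(1)]
      by (simp add: lc A.M.minus_eq A.M.minus_add A.M.a_assoc A.M.l_neg)
    then have "u (x \<ominus>\<^bsub>A\<^esub> l z) = u (x \<ominus>\<^bsub>A\<^esub> l w) \<oplus>\<^bsub>Y\<^esub> u (l d)"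
      using uadd[OF dK[OF x w] ld] by simp
    then have "u (x \<ominus>\<^bsub>A\<^esub> l z) \<oplus>\<^bsub>Y\<^esub> e z = u (x \<ominus>\<^bsub>A\<^esub> l w) \<oplus>\<^bsub>Y\<^esub> (e z \<oplus>\<^bsub>Y\<^esub> e d)"
      using e(2)[OF d] z(1) d(1) uc[OF ld] uc[OF dK[OF x w]] ec by (simp add: Y.M.a_ac)
    then show ?thesis
      using z(1) d(1) by (simp add: h_def w_def[symmetric] wd linear_map_add[OF e(1)])
  qed
  have lift: "\<exists>z. z \<in> carrier F \<and> c z = q (g x)" if "x \<in> carrier A" for x
    using s that gc qc by blast
  show ?thesis
  proof (intro exI[of _ h] conjI ballI)
    show "linear_map R A Y h"
    proof (rule linear_mapI)
      fix x assume x: "x \<in> carrier A"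
      then obtain z where z: "z \<in> carrier F" "c z = q (g x)" using lift by blast
      show "h x \<in> carrier Y" unfolding h[OF x z] using uc[OF dK[OF x z]] ec[OF z(1)] by simp
      { fix y assume y: "y \<in> carrier A"
        then obtain w where w: "w \<in> carrier F" "c w = q (g y)" using lift by blast
        have "c (z \<oplus>\<^bsub>F\<^esub> w) = q (g (x \<oplus>\<^bsub>A\<^esub> y))"
          using x y z w by (simp add: linear_map_add[OF c(1)] linear_map_add[OF g] linear_map_add[OF q] gc)
        then have "h (x \<oplus>\<^bsub>A\<^esub> y) = u ((x \<oplus>\<^bsub>A\<^esub> y) \<ominus>\<^bsub>A\<^esub> l (z \<oplus>\<^bsub>F\<^esub> w)) \<oplus>\<^bsub>Y\<^esub> e (z \<oplus>\<^bsub>F\<^esub> w)"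
          using x y z w by (intro h) auto
        also have "(x \<oplus>\<^bsub>A\<^esub> y) \<ominus>\<^bsub>A\<^esub> l (z \<oplus>\<^bsub>F\<^esub> w) = (x \<ominus>\<^bsub>A\<^esub> l z) \<oplus>\<^bsub>A\<^esub> (y \<ominus>\<^bsub>A\<^esub> l w)"
          using x y z w by (simp add: linear_map_add[OF l(1)] lc A.M.minus_eq A.M.minus_add A.M.a_ac)
        also have "u \<dots> = u (x \<ominus>\<^bsub>A\<^esub> l z) \<oplus>\<^bsub>Y\<^esub> u (y \<ominus>\<^bsub>A\<^esub> l w)"
          by (rule uadd[OF dK[OF x z] dK[OF y w]])
        finally show "h (x \<oplus>\<^bsub>A\<^esub> y) = h x \<oplus>\<^bsub>Y\<^esub> h y"
          unfolding h[OF x z] h[OF y w] using uc[OF dK[OF x z]] uc[OF dK[OF y w]] z w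
          by (simp add: linear_map_add[OF e(1)] ec Y.M.a_ac) }
      fix r assume r: "r \<in> carrier R"
      have "c (r \<odot>\<^bsub>F\<^esub> z) = q (g (r \<odot>\<^bsub>A\<^esub> x))"
        using x r z by (simp add: linear_map_smult[OF c(1)] linear_map_smult[OF g] linear_map_smult[OF q] gc)
      then have "h (r \<odot>\<^bsub>A\<^esub> x) = u (r \<odot>\<^bsub>A\<^esub> x \<ominus>\<^bsub>A\<^esub> l (r \<odot>\<^bsub>F\<^esub> z)) \<oplus>\<^bsub>Y\<^esub> e (r \<odot>\<^bsub>F\<^esub> z)"
        using x r z by (intro h) auto
      also have "r \<odot>\<^bsub>A\<^esub> x \<ominus>\<^bsub>A\<^esub> l (r \<odot>\<^bsub>F\<^esub> z) = r \<odot>\<^bsub>A\<^esub> (x \<ominus>\<^bsub>A\<^esub> l z)"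
        using x r z by (simp add: linear_map_smult[OF l(1)] lc A.M.minus_eq A.smult_r_distr A.smult_r_minus)
      also have "u \<dots> = r \<odot>\<^bsub>Y\<^esub> u (x \<ominus>\<^bsub>A\<^esub> l z)" by (rule usmult[OF r dK[OF x z]])
      finally show "h (r \<odot>\<^bsub>A\<^esub> x) = r \<odot>\<^bsub>Y\<^esub> h x"
        unfolding h[OF x z] using uc[OF dK[OF x z]] z r
        by (simp add: linear_map_smult[OF e(1)] ec Y.smult_r_distr)
    qed
    fix x assume x: "x \<in> ?K"
    then have "h x = u (x \<ominus>\<^bsub>A\<^esub> l \<zero>\<^bsub>F\<^esub>) \<oplus>\<^bsub>Y\<^esub> e \<zero>\<^bsub>F\<^esub>"
      using Kc[OF x] linear_map_zero[OF F B c(1)] linear_map_zero[OF X B q]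
      by (intro h) (auto simp: a_kernel_def')
    then show "h x = u x"
      using linear_map_zero[OF F A l(1)] linear_map_zero[OF F Y e(1)] Kc[OF x] uc[OF x]
      by (simp add: A.diff_zero)
  qed
qed

text \<open>The passage from the canonical presentation of T to an arbitrary surjection onto a
  module in add(T). Each map from T to X given by a coordinate of the power is lifted along
  \<open>g\<close> to the free cover of T; the lift takes the syzygy into the kernel of
  \<open>g\<close>, and its composite with \<open>u\<close> extends by hypothesis. A power of the
  free cover collects the coordinates, and \<open>extend_from_kernel\<close> applies.\<close>

lemma ext_zero_extend:
  assumes T: "left_module R T" and A: "left_module R A" and X: "left_module R X" and Y: "left_module R Y"
    and ext: "ext_zero R T Y" and "retract_of_power R T X"
    and g: "linear_map R A X g" "g ` carrier A = carrier X"
    and u: "linear_map R (sub_module A (a_kernel A X g)) Y u"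
  obtains h where "linear_map R A Y h" "\<And>x. x \<in> a_kernel A X g \<Longrightarrow> h x = u x"
proof -
  interpret T: left_module R T by fact
  interpret A: left_module R A by fact
  interpret X: left_module R X by fact
  interpret Y: left_module R Y by fact
  obtain n p q where p: "linear_map R (power_module T n) X p" and q: "linear_map R X (power_module T n) q"
    and pq: "\<And>x. x \<in> carrier X \<Longrightarrow> p (q x) = x"
    using retract_of_powerE[OF assms(6)] by metis
  let ?F = "free_cover R T" and ?c = "free_cover_map R T"
  have F: "left_module R ?F" by (rule free_cover_left_module) (rule T.R.ring_axioms)
  have c: "linear_map R ?F T ?c" "?c ` carrier ?F = carrier T"
    using free_cover_map_linear[OF T] free_cover_map_surj[OF T] .
  note Fn = power_left_module[OF F, of n] and Tn = power_left_module[OF T, of n]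
  have S: "syzygy R T = sub_module ?F (a_kernel ?F T ?c)" by (simp add: syzygy_def)
  have Ssub: "submodule (a_kernel ?F T ?c) R ?F" by (rule linear_map_kernel[OF F T c(1)])
  have Ksub: "submodule (a_kernel A X g) R A" by (rule linear_map_kernel[OF A X g(1)])
  have K: "left_module R (sub_module A (a_kernel A X g))" by (rule submodule_left_module[OF A Ksub])
  define i where "i = power_incl T n"
  have i: "linear_map R T (power_module T n) (i j)" for j
    unfolding i_def by (rule linear_map_power_incl[OF T])
  have pi: "linear_map R T X (\<lambda>t. p (i j t))" for j
    by (rule linear_map_comp[OF i p])
  \<comment> \<open>A choice of preimages as a map of sets is enough, since the free cover has a
    basis indexed by the elements of T.\<close>
  have "\<exists>a. \<forall>t\<in>carrier T. a t \<in> carrier A \<and> g (a t) = p (i j t)" for j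
    using linear_map_closed[OF pi] g(2) by (intro bchoice) (metis imageE)
  then obtain a where a: "\<And>j t. t \<in> carrier T \<Longrightarrow> a j t \<in> carrier A"
    "\<And>j t. t \<in> carrier T \<Longrightarrow> g (a j t) = p (i j t)" by metis
  define l where "l j = free_cover_ext R T A (a j)" for j
  have l: "linear_map R ?F A (l j)" for j
    unfolding l_def by (rule free_cover_ext_linear[OF A a(1)])
  have gl: "g (l j z) = p (i j (?c z))" if z: "z \<in> carrier ?F" for j z
  proof -
    have "g (l j z) = free_cover_ext R T X (\<lambda>t. g (a j t)) z"
      unfolding l_def by (rule free_cover_ext_comp[OF A X g(1) a(1) z])
    also have "\<dots> = free_cover_ext R T X (\<lambda>t. p (i j t)) z"
      unfolding free_cover_ext_def using free_cover_closed[OF z]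
      by (intro X.M.finsum_cong') (auto simp: a(2) linear_map_closed[OF pi])
    also have "\<dots> = p (i j (?c z))"
      unfolding free_cover_map_eq[OF z] by (rule free_cover_ext_comp[OF T X pi _ z, symmetric]) simp
    finally show ?thesis .
  qed
  have lS: "l j z \<in> a_kernel A X g" if "z \<in> a_kernel ?F T ?c" for j z
    using that linear_map_zero[OF T X pi] linear_map_closed[OF l] gl by (auto simp: a_kernel_def')
  have "\<exists>e. linear_map R ?F Y e \<and> (\<forall>z\<in>a_kernel ?F T ?c. e z = u (l j z))" for j
  proof -
    have "linear_map R (syzygy R T) Y (\<lambda>z. u (l j z))"
      unfolding S by (rule linear_map_comp[OF linear_map_sub_cod[OF linear_map_sub_dom[OF Ssub l]] u])
        (simp add: lS)
    then show ?thesis using ext unfolding ext_zero_def S by simp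
  qed
  then obtain e where e: "\<And>j. linear_map R ?F Y (e j)"
    "\<And>j z. z \<in> a_kernel ?F T ?c \<Longrightarrow> e j z = u (l j z)" by metis
  define c' where "c' z = (\<lambda>j\<in>{..<n}. ?c (z j))" for z
  define l' where "l' z = (\<Oplus>\<^bsub>A\<^esub>j\<in>{..<n}. l j (z j))" for z
  define e' where "e' z = (\<Oplus>\<^bsub>Y\<^esub>j\<in>{..<n}. e j (z j))" for z
  have nth: "z j \<in> carrier ?F" if "z \<in> carrier (power_module ?F n)" "j < n" for z j
    using that PiE_nth by fastforce
  have c': "linear_map R (power_module ?F n) (power_module T n) c'"
    unfolding c'_def[abs_def] by (rule linear_map_tuple[OF linear_map_comp[OF linear_map_nth c(1)]])
  have c's: "c' ` carrier (power_module ?F n) = carrier (power_module T n)"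
  proof (intro equalityI subsetI)
    fix t assume "t \<in> carrier (power_module T n)"
    then have t: "t \<in> {..<n} \<rightarrow>\<^sub>E carrier T" by simp
    then have "t j \<in> ?c ` carrier ?F" if "j < n" for j
      using PiE_nth[OF t that] c(2) by simp
    then have "\<exists>z. j < n \<longrightarrow> z \<in> carrier ?F \<and> ?c z = t j" for j by force
    then obtain z where z: "\<And>j. j < n \<Longrightarrow> z j \<in> carrier ?F" "\<And>j. j < n \<Longrightarrow> ?c (z j) = t j" by metis
    have "c' (\<lambda>j\<in>{..<n}. z j) = t"
      unfolding c'_def using z t by (intro PiE_eqI[of _ n "carrier T" t "carrier T"]) (auto simp: PiE_nth)
    moreover have "(\<lambda>j\<in>{..<n}. z j) \<in> carrier (power_module ?F n)" using z by auto
    ultimately show "t \<in> c' ` carrier (power_module ?F n)" by blast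
  qed (use linear_map_closed[OF c'] in blast)
  have l': "linear_map R (power_module ?F n) A l'"
    unfolding l'_def[abs_def] by (rule linear_map_copair[OF A l])
  have e': "linear_map R (power_module ?F n) Y e'"
    unfolding e'_def[abs_def] by (rule linear_map_copair[OF Y e(1)])
  have gl': "g (l' z) = p (c' z)" if z: "z \<in> carrier (power_module ?F n)" for z
  proof -
    have "g (l' z) = (\<Oplus>\<^bsub>X\<^esub>j\<in>{..<n}. g (l j (z j)))"
      unfolding l'_def by (rule linear_map_finsum[OF A X g(1)])
        (use linear_map_closed[OF l nth[OF z]] in auto)
    also have "\<dots> = (\<Oplus>\<^bsub>X\<^esub>j\<in>{..<n}. p (i j (c' z j)))"
      using gl[OF nth[OF z]] linear_map_closed[OF pi linear_map_closed[OF c(1) nth[OF z]]]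
      by (intro X.M.finsum_cong') (auto simp: c'_def)
    also have "\<dots> = p (c' z)"
      using linear_map_power_eq[OF T X p] linear_map_closed[OF c' z] by (simp add: i_def)
    finally show ?thesis .
  qed
  \<comment> \<open>A tuple killed by \<open>c'\<close> has all its entries in the syzygy, where
    \<open>e j\<close> is \<open>u\<close> after \<open>l j\<close> by construction.\<close>
  have eu: "e' z = u (l' z)"
    if z: "z \<in> carrier (power_module ?F n)" "c' z = \<zero>\<^bsub>power_module T n\<^esub>" for z
  proof -
    have zj: "z j \<in> a_kernel ?F T ?c" if "j < n" for j
      using nth[OF z(1) that] fun_cong[OF z(2), of j] that by (simp add: a_kernel_def' c'_def)
    have uc: "u (l j (z j)) \<in> carrier Y" if "j < n" for j
      using linear_map_closed[OF u] lS[OF zj[OF that]] by simp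
    have "e' z = (\<Oplus>\<^bsub>Y\<^esub>j\<in>{..<n}. u (l j (z j)))"
      unfolding e'_def using e(2)[OF zj] uc by (intro Y.M.finsum_cong') auto
    also have "\<dots> = u (\<Oplus>\<^bsub>sub_module A (a_kernel A X g)\<^esub>j\<in>{..<n}. l j (z j))"
      using lS[OF zj] by (intro linear_map_finsum[OF K Y u, symmetric]) auto
    also have "(\<Oplus>\<^bsub>sub_module A (a_kernel A X g)\<^esub>j\<in>{..<n}. l j (z j)) = l' z"
      unfolding l'_def by (rule sub_module_finsum[OF A Ksub]) (use lS[OF zj] in auto)
    finally show ?thesis .
  qed
  show thesis
    using extend_from_kernel[where c = c' and p = p and q = q and l = l' and e = e' and g = g and u = u,
        OF A X Tn Fn Y g(1) c' c's q p pq l' gl' u e' eu] that by blast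
qed

text \<open>The case of \<open>ext_zero_extend\<close> in which the surjection is the free cover of
  X.\<close>

lemma ext_zero_retract:
  assumes "left_module R T" "left_module R X" "left_module R Y"
    and "ext_zero R T Y" "retract_of_power R T X"
  shows "ext_zero R X Y"
  unfolding ext_zero_def
proof (intro allI impI)
  fix u assume u: "linear_map R (syzygy R X) Y u"
  have F: "left_module R (free_cover R X)"
    by (rule free_cover_left_module[OF left_module_ring[OF assms(1)]])
  show "\<exists>e. linear_map R (free_cover R X) Y e \<and> (\<forall>z\<in>carrier (syzygy R X). e z = u z)"
    using ext_zero_extend[OF assms(1) F assms(2-5) free_cover_map_linear[OF assms(2)]
        free_cover_map_surj[OF assms(2)] u[unfolded syzygy_def]]
    by (simp add: syzygy_def) metis
qed

text \<open>Maps into Y are pushed into a power of T by \<open>q\<close>, extended there one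
  coordinate at a time, and brought back by \<open>p\<close>.\<close>

lemma ext_zero_retract_right:
  assumes X: "left_module R X" and T: "left_module R T" and Y: "left_module R Y"
    and ext: "ext_zero R X T" and "retract_of_power R T Y"
  shows "ext_zero R X Y"
  unfolding ext_zero_def
proof (intro allI impI)
  fix u assume u: "linear_map R (syzygy R X) Y u"
  let ?F = "free_cover R X" and ?S = "syzygy R X"
  have F: "left_module R ?F" by (rule free_cover_left_module[OF left_module_ring[OF X]])
  have Ssub: "submodule (carrier ?S) R ?F"
    using linear_map_kernel[OF F X free_cover_map_linear[OF X]] by (simp add: syzygy_def)
  obtain n p q where p: "linear_map R (power_module T n) Y p" and q: "linear_map R Y (power_module T n) q"
    and pq: "\<And>x. x \<in> carrier Y \<Longrightarrow> p (q x) = x"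
    using retract_of_powerE[OF assms(5)] by metis
  have "linear_map R ?S T (\<lambda>z. q (u z) j)" if "j < n" for j
    by (rule linear_map_comp[OF linear_map_comp[OF u q] linear_map_nth[OF that]])
  then have "\<exists>e. j < n \<longrightarrow> linear_map R ?F T e \<and> (\<forall>z\<in>carrier ?S. e z = q (u z) j)" for j
    using ext unfolding ext_zero_def by (cases "j < n") auto
  then obtain e where e: "\<And>j. j < n \<Longrightarrow> linear_map R ?F T (e j)"
    "\<And>j z. \<lbrakk>j < n; z \<in> carrier ?S\<rbrakk> \<Longrightarrow> e j z = q (u z) j" by metis
  define e' where "e' z = (\<lambda>j\<in>{..<n}. e j z)" for z
  have e': "linear_map R ?F (power_module T n) e'"
    unfolding e'_def[abs_def] by (rule linear_map_tuple[OF e(1)])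
  have "p (e' z) = u z" if z: "z \<in> carrier ?S" for z
  proof -
    have uz: "u z \<in> carrier Y" by (rule linear_map_closed[OF u z])
    have "z \<in> carrier ?F" by (rule submodule_carrier[OF Ssub z])
    then have "e' z = q (u z)"
      using linear_map_closed[OF e'] linear_map_closed[OF q uz] e(2)[OF _ z]
      by (intro PiE_eqI[of _ n "carrier T" _ "carrier T"]) (auto simp: e'_def)
    then show ?thesis using pq[OF uz] by simp
  qed
  then show "\<exists>e. linear_map R ?F Y e \<and> (\<forall>z\<in>carrier ?S. e z = u z)"
    using linear_map_comp[OF e' p] by blast
qed

text \<open>Generation is pointwise: the power may depend on the element, so the notion applies to
  kernels before anything is known about their finite generation.\<close>

definition generated_by ::
  "('a, 'r) ring_scheme \<Rightarrow> ('a, 'm) module \<Rightarrow> ('a, 'x) module \<Rightarrow> bool" where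
  "generated_by R M X \<longleftrightarrow> (\<forall>x\<in>carrier X. \<exists>n v t. linear_map R (power_module M n) X v \<and>
     t \<in> carrier (power_module M n) \<and> v t = x)"

text \<open>Right exactness of \<open>Ext\<^sup>1(T,-)\<close>: on the first syzygy \<open>P1\<close>, a map to \<open>Y\<close> is a sum of maps
  which factor through powers of \<open>T\<close>.\<close>

lemma ext_zero_generated:
  assumes T: "left_module R T" and Y: "left_module R Y"
    and "proj_dim_le_1 R T" "ext_zero R T T" "generated_by R T Y"
  shows "ext_zero R T Y"
  unfolding ext_zero_def
proof (intro allI impI)
  fix u assume u: "linear_map R (syzygy R T) Y u"
  interpret Y: left_module R Y by fact
  have R: "ring R" by (rule Y.R.ring_axioms)
  let ?F = "free_cover R T" and ?c = "free_cover_map R T" and ?\<Lambda> = "regular_module R"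
  have reg: "left_module R ?\<Lambda>" using R by (rule regular_left_module)
  have F: "left_module R ?F" by (rule free_cover_left_module[OF R])
  note c = free_cover_map_linear[OF T]
  obtain P1 P0 :: "('a, nat \<Rightarrow> 'a) module" and f \<pi> where
    P: "fg_projective R P1" "fg_projective R P0" and ex: "short_exact R P1 f P0 \<pi> T"
    using assms(3) unfolding proj_dim_le_1_def by metis
  have P1: "left_module R P1" and P0: "left_module R P0"
    using P by (simp_all add: fg_projective_def add_subcat_def)
  have f: "linear_map R P1 P0 f" "inj_on f (carrier P1)" "f ` carrier P1 = a_kernel P0 T \<pi>"
    and \<pi>: "linear_map R P0 T \<pi>" "\<pi> ` carrier P0 = carrier T"
    using ex by (simp_all add: short_exact_def mod_hom_linear)
  \<comment> \<open>The projective resolution is compared with the canonical presentation over the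
    identity of T; \<open>l\<close> takes the kernel of \<open>\<pi>\<close>, which is a copy of P1,
    into the syzygy.\<close>
  obtain l where l: "linear_map R P0 ?F l" "\<And>x. x \<in> carrier P0 \<Longrightarrow> ?c (l x) = \<pi> x"
    using fg_projective_lift[OF R P0 P(2) F T c \<pi>(1)] free_cover_map_surj[OF T] \<pi>(2) by (metis order_refl)
  let ?K = "a_kernel P0 T \<pi>"
  have Ksub: "submodule ?K R P0" by (rule linear_map_kernel[OF P0 T \<pi>(1)])
  have K: "left_module R (sub_module P0 ?K)" by (rule submodule_left_module[OF P0 Ksub])
  have fK: "linear_map R P1 (sub_module P0 ?K) f"
    by (rule linear_map_sub_cod[OF f(1)]) (use f(3) in blast)
  have fK_bij: "bij_betw f (carrier P1) (carrier (sub_module P0 ?K))"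
    using f(2,3) by (simp add: bij_betw_def)
  note f_inv = linear_map_inv[OF P1 fK fK_bij]
  let ?f = "inv_into (carrier P1) f"
  have lK: "l x \<in> a_kernel ?F T ?c" if "x \<in> ?K" for x
    using that linear_map_closed[OF l(1)] l(2) by (auto simp: a_kernel_def')
  have ul: "linear_map R (sub_module P0 ?K) Y (\<lambda>x. u (l x))"
    by (rule linear_map_comp[OF linear_map_sub_cod[OF linear_map_sub_dom[OF Ksub l(1)]] u[unfolded syzygy_def]])
      (simp add: lK)
  have w0: "linear_map R P1 Y (\<lambda>x. u (l (f x)))"
    by (rule linear_map_comp[OF fK ul])
  obtain n p q where p: "linear_map R (power_module ?\<Lambda> n) P1 p" and q: "linear_map R P1 (power_module ?\<Lambda> n) q"
    and pq: "\<And>x. x \<in> carrier P1 \<Longrightarrow> p (q x) = x"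
    using retract_of_powerE[OF add_subcat_retract_of_power[OF reg P(1)[unfolded fg_projective_def]]] by metis
  define b where "b i = power_incl ?\<Lambda> n i \<one>\<^bsub>R\<^esub>" for i
  have b: "b i \<in> carrier (power_module ?\<Lambda> n)" for i
    using power_incl_closed[OF reg, of "\<one>\<^bsub>R\<^esub>"] by (simp add: b_def)
  have up: "linear_map R (power_module ?\<Lambda> n) Y (\<lambda>x. u (l (f (p x))))"
    by (rule linear_map_comp[OF p w0])
  define y where "y i = u (l (f (p (b i))))" for i
  have y: "y i \<in> carrier Y" for i unfolding y_def by (rule linear_map_closed[OF up b])
  have "\<exists>m v t. linear_map R (power_module T m) Y v \<and> t \<in> carrier (power_module T m) \<and> v t = y i" for i
    using assms(5) y unfolding generated_by_def by blast
  then obtain m v t where v: "\<And>i. linear_map R (power_module T (m i)) Y (v i)"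
    and t: "\<And>i. t i \<in> carrier (power_module T (m i))" and vt: "\<And>i. v i (t i) = y i" by metis
  have Tm: "left_module R (power_module T (m i))" for i by (rule power_left_module[OF T])
  \<comment> \<open>The i-th coordinate on P1 times \<open>t i\<close>. Followed by
    \<open>v i\<close> it becomes the i-th term of the map from P1 to Y, but its own values lie in a
    power of T, where the Ext hypothesis extends it to P0.\<close>
  have w: "linear_map R P1 (power_module T (m i)) (\<lambda>x. q x i \<odot>\<^bsub>power_module T (m i)\<^esub> t i)" if "i < n" for i
    by (rule linear_map_comp[OF linear_map_comp[OF q linear_map_nth[OF that]] linear_map_regular[OF Tm t]])
  have "\<exists>e. i < n \<longrightarrow> linear_map R P0 (power_module T (m i)) e \<and>
      (\<forall>x\<in>?K. e x = q (?f x) i \<odot>\<^bsub>power_module T (m i)\<^esub> t i)" for i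
  proof (cases "i < n")
    case True
    have "ext_zero R T (power_module T (m i))"
      by (rule ext_zero_retract_right[OF T T Tm assms(4) retract_of_power_power])
    from ext_zero_extend[OF T P0 T Tm this retract_of_power_self[OF T] \<pi> linear_map_comp[OF f_inv w[OF True]]]
    show ?thesis by metis
  qed auto
  then obtain e where e: "\<And>i. i < n \<Longrightarrow> linear_map R P0 (power_module T (m i)) (e i)"
    "\<And>i x. \<lbrakk>i < n; x \<in> ?K\<rbrakk> \<Longrightarrow> e i x = q (?f x) i \<odot>\<^bsub>power_module T (m i)\<^esub> t i" by metis
  define e' where "e' x = (\<Oplus>\<^bsub>Y\<^esub>i\<in>{..<n}. v i (e i x))" for x
  have e': "linear_map R P0 Y e'"
    unfolding e'_def[abs_def] by (rule linear_map_sum[OF P0 Y linear_map_comp[OF e(1) v]])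
  have eu: "e' x = u (l x)" if x: "x \<in> carrier P0" "\<pi> x = \<zero>\<^bsub>T\<^esub>" for x
  proof -
    have xK: "x \<in> ?K" using x by (simp add: a_kernel_def')
    then have fx: "?f x \<in> carrier P1" "f (?f x) = x"
      using linear_map_closed[OF f_inv] f(3) by (simp_all add: f_inv_into_f)
    have qx: "q (?f x) \<in> {..<n} \<rightarrow>\<^sub>E carrier ?\<Lambda>" using linear_map_closed[OF q fx(1)] by simp
    have qxi: "q (?f x) i \<in> carrier R" if "i < n" for i using PiE_nth[OF qx that] by simp
    have "e' x = (\<Oplus>\<^bsub>Y\<^esub>i\<in>{..<n}. u (l (f (p (power_incl ?\<Lambda> n i (q (?f x) i))))))"
      unfolding e'_def
    proof (rule Y.M.finsum_cong')
      have "power_incl ?\<Lambda> n i (q (?f x) i) \<in> carrier (power_module ?\<Lambda> n)" if "i < n" for i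
        using power_incl_closed[OF reg, of "q (?f x) i"] qxi[OF that] by simp
      then show "(\<lambda>i. u (l (f (p (power_incl ?\<Lambda> n i (q (?f x) i)))))) \<in> {..<n} \<rightarrow> carrier Y"
        using linear_map_closed[OF up] by blast
      fix i assume "i \<in> {..<n}"
      then have i: "i < n" by simp
      have "v i (e i x) = q (?f x) i \<odot>\<^bsub>Y\<^esub> y i"
        unfolding e(2)[OF i xK] linear_map_smult[OF v qxi[OF i] t] vt by simp
      also have "\<dots> = u (l (f (p (power_incl ?\<Lambda> n i (q (?f x) i)))))"
        using linear_map_regular_eq[OF R linear_map_comp[OF linear_map_power_incl[OF reg] up] qxi[OF i]]
        by (simp add: y_def b_def)
      finally show "v i (e i x) = u (l (f (p (power_incl ?\<Lambda> n i (q (?f x) i)))))" .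
    qed simp
    also have "\<dots> = u (l (f (p (q (?f x)))))"
      by (rule linear_map_power_eq[OF reg Y up qx, symmetric])
    finally show ?thesis using pq fx by simp
  qed
  \<comment> \<open>The extension found on P0 is carried back to the free cover: P0 takes the place
    of the covering module, and both retraction maps are the identity of T.\<close>
  have "\<exists>h. linear_map R ?F Y h \<and> (\<forall>x\<in>a_kernel ?F T ?c. h x = u x)"
    by (rule extend_from_kernel[where c = \<pi> and p = "\<lambda>x. x" and q = "\<lambda>x. x" and l = l and e = e' and u = u
        and g = ?c, OF F T T P0 Y c \<pi> linear_map_id linear_map_id refl l u[unfolded syzygy_def] e' eu])
  moreover have "carrier (syzygy R T) = a_kernel ?F T ?c" by (simp add: syzygy_def)
  ultimately show "\<exists>e. linear_map R ?F Y e \<and> (\<forall>z\<in>carrier (syzygy R T). e z = u z)"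
    by (simp only:)
qed

text \<open>The connecting map from Hom(N,C) to Ext of N by the kernel is zero because maps from N
  to C lift, and Ext of N by B vanishes. Concretely, \<open>u\<close> extends to a map
  \<open>e\<close> into B; its composite with \<open>g\<close> kills the syzygy and so comes from a
  map on N, and subtracting a lift of that map corrects \<open>e\<close> to have values in the
  kernel.\<close>

lemma ext_zero_kernel:
  assumes N: "left_module R N" and B: "left_module R B" and C: "left_module R C"
    and g: "linear_map R B C g"
    and lift: "\<And>m. linear_map R N C m \<Longrightarrow> \<exists>m'. linear_map R N B m' \<and> (\<forall>x\<in>carrier N. g (m' x) = m x)"
    and ext: "ext_zero R N B"
  shows "ext_zero R N (sub_module B (a_kernel B C g))"
  unfolding ext_zero_def
proof (intro allI impI)
  interpret C: left_module R C by fact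
  interpret B: left_module R B by fact
  let ?K = "a_kernel B C g" and ?F = "free_cover R N" and ?c = "free_cover_map R N"
  have K: "submodule ?K R B" by (rule linear_map_kernel[OF B C g])
  have F: "left_module R ?F" by (rule free_cover_left_module[OF left_module_ring[OF N]])
  note c = free_cover_map_linear[OF N] free_cover_map_surj[OF N]
  have S: "carrier (syzygy R N) = {z \<in> carrier ?F. ?c z = \<zero>\<^bsub>N\<^esub>}"
    by (simp add: syzygy_def a_kernel_def')
  fix u assume u: "linear_map R (syzygy R N) (sub_module B ?K) u"
  obtain e where e: "linear_map R ?F B e" "\<And>z. z \<in> carrier (syzygy R N) \<Longrightarrow> e z = u z"
    using ext linear_map_sub_codD[OF K u] unfolding ext_zero_def by metis
  have ge: "linear_map R ?F C (\<lambda>z. g (e z))" by (rule linear_map_comp[OF e(1) g])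
  have "g (e z) = \<zero>\<^bsub>C\<^esub>" if "z \<in> carrier ?F" "?c z = \<zero>\<^bsub>N\<^esub>" for z
    using linear_map_closed[OF u] e(2) that by (auto simp: S a_kernel_def')
  then obtain m where m: "linear_map R N C m" "\<And>z. z \<in> carrier ?F \<Longrightarrow> m (?c z) = g (e z)"
    using linear_map_factor[OF F N C c ge] by metis
  obtain m' where m': "linear_map R N B m'" "\<And>x. x \<in> carrier N \<Longrightarrow> g (m' x) = m x"
    using lift[OF m(1)] by metis
  have mc: "linear_map R ?F B (\<lambda>z. m' (?c z))" by (rule linear_map_comp[OF c(1) m'(1)])
  let ?e = "\<lambda>z. e z \<ominus>\<^bsub>B\<^esub> m' (?c z)"
  have "linear_map R ?F B ?e" by (rule linear_map_minus[OF F B e(1) mc])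
  moreover have "?e z \<in> ?K" if z: "z \<in> carrier ?F" for z
  proof -
    note ez = linear_map_closed[OF e(1) z] and mz = linear_map_closed[OF mc z]
    have "g (?e z) = g (e z) \<ominus>\<^bsub>C\<^esub> g (m' (?c z))" by (rule linear_map_diff[OF B C g ez mz])
    then show ?thesis
      using ez mz m'(2)[OF linear_map_closed[OF c(1) z]] m(2)[OF z] linear_map_closed[OF g ez]
      by (simp add: a_kernel_def' C.diff_eq_zero_iff)
  qed
  ultimately have "linear_map R ?F (sub_module B ?K) ?e" by (intro linear_map_sub_cod) auto
  moreover have "?e z = u z" if z: "z \<in> carrier (syzygy R N)" for z
    using z e(2)[OF z, symmetric] linear_map_zero[OF N B m'(1)] linear_map_closed[OF e(1)]
    by (simp add: S B.diff_zero)
  ultimately show "\<exists>e. linear_map R ?F (sub_module B ?K) e \<and> (\<forall>z\<in>carrier (syzygy R N). e z = u z)"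
    by blast
qed

text \<open>Extending the identity of the kernel gives a retraction \<open>r\<close> of A onto it.
  The map \<open>x - r x\<close> vanishes on the kernel and descends along \<open>g\<close> to the
  section.\<close>

lemma ext_zero_split:
  assumes T: "left_module R T" and A: "left_module R A" and g: "linear_map R A T g" "g ` carrier A = carrier T"
    and ext: "ext_zero R T (sub_module A (a_kernel A T g))"
  obtains s where "linear_map R T A s" "\<And>x. x \<in> carrier T \<Longrightarrow> g (s x) = x"
proof -
  interpret A: left_module R A by fact
  interpret T: left_module R T by fact
  let ?K = "a_kernel A T g"
  have K: "submodule ?K R A" by (rule linear_map_kernel[OF A T g(1)])
  obtain r where r: "linear_map R A (sub_module A ?K) r" "\<And>x. x \<in> ?K \<Longrightarrow> r x = x"
    using ext_zero_extend[OF T A T submodule_left_module[OF A K] ext retract_of_power_self[OF T] g linear_map_id]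
    by metis
  note r' = linear_map_sub_codD[OF K r(1)]
  let ?h = "\<lambda>x. x \<ominus>\<^bsub>A\<^esub> r x"
  have h: "linear_map R A A ?h" by (rule linear_map_minus[OF A A linear_map_id r'])
  have "?h x = \<zero>\<^bsub>A\<^esub>" if "x \<in> carrier A" "g x = \<zero>\<^bsub>T\<^esub>" for x
    using that r(2)[of x] by (simp add: a_kernel_def' A.diff_eq_zero_iff)
  then obtain s where s: "linear_map R T A s" "\<And>x. x \<in> carrier A \<Longrightarrow> s (g x) = ?h x"
    using linear_map_factor[OF A T A g h] by metis
  have "g (s y) = y" if y: "y \<in> carrier T" for y
  proof -
    obtain x where x: "x \<in> carrier A" "y = g x" using y g(2) by (metis imageE)
    have "r x \<in> ?K" using linear_map_closed[OF r(1) x(1)] by simp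
    then have rx: "r x \<in> carrier A" "g (r x) = \<zero>\<^bsub>T\<^esub>" by (simp_all add: a_kernel_def')
    show ?thesis
      using x rx linear_map_closed[OF g(1) x(1)]
      by (simp add: s(2) linear_map_diff[OF A T g(1)] T.diff_zero)
  qed
  then show thesis using that s(1) by blast
qed

section \<open>Artinian modules\<close>

text \<open>The minimum condition, equivalent to the descending chain condition. Most uses pick a
  minimal counterexample or a minimal summand, for which this form is direct.\<close>

definition artinian_module :: "('a, 'r) ring_scheme \<Rightarrow> ('a, 'm) module \<Rightarrow> bool" where
  "artinian_module R M \<longleftrightarrow> (\<forall>\<S>. \<S> \<noteq> {} \<and> (\<forall>H\<in>\<S>. submodule H R M) \<longrightarrow>
     (\<exists>H\<in>\<S>. \<forall>H'\<in>\<S>. H' \<subseteq> H \<longrightarrow> H' = H))"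

lemma artinian_moduleE:
  assumes "artinian_module R M" "\<S> \<noteq> {}" "\<And>H. H \<in> \<S> \<Longrightarrow> submodule H R M"
  obtains H where "H \<in> \<S>" "\<And>H'. \<lbrakk>H' \<in> \<S>; H' \<subseteq> H\<rbrakk> \<Longrightarrow> H' = H"
  using assms unfolding artinian_module_def by metis

text \<open>The definition for k speaks of descending sequences of ideals. Were there no minimal
  member, iterating a choice \<open>d\<close> of strictly smaller members would give a sequence that
  never stabilises; submodules are ideals because k is commutative.\<close>

lemma artinian_regular_module:
  assumes "artinian_cring k"
  shows "artinian_module k (regular_module k)"
  unfolding artinian_module_def
proof (intro allI impI, rule ccontr)
  interpret cring k using assms by (simp add: artinian_cring_def)
  fix \<S> assume \<S>: "\<S> \<noteq> {} \<and> (\<forall>H\<in>\<S>. submodule H k (regular_module k))"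
    and "\<not> (\<exists>H\<in>\<S>. \<forall>H'\<in>\<S>. H' \<subseteq> H \<longrightarrow> H' = H)"
  then have "\<exists>H'. H \<in> \<S> \<longrightarrow> H' \<in> \<S> \<and> H' \<subset> H" for H by blast
  then obtain d where d: "\<And>H. H \<in> \<S> \<Longrightarrow> d H \<in> \<S>" "\<And>H. H \<in> \<S> \<Longrightarrow> d H \<subset> H" by metis
  obtain H0 where "H0 \<in> \<S>" using \<S> by blast
  then have I: "(d ^^ n) H0 \<in> \<S>" for n by (induction n) (simp_all add: d)
  have "ideal H k" if "H \<in> \<S>" for H
  proof (rule idealI[OF ring_axioms])
    have H: "submodule H k (regular_module k)" using \<S> that by blast
    then show "subgroup H (add_monoid k)"
      by (simp add: submodule_def subgroup_def m_inv_def regular_module_def scalar_module_def)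
    fix a x assume "a \<in> H" "x \<in> carrier k"
    then show "x \<otimes>\<^bsub>k\<^esub> a \<in> H" "a \<otimes>\<^bsub>k\<^esub> x \<in> H"
      using submodule_smult[OF H, of x a] submodule_carrier[OF H, of a] by (simp_all add: m_comm)
  qed
  then have "(\<forall>n. ideal ((d ^^ n) H0) k) \<and> (\<forall>n. (d ^^ Suc n) H0 \<subseteq> (d ^^ n) H0)"
    using I d(2) by auto
  then obtain m where "\<forall>n\<ge>m. (d ^^ n) H0 = (d ^^ m) H0"
    using assms[unfolded artinian_cring_def, THEN conjunct2, rule_format, of "\<lambda>n. (d ^^ n) H0"] by blast
  then have "(d ^^ Suc m) H0 = (d ^^ m) H0" using le_SucI by blast
  then show False using d(2)[OF I[of m]] by simp
qed

text \<open>Minimality is taken twice: for the image under \<open>g\<close>, and then, among the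
  submodules with that image, for the image under \<open>g'\<close> of the part inside the kernel of
  \<open>g\<close>. With \<open>g = g'\<close> this is the case of an embedding; with two coordinate
  maps it is the induction step for powers.\<close>

lemma artinian_jointly_injective:
  assumes V: "left_module R V" and W: "left_module R W" and W': "left_module R W'"
    and g: "linear_map R V W g" and g': "linear_map R V W' g'"
    and inj: "\<And>x. \<lbrakk>x \<in> carrier V; g x = \<zero>\<^bsub>W\<^esub>; g' x = \<zero>\<^bsub>W'\<^esub>\<rbrakk> \<Longrightarrow> x = \<zero>\<^bsub>V\<^esub>"
    and "artinian_module R W" "artinian_module R W'"
  shows "artinian_module R V"
  unfolding artinian_module_def
proof (intro allI impI)
  interpret V: left_module R V by fact
  interpret W: left_module R W by fact
  interpret W': left_module R W' by fact
  let ?K = "a_kernel V W g"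
  have K: "submodule ?K R V" by (rule linear_map_kernel[OF V W g])
  fix \<S> assume "\<S> \<noteq> {} \<and> (\<forall>H\<in>\<S>. submodule H R V)"
  then have ne: "\<S> \<noteq> {}" and \<S>: "\<And>H. H \<in> \<S> \<Longrightarrow> submodule H R V" by auto
  have "(\<lambda>H. g ` H) ` \<S> \<noteq> {}" using ne by simp
  moreover have "submodule L R W" if "L \<in> (\<lambda>H. g ` H) ` \<S>" for L
    using that linear_map_image[OF V W g \<S>] by auto
  ultimately obtain G where G: "G \<in> (\<lambda>H. g ` H) ` \<S>"
    "\<And>G'. \<lbrakk>G' \<in> (\<lambda>H. g ` H) ` \<S>; G' \<subseteq> G\<rbrakk> \<Longrightarrow> G' = G"
    by (rule artinian_moduleE[OF assms(7)]) blast+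
  define \<S>1 where "\<S>1 = {H \<in> \<S>. g ` H = G}"
  have ne1: "\<S>1 \<noteq> {}" using G(1) by (auto simp: \<S>1_def)
  have "(\<lambda>H. g' ` (H \<inter> ?K)) ` \<S>1 \<noteq> {}" using ne1 by simp
  moreover have "submodule L R W'" if "L \<in> (\<lambda>H. g' ` (H \<inter> ?K)) ` \<S>1" for L
    using that linear_map_image[OF V W' g' submodule_Int[OF V \<S> K]] by (auto simp: \<S>1_def)
  ultimately obtain G' where G': "G' \<in> (\<lambda>H. g' ` (H \<inter> ?K)) ` \<S>1"
    "\<And>L. \<lbrakk>L \<in> (\<lambda>H. g' ` (H \<inter> ?K)) ` \<S>1; L \<subseteq> G'\<rbrakk> \<Longrightarrow> L = G'"
    by (rule artinian_moduleE[OF assms(8)]) blast+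
  then obtain H where H: "H \<in> \<S>1" "G' = g' ` (H \<inter> ?K)" by blast
  then have HS: "H \<in> \<S>" "g ` H = G" by (simp_all add: \<S>1_def)
  show "\<exists>H\<in>\<S>. \<forall>H'\<in>\<S>. H' \<subseteq> H \<longrightarrow> H' = H"
  proof (intro bexI[OF _ HS(1)] ballI impI equalityI subsetI)
    fix H' x assume H': "H' \<in> \<S>" "H' \<subseteq> H" and x: "x \<in> H"
    note sH = \<S>[OF HS(1)] and sH' = \<S>[OF H'(1)]
    have gH': "g ` H' = G" using G(2)[of "g ` H'"] H' HS by blast
    then have "H' \<in> \<S>1" using H' by (simp add: \<S>1_def)
    then have g'H': "g' ` (H' \<inter> ?K) = g' ` (H \<inter> ?K)" using G'(2)[of "g' ` (H' \<inter> ?K)"] H' H(2) by blast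
    \<comment> \<open>\<open>x\<close> is corrected twice by elements of \<open>H'\<close>:
      \<open>y\<close> matches it under \<open>g\<close>, and \<open>z\<close> matches the remainder
      \<open>x - y\<close>, which lies in the kernel of \<open>g\<close>, under \<open>g'\<close>.
      What is left is killed by both maps.\<close>
    have "g x \<in> g ` H'" using gH' HS x by blast
    then obtain y where y: "y \<in> H'" "g x = g y" by blast
    have xV: "x \<in> carrier V" and yV: "y \<in> carrier V"
      using submodule_carrier[OF sH x] submodule_carrier[OF sH' y(1)] .
    have "x \<ominus>\<^bsub>V\<^esub> y \<in> H \<inter> ?K"
      using submodule_diff[OF sH x] y H' linear_map_eq_iff_kernel[OF V W g xV yV] by blast
    then have "g' (x \<ominus>\<^bsub>V\<^esub> y) \<in> g' ` (H' \<inter> ?K)" and xyK: "x \<ominus>\<^bsub>V\<^esub> y \<in> ?K" using g'H' by blast+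
    then obtain z where z: "z \<in> H'" "z \<in> ?K" "g' (x \<ominus>\<^bsub>V\<^esub> y) = g' z" by blast
    have zV: "z \<in> carrier V" using submodule_carrier[OF sH' z(1)] .
    have "x \<ominus>\<^bsub>V\<^esub> y \<ominus>\<^bsub>V\<^esub> z \<in> ?K" using submodule_diff[OF K xyK z(2)] .
    moreover have "x \<ominus>\<^bsub>V\<^esub> y \<ominus>\<^bsub>V\<^esub> z \<in> a_kernel V W' g'"
      using z(3) linear_map_eq_iff_kernel[OF V W' g' _ zV, of "x \<ominus>\<^bsub>V\<^esub> y"] xV yV by simp
    ultimately have "x \<ominus>\<^bsub>V\<^esub> y \<ominus>\<^bsub>V\<^esub> z = \<zero>\<^bsub>V\<^esub>" using inj by (simp add: a_kernel_def')
    then have "x \<ominus>\<^bsub>V\<^esub> y = z" using V.diff_eq_zero_iff xV yV zV by simp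
    then have "x = y \<oplus>\<^bsub>V\<^esub> z" using V.add_diff_eq[OF yV xV] by simp
    then show "x \<in> H'" using submodule_add[OF sH' y(1) z(1)] by simp
  qed auto
qed

lemma artinian_injective:
  assumes "left_module R V" "left_module R W" "linear_map R V W g"
    and "\<And>x. \<lbrakk>x \<in> carrier V; g x = \<zero>\<^bsub>W\<^esub>\<rbrakk> \<Longrightarrow> x = \<zero>\<^bsub>V\<^esub>" "artinian_module R W"
  shows "artinian_module R V"
  by (rule artinian_jointly_injective[OF assms(1,2,2,3,3)]) (use assms in auto)

lemma artinian_sub_module:
  assumes "left_module R V" "submodule H R V" "artinian_module R V"
  shows "artinian_module R (sub_module V H)"
  by (rule artinian_injective[OF submodule_left_module[OF assms(1,2)] assms(1) linear_map_incl[OF assms(2)]])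
    (use assms(3) in auto)

lemma artinian_surjective:
  assumes V: "left_module R V" and W: "left_module R W"
    and g: "linear_map R V W g" "g ` carrier V = carrier W" and "artinian_module R V"
  shows "artinian_module R W"
  unfolding artinian_module_def
proof (intro allI impI)
  fix \<S> assume "\<S> \<noteq> {} \<and> (\<forall>H\<in>\<S>. submodule H R W)"
  then have ne: "\<S> \<noteq> {}" and \<S>: "\<And>H. H \<in> \<S> \<Longrightarrow> submodule H R W" by auto
  let ?p = "\<lambda>H. {x \<in> carrier V. g x \<in> H}"
  have gp: "g ` ?p H = H" if "H \<in> \<S>" for H
    using submodule_subset[OF \<S>[OF that]] g(2) by force
  have ne': "?p ` \<S> \<noteq> {}" using ne by simp
  have sub: "submodule L R V" if "L \<in> ?p ` \<S>" for L
    using that linear_map_vimage[OF V W g(1) \<S>] by auto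
  obtain L where L: "L \<in> ?p ` \<S>" "\<And>L'. \<lbrakk>L' \<in> ?p ` \<S>; L' \<subseteq> L\<rbrakk> \<Longrightarrow> L' = L"
    by (rule artinian_moduleE[OF assms(5) ne' sub]) blast+
  then obtain H where H: "H \<in> \<S>" "L = ?p H" by blast
  have "H' = H" if "H' \<in> \<S>" "H' \<subseteq> H" for H'
  proof -
    have "?p H' = ?p H" using L(2)[of "?p H'"] H that by blast
    then show ?thesis using gp[OF that(1)] gp[OF H(1)] by metis
  qed
  then show "\<exists>H\<in>\<S>. \<forall>H'\<in>\<S>. H' \<subseteq> H \<longrightarrow> H' = H" using H(1) by blast
qed

text \<open>Induction on \<open>n\<close>: the last coordinate and the tuple of the others are
  jointly injective.\<close>

lemma artinian_power:
  assumes V: "left_module R V" and "artinian_module R V"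
  shows "artinian_module R (power_module V n)"
proof (induction n)
  case 0
  show ?case
    by (rule artinian_injective[OF power_left_module[OF V] V linear_map_const_zero[OF V] _ assms(2)])
      (auto simp: PiE_empty_domain)
next
  case (Suc n)
  have "linear_map R (power_module V (Suc n)) (power_module V n) (\<lambda>u. \<lambda>i\<in>{..<n}. u i)"
    by (rule linear_map_tuple[OF linear_map_nth]) simp
  then show ?case
  proof (rule artinian_jointly_injective[OF power_left_module[OF V] V power_left_module[OF V]
        linear_map_nth[of n "Suc n"] _ _ assms(2) Suc, simplified])
    fix x assume x: "x \<in> {..<Suc n} \<rightarrow>\<^sub>E carrier V" "x n = \<zero>\<^bsub>V\<^esub>"
      "restrict x {..<n} = (\<lambda>i\<in>{..<n}. \<zero>\<^bsub>V\<^esub>)"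
    have "x i = \<zero>\<^bsub>V\<^esub>" if "i < Suc n" for i
      using that x(2) fun_cong[OF x(3), of i] by (cases "i = n") auto
    then show "x = (\<lambda>i\<in>{..<Suc n}. \<zero>\<^bsub>V\<^esub>)"
      by (intro extensionalityI[of x "{..<Suc n}"]) (use x(1) in \<open>auto simp: PiE_def\<close>)
  qed
qed

lemma finitely_generated_artinian:
  assumes "artinian_module R (regular_module R)" "left_module R V" "finitely_generated R V"
  shows "artinian_module R V"
proof -
  have reg: "left_module R (regular_module R)"
    by (rule regular_left_module[OF left_module_ring[OF assms(2)]])
  obtain n g where "linear_map R (power_module (regular_module R) n) V g"
    "g ` carrier (power_module (regular_module R) n) = carrier V"
    using finitely_generated_surj[OF assms(2,3)] by metis
  then show ?thesis
    by (rule artinian_surjective[OF power_left_module[OF reg] assms(2) _ _ artinian_power[OF reg assms(1)]])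
qed

text \<open>A submodule minimal among those that are not finitely generated is divisible by every scalar
  that does not annihilate it. Hence it is a vector space over a field, and a complement of a line in
  it is a proper subspace which is not finitely generated.\<close>

lemma artinian_finitely_generated:
  assumes k: "artinian_cring k" and V: "left_module k V" and "artinian_module k V"
  shows "finitely_generated k V"
proof (rule ccontr)
  assume not_fg: "\<not> finitely_generated k V"
  interpret k: cring k using k by (simp add: artinian_cring_def)
  interpret V: left_module k V by fact
  define fg where "fg H \<longleftrightarrow> (\<exists>S. finite S \<and> S \<subseteq> H \<and> (\<forall>H'. submodule H' k V \<and> S \<subseteq> H' \<longrightarrow> H \<subseteq> H'))" for H
  have fgE: thesis
    if "fg H" and "\<And>S. \<lbrakk>finite S; S \<subseteq> H; \<And>H'. \<lbrakk>submodule H' k V; S \<subseteq> H'\<rbrakk> \<Longrightarrow> H \<subseteq> H'\<rbrakk> \<Longrightarrow> thesis"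
    for H thesis
    using that unfolding fg_def by metis
  have "\<not> fg (carrier V)"
  proof
    assume "fg (carrier V)"
    then obtain S where "finite S" "S \<subseteq> carrier V" "\<forall>H'. submodule H' k V \<and> S \<subseteq> H' \<longrightarrow> carrier V \<subseteq> H'"
      unfolding fg_def by blast
    then have "finitely_generated k V"
      unfolding finitely_generated_def using submodule_subset by (metis subset_antisym)
    then show False using not_fg by simp
  qed
  then have "{H. submodule H k V \<and> \<not> fg H} \<noteq> {}" using V.submodule_self by auto
  then obtain X where X: "submodule X k V" "\<not> fg X"
    and min: "\<And>H. \<lbrakk>submodule H k V; \<not> fg H; H \<subseteq> X\<rbrakk> \<Longrightarrow> H = X"
    using artinian_moduleE[OF assms(3), of "{H. submodule H k V \<and> \<not> fg H}"] by (metis (lifting) mem_Collect_eq)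
  note XV = submodule_carrier[OF X(1)]
  have lin: "linear_map k V V (\<lambda>x. c \<odot>\<^bsub>V\<^esub> x)" if "c \<in> carrier k" for c
    using that by (intro linear_mapI) (simp_all add: V.smult_r_distr V.smult_assoc1[symmetric] k.m_comm)
  \<comment> \<open>If \<open>c\<close> neither acts surjectively on X nor kills it, then its image
    and its kernel in X are both proper, hence finitely generated by minimality. Preimages
    \<open>S'\<close> of generators of the image together with generators \<open>P\<close> of the
    kernel then generate X.\<close>
  have scalar: "(\<lambda>x. c \<odot>\<^bsub>V\<^esub> x) ` X = X \<or> (\<forall>x\<in>X. c \<odot>\<^bsub>V\<^esub> x = \<zero>\<^bsub>V\<^esub>)" if c: "c \<in> carrier k" for c
  proof (rule ccontr)
    assume not: "\<not> ?thesis"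
    let ?I = "(\<lambda>x. c \<odot>\<^bsub>V\<^esub> x) ` X" and ?N = "X \<inter> a_kernel V V (\<lambda>x. c \<odot>\<^bsub>V\<^esub> x)"
    have N: "submodule ?N k V" by (rule submodule_Int[OF V X(1) linear_map_kernel[OF V V lin[OF c]]])
    have I: "submodule ?I k V" by (rule linear_map_image[OF V V lin[OF c] X(1)])
    have "?I \<subseteq> X" using submodule_smult[OF X(1) c] by blast
    then have "fg ?I" using min[OF I] not by blast
    then obtain S where S: "finite S" "S \<subseteq> ?I" "\<And>H'. \<lbrakk>submodule H' k V; S \<subseteq> H'\<rbrakk> \<Longrightarrow> ?I \<subseteq> H'"
      by (rule fgE) (rule that, assumption+)
    obtain S' where S': "S' \<subseteq> X" "finite S'" "S = (\<lambda>x. c \<odot>\<^bsub>V\<^esub> x) ` S'"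
      using finite_subset_image[OF S(1,2)] by blast
    have "fg ?N" using min[OF N] not by (auto simp: a_kernel_def')
    then obtain P where P: "finite P" "P \<subseteq> ?N" "\<And>H'. \<lbrakk>submodule H' k V; P \<subseteq> H'\<rbrakk> \<Longrightarrow> ?N \<subseteq> H'"
      by (rule fgE) (rule that, assumption+)
    have "X \<subseteq> H'" if H': "submodule H' k V" "S' \<union> P \<subseteq> H'" for H'
    proof
      fix x assume x: "x \<in> X"
      have "submodule ((\<lambda>x. c \<odot>\<^bsub>V\<^esub> x) ` (H' \<inter> X)) k V"
        by (rule linear_map_image[OF V V lin[OF c] submodule_Int[OF V H'(1) X(1)]])
      moreover have "S \<subseteq> (\<lambda>x. c \<odot>\<^bsub>V\<^esub> x) ` (H' \<inter> X)" using S' H'(2) by blast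
      ultimately have "?I \<subseteq> (\<lambda>x. c \<odot>\<^bsub>V\<^esub> x) ` (H' \<inter> X)" by (rule S(3))
      then obtain y where y: "y \<in> H'" "y \<in> X" "c \<odot>\<^bsub>V\<^esub> x = c \<odot>\<^bsub>V\<^esub> y" using x by blast
      have "x \<ominus>\<^bsub>V\<^esub> y \<in> ?N"
        using linear_map_eq_iff_kernel[OF V V lin[OF c] XV[OF x] XV[OF y(2)]] y submodule_diff[OF X(1) x y(2)]
        by blast
      then have "x \<ominus>\<^bsub>V\<^esub> y \<in> H'" using P(3)[OF H'(1)] H'(2) by blast
      then have "y \<oplus>\<^bsub>V\<^esub> (x \<ominus>\<^bsub>V\<^esub> y) \<in> H'" using submodule_add[OF H'(1) y(1)] by blast
      then show "x \<in> H'" using V.add_diff_eq[OF XV[OF y(2)] XV[OF x]] by simp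
    qed
    then have "fg X" unfolding fg_def using S' P by (intro exI[of _ "S' \<union> P"]) auto
    then show False using X(2) by simp
  qed
  \<comment> \<open>The powers of \<open>c\<close> generate a stationary chain of ideals, so
    \<open>c^n = d c^(n+1)\<close> for some \<open>d\<close>. As every \<open>x\<close> in X has the
    form \<open>c^n y\<close>, multiplication by \<open>d\<close> undoes multiplication by
    \<open>c\<close> on X.\<close>
  have inverse: "\<exists>d\<in>carrier k. \<forall>x\<in>X. d \<odot>\<^bsub>V\<^esub> (c \<odot>\<^bsub>V\<^esub> x) = x"
    if c: "c \<in> carrier k" "\<not> (\<forall>x\<in>X. c \<odot>\<^bsub>V\<^esub> x = \<zero>\<^bsub>V\<^esub>)" for c
  proof -
    have cX: "(\<lambda>x. c \<odot>\<^bsub>V\<^esub> x) ` X = X" using scalar c by blast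
    have surj: "\<exists>y\<in>X. (c [^]\<^bsub>k\<^esub> n) \<odot>\<^bsub>V\<^esub> y = x" if "x \<in> X" for n :: nat and x
      using that
    proof (induction n arbitrary: x)
      case 0
      then show ?case using XV by (intro bexI[of _ x]) auto
    next
      case (Suc n)
      then obtain y where y: "y \<in> X" "(c [^]\<^bsub>k\<^esub> n) \<odot>\<^bsub>V\<^esub> y = x" by blast
      then obtain z where z: "z \<in> X" "y = c \<odot>\<^bsub>V\<^esub> z" using cX by blast
      then have "(c [^]\<^bsub>k\<^esub> Suc n) \<odot>\<^bsub>V\<^esub> z = x" using y c(1) by (simp add: V.smult_assoc1 XV)
      then show ?case using z(1) by blast
    qed
    define I where "I n = (\<lambda>d. d \<otimes>\<^bsub>k\<^esub> c [^]\<^bsub>k\<^esub> n) ` carrier k" for n :: nat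
    have "submodule (I n) k (regular_module k)" for n
      unfolding I_def
      using linear_map_image[OF regular_left_module[OF k.ring_axioms] regular_left_module[OF k.ring_axioms]
          linear_map_regular[OF regular_left_module[OF k.ring_axioms]] left_module.submodule_self[OF regular_left_module[OF k.ring_axioms]]]
        c(1) by simp
    then have "\<And>H. H \<in> range I \<Longrightarrow> submodule H k (regular_module k)" by blast
    then obtain H where H: "H \<in> range I" "\<And>H'. \<lbrakk>H' \<in> range I; H' \<subseteq> H\<rbrakk> \<Longrightarrow> H' = H"
      using artinian_moduleE[OF artinian_regular_module[OF k], of "range I"] by (metis UNIV_not_empty image_is_empty)
    then obtain n where n: "H = I n" by blast
    have "I (Suc n) \<subseteq> I n"
    proof
      fix x assume "x \<in> I (Suc n)"
      then obtain d where d: "d \<in> carrier k" "x = d \<otimes>\<^bsub>k\<^esub> c [^]\<^bsub>k\<^esub> Suc n" by (auto simp: I_def)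
      then have "x = (d \<otimes>\<^bsub>k\<^esub> c) \<otimes>\<^bsub>k\<^esub> c [^]\<^bsub>k\<^esub> n" using c(1) by (simp add: k.m_ac)
      then show "x \<in> I n" using d c(1) unfolding I_def by (intro image_eqI[of _ _ "d \<otimes>\<^bsub>k\<^esub> c"]) auto
    qed
    then have "I n \<subseteq> I (Suc n)" using H n by blast
    moreover have "c [^]\<^bsub>k\<^esub> n \<in> I n"
      unfolding I_def using c(1) by (intro image_eqI[of _ _ "\<one>\<^bsub>k\<^esub>"]) auto
    ultimately obtain d where d: "d \<in> carrier k" "c [^]\<^bsub>k\<^esub> n = d \<otimes>\<^bsub>k\<^esub> c [^]\<^bsub>k\<^esub> Suc n"
      by (auto simp: I_def)
    have "d \<odot>\<^bsub>V\<^esub> (c \<odot>\<^bsub>V\<^esub> x) = x" if x: "x \<in> X" for x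
    proof -
      obtain y where y: "y \<in> X" "(c [^]\<^bsub>k\<^esub> n) \<odot>\<^bsub>V\<^esub> y = x" using surj[OF x] by blast
      have "d \<odot>\<^bsub>V\<^esub> (c \<odot>\<^bsub>V\<^esub> x) = (d \<otimes>\<^bsub>k\<^esub> (c \<otimes>\<^bsub>k\<^esub> c [^]\<^bsub>k\<^esub> n)) \<odot>\<^bsub>V\<^esub> y"
        using y c(1) d(1) XV[OF y(1)] by (simp add: V.smult_assoc1 del: k.nat_pow_Suc)
      also have "c \<otimes>\<^bsub>k\<^esub> c [^]\<^bsub>k\<^esub> n = c [^]\<^bsub>k\<^esub> Suc n" using c(1) by (simp add: k.m_comm)
      finally show ?thesis by (simp only: d(2)[symmetric] y(2))
    qed
    then show ?thesis using d(1) by blast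
  qed
  have "X \<noteq> {\<zero>\<^bsub>V\<^esub>}"
  proof
    assume "X = {\<zero>\<^bsub>V\<^esub>}"
    then have "fg X" unfolding fg_def by (intro exI[of _ "{}"]) (auto simp: submodule_zero)
    then show False using X(2) by simp
  qed
  then obtain x where x: "x \<in> X" "x \<noteq> \<zero>\<^bsub>V\<^esub>" using submodule_zero[OF X(1)] by blast
  \<comment> \<open>A maximal submodule of X that avoids \<open>x\<close> is a complement of the
    line through \<open>x\<close>.\<close>
  define \<A> where "\<A> = {Y. submodule Y k V \<and> Y \<subseteq> X \<and> x \<notin> Y}"
  have "\<exists>Y\<in>\<A>. \<forall>Y'\<in>\<A>. Y \<subseteq> Y' \<longrightarrow> Y' = Y"
  proof (rule subset_Zorn_nonempty)
    have "{\<zero>\<^bsub>V\<^esub>} \<in> \<A>" using V.submodule_zero_set submodule_zero[OF X(1)] x by (auto simp: \<A>_def)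
    then show "\<A> \<noteq> {}" by blast
    fix \<C> assume ne: "\<C> \<noteq> {}" and ch: "subset.chain \<A> \<C>"
    have C: "Y \<in> \<A>" if "Y \<in> \<C>" for Y using ch that by (auto simp: subset.chain_def)
    have C': "submodule Y k V" if "Y \<in> \<C>" for Y using C[OF that] by (simp add: \<A>_def)
    have tot: "Y \<subseteq> Y' \<or> Y' \<subseteq> Y" if "Y \<in> \<C>" "Y' \<in> \<C>" for Y Y'
      using ch that by (auto simp: subset.chain_def subset_chain_def)
    have "submodule (\<Union>\<C>) k V"
    proof (rule V.submoduleI)
      show "\<Union>\<C> \<subseteq> carrier V" using C' submodule_subset by blast
      show "\<zero>\<^bsub>V\<^esub> \<in> \<Union>\<C>" using ne C' submodule_zero by blast
      show "y \<oplus>\<^bsub>V\<^esub> z \<in> \<Union>\<C>" if yz: "y \<in> \<Union>\<C>" "z \<in> \<Union>\<C>" for y z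
      proof -
        obtain Y Z where YZ: "Y \<in> \<C>" "y \<in> Y" "Z \<in> \<C>" "z \<in> Z" using yz by blast
        then show ?thesis
          using tot[OF YZ(1,3)] submodule_add[OF C'[OF YZ(1)]] submodule_add[OF C'[OF YZ(3)]] by blast
      qed
      show "a \<odot>\<^bsub>V\<^esub> y \<in> \<Union>\<C>" if "a \<in> carrier k" "y \<in> \<Union>\<C>" for a y
        using that submodule_smult[OF C'] by blast
    qed
    then show "\<Union>\<C> \<in> \<A>" using C by (auto simp: \<A>_def)
  qed
  then obtain Y where Y: "submodule Y k V" "Y \<subseteq> X" "x \<notin> Y"
    and max: "\<And>Y'. \<lbrakk>Y' \<in> \<A>; Y \<subseteq> Y'\<rbrakk> \<Longrightarrow> Y' = Y" by (auto simp: \<A>_def)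
  have "fg Y" using min[OF Y(1)] Y x by blast
  then obtain S where S: "finite S" "S \<subseteq> Y" "\<And>H'. \<lbrakk>submodule H' k V; S \<subseteq> H'\<rbrakk> \<Longrightarrow> Y \<subseteq> H'"
    by (rule fgE) (rule that, assumption+)
  \<comment> \<open>Maximality of Y puts \<open>x\<close> into \<open>Y + k z\<close> for each
    \<open>z\<close> of X outside Y. In \<open>x = y + c z\<close> the term \<open>c z\<close> is
    nonzero because \<open>x\<close> is not in Y, so \<open>c\<close> is invertible on X and
    \<open>z\<close> is recovered from \<open>x - y\<close>.\<close>
  have "X \<subseteq> H'" if H': "submodule H' k V" "insert x S \<subseteq> H'" for H'
  proof
    fix z assume z: "z \<in> X"
    have YH: "Y \<subseteq> H'" using S(3)[OF H'(1)] H'(2) by blast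
    show "z \<in> H'"
    proof (cases "z \<in> Y")
      case False
      let ?L = "(\<lambda>c. c \<odot>\<^bsub>V\<^esub> z) ` carrier k"
      have L: "submodule ?L k V"
        using linear_map_image[OF regular_left_module[OF k.ring_axioms] V
            linear_map_regular[OF V XV[OF z]] left_module.submodule_self[OF regular_left_module[OF k.ring_axioms]]]
        by simp
      have YL: "submodule (Y <+>\<^bsub>V\<^esub> ?L) k V" by (rule submodule_set_add[OF V Y(1) L])
      have "Y \<subseteq> Y <+>\<^bsub>V\<^esub> ?L" by (rule submodule_subset_set_add(1)[OF V Y(1) L])
      moreover have "z \<in> Y <+>\<^bsub>V\<^esub> ?L"
      proof -
        have "z = \<zero>\<^bsub>V\<^esub> \<oplus>\<^bsub>V\<^esub> \<one>\<^bsub>k\<^esub> \<odot>\<^bsub>V\<^esub> z" using XV[OF z] by simp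
        then show ?thesis using submodule_zero[OF Y(1)] unfolding set_add_iff by blast
      qed
      moreover have "Y <+>\<^bsub>V\<^esub> ?L \<subseteq> X"
        using Y(2) submodule_add[OF X(1)] submodule_smult[OF X(1) _ z]
        by (auto simp: set_add_iff subset_iff)
      ultimately have "x \<in> Y <+>\<^bsub>V\<^esub> ?L" using max[of "Y <+>\<^bsub>V\<^esub> ?L"] YL False by (auto simp: \<A>_def)
      then obtain y c where yc: "y \<in> Y" "c \<in> carrier k" "x = y \<oplus>\<^bsub>V\<^esub> c \<odot>\<^bsub>V\<^esub> z"
        unfolding set_add_iff by blast
      have yV: "y \<in> carrier V" using submodule_carrier[OF Y(1) yc(1)] .
      have "c \<odot>\<^bsub>V\<^esub> z \<noteq> \<zero>\<^bsub>V\<^esub>" using yc Y(3) yV by auto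
      then obtain d where d: "d \<in> carrier k" "d \<odot>\<^bsub>V\<^esub> (c \<odot>\<^bsub>V\<^esub> z) = z" using inverse[OF yc(2)] z by blast
      have "c \<odot>\<^bsub>V\<^esub> z = x \<ominus>\<^bsub>V\<^esub> y" using yc yV XV[OF z] V.add_diff_cancel_left by simp
      then have "c \<odot>\<^bsub>V\<^esub> z \<in> H'" using H' YH yc(1) submodule_diff[OF H'(1)] by auto
      then show ?thesis using submodule_smult[OF H'(1) d(1)] d(2) by metis
    qed (use YH in blast)
  qed
  then have "fg X" unfolding fg_def using S Y(2) x by (intro exI[of _ "insert x S"]) auto
  then show False using X(2) by simp
qed

section \<open>Modules and Hom groups over an artin algebra as modules over k\<close>

definition restrict_scalars :: "('k \<Rightarrow> 'a) \<Rightarrow> ('a, 'm) module \<Rightarrow> ('k, 'm) module" where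
  "restrict_scalars \<phi> M =
     \<lparr>carrier = carrier M, monoid.mult = monoid.mult M, one = one M, ring.zero = ring.zero M,
      ring.add = ring.add M, smult = (\<lambda>c x. \<phi> c \<odot>\<^bsub>M\<^esub> x)\<rparr>"

lemma restrict_scalars_simps [simp]:
  "carrier (restrict_scalars \<phi> M) = carrier M"
  "\<zero>\<^bsub>restrict_scalars \<phi> M\<^esub> = \<zero>\<^bsub>M\<^esub>"
  "x \<oplus>\<^bsub>restrict_scalars \<phi> M\<^esub> y = x \<oplus>\<^bsub>M\<^esub> y"
  "c \<odot>\<^bsub>restrict_scalars \<phi> M\<^esub> x = \<phi> c \<odot>\<^bsub>M\<^esub> x"
  by (simp_all add: restrict_scalars_def)

lemma restrict_scalars_left_module:
  assumes "ring k" "\<phi> \<in> ring_hom k R" "left_module R M"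
  shows "left_module k (restrict_scalars \<phi> M)"
proof -
  interpret k: ring k by fact
  interpret M: left_module R M by fact
  note hom = ring_hom_closed[OF assms(2)] ring_hom_add[OF assms(2)] ring_hom_mult[OF assms(2)]
    ring_hom_one[OF assms(2)] ring_hom_zero[OF assms(2,1) M.R.ring_axioms]
  show ?thesis
    by (rule left_moduleI)
      (simp_all add: assms(1) hom M.M.a_ac M.smult_l_distr M.smult_r_distr M.smult_assoc1)
qed

lemma restrict_scalars_linear_map:
  assumes "\<phi> \<in> ring_hom k R" "linear_map R M N f"
  shows "linear_map k (restrict_scalars \<phi> M) (restrict_scalars \<phi> N) f"
  using assms(2) ring_hom_closed[OF assms(1)] by (simp add: linear_map_def)

lemma restrict_scalars_submodule:
  assumes "ring k" "\<phi> \<in> ring_hom k R" "left_module R M" "submodule H R M"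
  shows "submodule H k (restrict_scalars \<phi> M)"
proof -
  interpret left_module k "restrict_scalars \<phi> M" by (rule restrict_scalars_left_module[OF assms(1-3)])
  show ?thesis
    by (rule submoduleI)
      (use assms(4) submodule_subset ring_hom_closed[OF assms(2)] in
        \<open>auto simp: submodule_zero submodule_add submodule_smult\<close>)
qed

lemma restrict_scalars_power:
  "restrict_scalars \<phi> (power_module M n) = power_module (restrict_scalars \<phi> M) n"
  by (simp add: restrict_scalars_def power_module_def)

lemma restrict_scalars_regular: "restrict_scalars \<phi> (regular_module R) = scalar_module \<phi> R"
  by (simp add: restrict_scalars_def regular_module_def scalar_module_def)

lemma artin_algebraD:
  assumes "artin_algebra k \<phi> R"
  shows "artinian_cring k" "ring k" "ring R" "\<phi> \<in> ring_hom k R"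
    and "\<And>c x. \<lbrakk>c \<in> carrier k; x \<in> carrier R\<rbrakk> \<Longrightarrow> \<phi> c \<otimes>\<^bsub>R\<^esub> x = x \<otimes>\<^bsub>R\<^esub> \<phi> c"
    and "finitely_generated k (scalar_module \<phi> R)"
  using assms by (auto simp: artin_algebra_def artinian_cring_def cring_def)

text \<open>R is finitely generated over k, hence artinian over k; this passes to free modules of
  finite rank and to their quotients.\<close>

lemma artin_algebra_artinian:
  assumes "artin_algebra k \<phi> R" "left_module R M" "finitely_generated R M"
  shows "artinian_module k (restrict_scalars \<phi> M)"
proof -
  note alg = artin_algebraD[OF assms(1)]
  note rs = restrict_scalars_left_module[OF alg(2,4)]
  have reg: "left_module R (regular_module R)" by (rule regular_left_module[OF alg(3)])
  have "artinian_module k (restrict_scalars \<phi> (regular_module R))"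
    using finitely_generated_artinian[OF artinian_regular_module[OF alg(1)] rs[OF reg]] alg(6)
    by (simp add: restrict_scalars_regular)
  then have art: "artinian_module k (restrict_scalars \<phi> (power_module (regular_module R) n))" for n
    unfolding restrict_scalars_power by (rule artinian_power[OF rs[OF reg]])
  obtain n g where g: "linear_map R (power_module (regular_module R) n) M g"
    "g ` carrier (power_module (regular_module R) n) = carrier M"
    using finitely_generated_surj[OF assms(2,3)] by metis
  show ?thesis
    by (rule artinian_surjective[OF rs[OF power_left_module[OF reg]] rs[OF assms(2)]
          restrict_scalars_linear_map[OF alg(4) g(1)] _ art]) (use g(2) in simp)
qed

text \<open>The Hom group as a k-module: over an artin algebra the multiple of a homomorphism by
  \<open>c\<close> is again R-linear because \<open>\<phi> c\<close> is central. As R may be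
  noncommutative, it need not act on Hom groups in this way, so their finiteness is sought over
  k.\<close>

definition hom_module ::
  "('k \<Rightarrow> 'a) \<Rightarrow> ('a, 'r) ring_scheme \<Rightarrow> ('a, 'm) module \<Rightarrow> ('a, 'n) module \<Rightarrow> ('k, 'm \<Rightarrow> 'n) module" where
  "hom_module \<phi> R M N =
     \<lparr>carrier = mod_hom R M N, monoid.mult = undefined, one = undefined,
      ring.zero = (\<lambda>x\<in>carrier M. \<zero>\<^bsub>N\<^esub>),
      ring.add = (\<lambda>f g. \<lambda>x\<in>carrier M. f x \<oplus>\<^bsub>N\<^esub> g x),
      smult = (\<lambda>c f. \<lambda>x\<in>carrier M. \<phi> c \<odot>\<^bsub>N\<^esub> f x)\<rparr>"

lemma hom_module_simps [simp]:
  "carrier (hom_module \<phi> R M N) = mod_hom R M N"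
  "\<zero>\<^bsub>hom_module \<phi> R M N\<^esub> = (\<lambda>x\<in>carrier M. \<zero>\<^bsub>N\<^esub>)"
  "f \<oplus>\<^bsub>hom_module \<phi> R M N\<^esub> g = (\<lambda>x\<in>carrier M. f x \<oplus>\<^bsub>N\<^esub> g x)"
  "c \<odot>\<^bsub>hom_module \<phi> R M N\<^esub> f = (\<lambda>x\<in>carrier M. \<phi> c \<odot>\<^bsub>N\<^esub> f x)"
  by (simp_all add: hom_module_def)

lemma linear_map_central_smult:
  assumes "artin_algebra k \<phi> R" "left_module R N" "linear_map R M N f" "c \<in> carrier k"
  shows "linear_map R M N (\<lambda>x. \<phi> c \<odot>\<^bsub>N\<^esub> f x)"
proof -
  note alg = artin_algebraD[OF assms(1)]
  interpret N: left_module R N by fact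
  have c: "\<phi> c \<in> carrier R" by (rule ring_hom_closed[OF alg(4) assms(4)])
  have "linear_map R N N (\<lambda>x. \<phi> c \<odot>\<^bsub>N\<^esub> x)"
    using c alg(5)[OF assms(4)]
    by (intro linear_mapI) (simp_all add: N.smult_r_distr N.smult_assoc1[symmetric])
  then show ?thesis by (rule linear_map_comp[OF assms(3)])
qed

lemma hom_module_left_module:
  assumes "artin_algebra k \<phi> R" "left_module R M" "left_module R N"
  shows "left_module k (hom_module \<phi> R M N)"
proof -
  note alg = artin_algebraD[OF assms(1)]
  interpret k: ring k by (rule alg(2))
  interpret N: left_module R N by fact
  note hom = ring_hom_closed[OF alg(4)] ring_hom_add[OF alg(4)] ring_hom_mult[OF alg(4)]
    ring_hom_one[OF alg(4)] ring_hom_zero[OF alg(4,2) N.R.ring_axioms]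
  have cl: "f x \<in> carrier N" if "f \<in> mod_hom R M N" "x \<in> carrier M" for f x
    using linear_map_closed[OF mod_hom_linear] that by metis
  have ext: "restrict f (carrier M) = f" if "f \<in> mod_hom R M N" for f
    using that by (simp add: mod_hom_iff extensional_restrict)
  show ?thesis
  proof (rule left_moduleI)
    fix f g assume "f \<in> carrier (hom_module \<phi> R M N)" "g \<in> carrier (hom_module \<phi> R M N)"
    then have fg: "f \<in> mod_hom R M N" "g \<in> mod_hom R M N" by simp_all
    show "f \<oplus>\<^bsub>hom_module \<phi> R M N\<^esub> g \<in> carrier (hom_module \<phi> R M N)"
      using restrict_mod_hom[OF assms(2) linear_map_plus[OF assms(3) mod_hom_linear mod_hom_linear, OF fg]] by simp
    show "f \<oplus>\<^bsub>hom_module \<phi> R M N\<^esub> g = g \<oplus>\<^bsub>hom_module \<phi> R M N\<^esub> f"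
      using cl[OF fg(1)] cl[OF fg(2)] by (simp add: N.M.a_comm cong: restrict_cong)
  next
    fix c f assume cf: "c \<in> carrier k" "f \<in> carrier (hom_module \<phi> R M N)"
    then show "c \<odot>\<^bsub>hom_module \<phi> R M N\<^esub> f \<in> carrier (hom_module \<phi> R M N)"
      using restrict_mod_hom[OF assms(2) linear_map_central_smult[OF assms(1,3) mod_hom_linear]] by simp
  next
    fix f assume "f \<in> carrier (hom_module \<phi> R M N)"
    then have f: "f \<in> mod_hom R M N" by simp
    have "(\<lambda>x\<in>carrier M. \<zero>\<^bsub>N\<^esub> \<oplus>\<^bsub>N\<^esub> f x) = f" "(\<lambda>x\<in>carrier M. \<one>\<^bsub>R\<^esub> \<odot>\<^bsub>N\<^esub> f x) = f"
      using ext[OF f] cl[OF f] by (simp_all cong: restrict_cong)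
    then show "\<zero>\<^bsub>hom_module \<phi> R M N\<^esub> \<oplus>\<^bsub>hom_module \<phi> R M N\<^esub> f = f" "\<one>\<^bsub>k\<^esub> \<odot>\<^bsub>hom_module \<phi> R M N\<^esub> f = f"
      by (simp_all add: hom cong: restrict_cong)
  next
    show "\<zero>\<^bsub>hom_module \<phi> R M N\<^esub> \<in> carrier (hom_module \<phi> R M N)"
      using restrict_mod_hom[OF assms(2) linear_map_const_zero[OF assms(3)]] by simp
  qed (simp_all add: cl hom alg(2) N.M.a_assoc N.smult_l_distr N.smult_r_distr N.smult_assoc1
      cong: restrict_cong)
qed

text \<open>A homomorphism is determined by its values on finitely many generators, so evaluation
  embeds the Hom group into a finite power of N over k.\<close>

lemma hom_module_artinian:
  assumes alg: "artin_algebra k \<phi> R" and M: "left_module R M" and N: "left_module R N"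
    and fg: "finitely_generated R M" and art: "artinian_module k (restrict_scalars \<phi> N)"
  shows "artinian_module k (hom_module \<phi> R M N)"
proof -
  interpret M: left_module R M by fact
  interpret N: left_module R N by fact
  obtain S where S: "finite S" "S \<subseteq> carrier M" "\<And>H. submodule H R M \<and> S \<subseteq> H \<Longrightarrow> H = carrier M"
    using fg unfolding finitely_generated_def by blast
  obtain n :: nat and s where s: "S = s ` {i. i < n}"
    using finite_imp_nat_seg_image_inj_on[OF S(1)] by blast
  have sM: "s i \<in> carrier M" if "i < n" for i using s S(2) that by auto
  have N': "left_module k (restrict_scalars \<phi> N)"
    by (rule restrict_scalars_left_module[OF artin_algebraD(2,4)[OF alg] N])
  have ev: "linear_map k (hom_module \<phi> R M N) (restrict_scalars \<phi> N) (\<lambda>f. f (s i))" if "i < n" for i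
    using sM[OF that] linear_map_closed[OF mod_hom_linear] by (intro linear_mapI) auto
  show ?thesis
  proof (rule artinian_injective[OF hom_module_left_module[OF alg M N] power_left_module[OF N']
        linear_map_tuple[OF ev] _ artinian_power[OF N' art]])
    fix f assume "f \<in> carrier (hom_module \<phi> R M N)"
      and f0: "(\<lambda>i\<in>{..<n}. f (s i)) = \<zero>\<^bsub>power_module (restrict_scalars \<phi> N) n\<^esub>"
    then have f: "f \<in> mod_hom R M N" by simp
    have K: "submodule (a_kernel M N f) R M" by (rule linear_map_kernel[OF M N mod_hom_linear[OF f]])
    have "f (s i) = \<zero>\<^bsub>N\<^esub>" if "i < n" for i using fun_cong[OF f0, of i] that by simp
    then have "S \<subseteq> a_kernel M N f" using s sM by (auto simp: a_kernel_def')
    then have "a_kernel M N f = carrier M" using S(3) K by blast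
    then have "f x = \<zero>\<^bsub>N\<^esub>" if "x \<in> carrier M" for x using that by (auto simp: a_kernel_def')
    then show "f = \<zero>\<^bsub>hom_module \<phi> R M N\<^esub>"
      using f by (intro extensionalityI[of f "carrier M"]) (auto simp: mod_hom_iff)
  qed
qed

section \<open>Decompositions into indecomposable modules\<close>

lemma artinian_restrict_scalars:
  assumes "ring k" "\<phi> \<in> ring_hom k R" "left_module R M" "artinian_module k (restrict_scalars \<phi> M)"
  shows "artinian_module R M"
  using assms(4) restrict_scalars_submodule[OF assms(1-3)] unfolding artinian_module_def by blast

lemma linear_map_funpow:
  assumes "linear_map R M M f"
  shows "linear_map R M M (f ^^ n)"
proof (induction n)
  case (Suc n)
  show ?case using linear_map_comp[OF Suc assms] by (simp add: comp_def)
qed (simp add: linear_map_id id_def)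

lemma decseq_sets_stable:
  fixes I :: "nat \<Rightarrow> 'b set"
  assumes "artinian_module R M" "\<And>n. submodule (I n) R M" "\<And>m n. m \<le> n \<Longrightarrow> I n \<subseteq> I m"
  shows "\<exists>m. \<forall>n\<ge>m. I n = I m"
proof -
  have "range I \<noteq> {}" by simp
  moreover have "submodule H R M" if "H \<in> range I" for H using that assms(2) by blast
  ultimately obtain H where H: "H \<in> range I" "\<And>H'. \<lbrakk>H' \<in> range I; H' \<subseteq> H\<rbrakk> \<Longrightarrow> H' = H"
    by (rule artinian_moduleE[OF assms(1)]) blast+
  then obtain m where "H = I m" by blast
  then have "I n = I m" if "m \<le> n" for n using H(2)[of "I n"] assms(3)[OF that] by blast
  then show ?thesis by blast
qed

text \<open>Fitting's lemma. The chain of the maps \<open>h \<circ> f\<^sup>n\<close> replaces the ascending chain of kernels.\<close>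

lemma indecomposable_endo:
  assumes U: "left_module R U" and ind: "indecomposable R U"
    and alg: "artin_algebra k \<phi> R" and art: "artinian_module R U" "artinian_module k (hom_module \<phi> R U U)"
    and f: "linear_map R U U f"
  shows "bij_betw f (carrier U) (carrier U) \<or> (\<exists>n. \<forall>x\<in>carrier U. (f ^^ n) x = \<zero>\<^bsub>U\<^esub>)"
proof -
  interpret U: left_module R U by fact
  note fn = linear_map_funpow[OF f]
  have fadd: "(f ^^ (m + n)) x = (f ^^ m) ((f ^^ n) x)" for m n x by (simp add: funpow_add)
  define I where "I n = (f ^^ n) ` carrier U" for n
  have I_sub: "submodule (I n) R U" for n
    unfolding I_def by (rule linear_map_image[OF U U fn U.submodule_self])
  have I_mono: "I n \<subseteq> I m" if "m \<le> n" for m n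
  proof
    fix y assume "y \<in> I n"
    then obtain x where "x \<in> carrier U" "y = (f ^^ n) x" by (auto simp: I_def)
    then show "y \<in> I m"
      using fadd[of m "n - m" x] that linear_map_closed[OF fn] unfolding I_def
      by (intro image_eqI[of _ _ "(f ^^ (n - m)) x"]) auto
  qed
  obtain m1 where m1: "\<And>n. m1 \<le> n \<Longrightarrow> I n = I m1"
    using decseq_sets_stable[OF art(1), of I, OF I_sub I_mono] by auto
  \<comment> \<open>\<open>J n\<close> is the left ideal of the endomorphism ring generated by
    \<open>f ^^ n\<close>. It is a k-submodule, so the chain is stationary.\<close>
  define J where "J n = (\<lambda>h. \<lambda>x\<in>carrier U. h ((f ^^ n) x)) ` mod_hom R U U" for n
  note HU = hom_module_left_module[OF alg U U]
  have J_sub: "submodule (J n) k (hom_module \<phi> R U U)" for n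
  proof -
    have "linear_map k (hom_module \<phi> R U U) (hom_module \<phi> R U U) (\<lambda>h. \<lambda>x\<in>carrier U. h ((f ^^ n) x))"
    proof (rule linear_mapI)
      fix h assume "h \<in> carrier (hom_module \<phi> R U U)"
      then show "(\<lambda>x\<in>carrier U. h ((f ^^ n) x)) \<in> carrier (hom_module \<phi> R U U)"
        using restrict_mod_hom[OF U linear_map_comp[OF fn mod_hom_linear]] by simp
    qed (simp_all add: linear_map_closed[OF fn] cong: restrict_cong)
    from linear_map_image[OF HU HU this left_module.submodule_self[OF HU]] show ?thesis
      by (simp add: J_def)
  qed
  have J_mono: "J n \<subseteq> J m" if "m \<le> n" for m n
  proof
    fix y assume "y \<in> J n"
    then obtain h where h: "h \<in> mod_hom R U U" "y = (\<lambda>x\<in>carrier U. h ((f ^^ n) x))" by (auto simp: J_def)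
    let ?h = "\<lambda>x\<in>carrier U. h ((f ^^ (n - m)) x)"
    have "?h \<in> mod_hom R U U"
      by (rule restrict_mod_hom[OF U linear_map_comp[OF fn mod_hom_linear[OF h(1)]]])
    moreover have "y = (\<lambda>x\<in>carrier U. ?h ((f ^^ m) x))"
      unfolding h(2) using fadd[of "n - m" m] that linear_map_closed[OF fn] by (simp cong: restrict_cong)
    ultimately show "y \<in> J m" unfolding J_def by blast
  qed
  obtain m2 where m2: "\<And>n. m2 \<le> n \<Longrightarrow> J n = J m2"
    using decseq_sets_stable[OF art(2), of J, OF J_sub J_mono] by auto
  \<comment> \<open>An index beyond both stabilisation points. The \<open>Suc\<close> makes
    \<open>n\<close> positive, so that injectivity and surjectivity pass from \<open>f ^^ n\<close>
    to \<open>f\<close>.\<close>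
  define n where "n = Suc (m1 + m2)"
  have In: "I (n + n) = I n" and Jn: "J (n + n) = J n"
    using m1[of n] m1[of "n + n"] m2[of n] m2[of "n + n"] by (simp_all add: n_def)
  have "(\<lambda>x\<in>carrier U. (\<lambda>x\<in>carrier U. x) ((f ^^ n) x)) \<in> J n"
    unfolding J_def by (rule imageI) (rule restrict_mod_hom[OF U linear_map_id])
  then have "(\<lambda>x\<in>carrier U. (\<lambda>x\<in>carrier U. x) ((f ^^ n) x)) \<in> J (n + n)" using Jn by simp
  then obtain h where h: "h \<in> mod_hom R U U"
    "(\<lambda>x\<in>carrier U. (\<lambda>x\<in>carrier U. x) ((f ^^ n) x)) = (\<lambda>x\<in>carrier U. h ((f ^^ (n + n)) x))"
    unfolding J_def by (rule imageE)
  \<comment> \<open>From \<open>J (n + n) = J n\<close>: an element killed by applying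
    \<open>f ^^ n\<close> twice is already killed by applying it once, so the kernel and the image
    of \<open>f ^^ n\<close> meet in zero.\<close>
  have hf: "(f ^^ n) x = h ((f ^^ n) ((f ^^ n) x))" if "x \<in> carrier U" for x
    using fun_cong[OF h(2), of x] that linear_map_closed[OF fn that] by (simp add: fadd)
  let ?K = "a_kernel U U (f ^^ n)"
  have K: "submodule ?K R U" by (rule linear_map_kernel[OF U U fn])
  have int: "?K \<inter> I n = {\<zero>\<^bsub>U\<^esub>}"
  proof (intro equalityI subsetI)
    fix x assume x: "x \<in> ?K \<inter> I n"
    then obtain y where y: "y \<in> carrier U" "x = (f ^^ n) y" by (auto simp: I_def)
    then show "x \<in> {\<zero>\<^bsub>U\<^esub>}"
      using x hf[OF y(1)] linear_map_zero[OF U U mod_hom_linear[OF h(1)]] by (simp add: a_kernel_def')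
  qed (use submodule_zero[OF K] submodule_zero[OF I_sub] in auto)
  \<comment> \<open>Stability of the images gives the other half: some element of the image of
    \<open>f ^^ n\<close> has the same value under \<open>f ^^ n\<close> as
    \<open>x\<close>.\<close>
  have sum: "?K <+>\<^bsub>U\<^esub> I n = carrier U"
  proof (intro equalityI subsetI)
    fix x assume x: "x \<in> carrier U"
    have "(f ^^ n) x \<in> I (n + n)" using x In by (auto simp: I_def)
    then obtain y where y: "y \<in> carrier U" "(f ^^ n) x = (f ^^ n) ((f ^^ n) y)" by (auto simp: I_def fadd)
    have fy: "(f ^^ n) y \<in> carrier U" "(f ^^ n) y \<in> I n" using linear_map_closed[OF fn y(1)] y(1) by (auto simp: I_def)
    have "x \<ominus>\<^bsub>U\<^esub> (f ^^ n) y \<in> ?K" using linear_map_eq_iff_kernel[OF U U fn x fy(1)] y(2) by blast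
    moreover have "x = (x \<ominus>\<^bsub>U\<^esub> (f ^^ n) y) \<oplus>\<^bsub>U\<^esub> (f ^^ n) y" using U.diff_add_eq[OF fy(1) x] by simp
    ultimately show "x \<in> ?K <+>\<^bsub>U\<^esub> I n" unfolding set_add_iff using fy(2) by blast
  qed (use submodule_subset[OF submodule_set_add[OF U K I_sub]] in auto)
  have "direct_summand R ?K U" unfolding direct_summand_def using K I_sub int sum by blast
  then consider "?K = {\<zero>\<^bsub>U\<^esub>}" | "?K = carrier U" using ind unfolding indecomposable_def by blast
  then show ?thesis
  proof cases
    case 1
    then have "x \<in> I n" if "x \<in> carrier U" for x
      using sum that U.M.l_zero submodule_carrier[OF I_sub] by (auto simp: set_add_iff)
    then have "x \<in> f ` carrier U" if "x \<in> carrier U" for x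
      using that linear_map_closed[OF fn] by (fastforce simp: I_def n_def)
    then have "f ` carrier U = carrier U" using linear_map_closed[OF f] by blast
    moreover have "inj_on f (carrier U)"
      unfolding linear_map_inj_iff[OF U U f]
    proof (intro ballI impI)
      fix x assume x: "x \<in> carrier U" "f x = \<zero>\<^bsub>U\<^esub>"
      then have "(f ^^ n) x = \<zero>\<^bsub>U\<^esub>"
        using linear_map_zero[OF U U fn, of "m1 + m2"] by (simp add: n_def funpow_swap1)
      then have "x \<in> ?K" using x by (simp add: a_kernel_def')
      then show "x = \<zero>\<^bsub>U\<^esub>" using 1 by simp
    qed
    ultimately show ?thesis by (simp add: bij_betw_def)
  next
    case 2
    then have "(f ^^ n) x = \<zero>\<^bsub>U\<^esub>" if "x \<in> carrier U" for x using that by (auto simp: a_kernel_def')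
    then show ?thesis by blast
  qed
qed

text \<open>Locality of the endomorphism ring, drawn from the alternative \<open>fit\<close>. For
  two summands, dividing by \<open>w\<close> turns the sum into the identity. If both terms were
  nilpotent, an \<open>x\<close> killed by the second would be fixed by the first, hence zero; so
  the second would be injective as well as nilpotent, and U would be zero. Induction gives
  \<open>n\<close> summands; for \<open>n = 0\<close> the zero map would be bijective on U.\<close>

lemma local_sum_bijective:
  fixes n :: nat
  assumes U: "left_module R U" and ne: "carrier U \<noteq> {\<zero>\<^bsub>U\<^esub>}"
    and fit: "\<And>f. linear_map R U U f \<Longrightarrow>
      bij_betw f (carrier U) (carrier U) \<or> (\<exists>n. \<forall>x\<in>carrier U. (f ^^ n) x = \<zero>\<^bsub>U\<^esub>)"
    and c: "\<And>i. i < n \<Longrightarrow> linear_map R U U (c i)"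
    and w: "linear_map R U U w" "bij_betw w (carrier U) (carrier U)"
    and eq: "\<And>x. x \<in> carrier U \<Longrightarrow> w x = (\<Oplus>\<^bsub>U\<^esub>i\<in>{..<n}. c i x)"
  shows "\<exists>i<n. bij_betw (c i) (carrier U) (carrier U)"
proof -
  interpret U: left_module R U by fact
  have two: "bij_betw a (carrier U) (carrier U) \<or> bij_betw b (carrier U) (carrier U)"
    if a: "linear_map R U U a" and b: "linear_map R U U b"
      and w: "linear_map R U U w" "bij_betw w (carrier U) (carrier U)"
      and eq: "\<And>x. x \<in> carrier U \<Longrightarrow> w x = a x \<oplus>\<^bsub>U\<^esub> b x" for a b w
  proof -
    let ?v = "inv_into (carrier U) w"
    have v: "linear_map R U U ?v" by (rule linear_map_inv[OF U w])
    have wv: "w (?v x) = x" if "x \<in> carrier U" for x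
      using that w(2) by (simp add: bij_betw_def f_inv_into_f)
    have vw: "?v (w x) = x" if "x \<in> carrier U" for x
      using that w(2) by (simp add: bij_betw_def)
    have va: "linear_map R U U (\<lambda>x. ?v (a x))" and vb: "linear_map R U U (\<lambda>x. ?v (b x))"
      by (rule linear_map_comp[OF a v], rule linear_map_comp[OF b v])
    have comp_w: "bij_betw g (carrier U) (carrier U)"
      if "linear_map R U U g" "bij_betw (\<lambda>x. ?v (g x)) (carrier U) (carrier U)" for g
    proof -
      have "bij_betw (w \<circ> (\<lambda>x. ?v (g x))) (carrier U) (carrier U)"
        by (rule bij_betw_trans[OF that(2) w(2)])
      moreover have "(w \<circ> (\<lambda>x. ?v (g x))) x = g x" if x: "x \<in> carrier U" for x
        using wv linear_map_closed[OF \<open>linear_map R U U g\<close> x] by simp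
      ultimately show ?thesis by (simp cong: bij_betw_cong)
    qed
    show ?thesis
    proof (rule ccontr)
      assume "\<not> ?thesis"
      then have not: "\<not> bij_betw (\<lambda>x. ?v (a x)) (carrier U) (carrier U)"
        "\<not> bij_betw (\<lambda>x. ?v (b x)) (carrier U) (carrier U)"
        using comp_w[OF a] comp_w[OF b] by blast+
      obtain m where m: "\<And>x. x \<in> carrier U \<Longrightarrow> ((\<lambda>x. ?v (a x)) ^^ m) x = \<zero>\<^bsub>U\<^esub>"
        using fit[OF va] not by blast
      obtain l where l: "\<And>x. x \<in> carrier U \<Longrightarrow> ((\<lambda>x. ?v (b x)) ^^ l) x = \<zero>\<^bsub>U\<^esub>"
        using fit[OF vb] not by blast
      have sum: "x = ?v (a x) \<oplus>\<^bsub>U\<^esub> ?v (b x)" if x: "x \<in> carrier U" for x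
        using vw[OF x] eq[OF x] linear_map_add[OF v linear_map_closed[OF a x] linear_map_closed[OF b x]]
        by simp
      have inj: "x = \<zero>\<^bsub>U\<^esub>" if x: "x \<in> carrier U" "?v (b x) = \<zero>\<^bsub>U\<^esub>" for x
      proof -
        have "?v (a x) = x" using sum[OF x(1)] x linear_map_closed[OF va x(1)] by simp
        then have "((\<lambda>x. ?v (a x)) ^^ j) x = x" for j by (induction j) simp_all
        then show ?thesis using m[OF x(1)] by metis
      qed
      have "x = \<zero>\<^bsub>U\<^esub>" if "x \<in> carrier U" "((\<lambda>x. ?v (b x)) ^^ j) x = \<zero>\<^bsub>U\<^esub>" for j x
        using that
      proof (induction j)
        case (Suc j)
        have "((\<lambda>x. ?v (b x)) ^^ j) x \<in> carrier U"
          by (rule linear_map_closed[OF linear_map_funpow[OF vb] Suc.prems(1)])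
        then have "((\<lambda>x. ?v (b x)) ^^ j) x = \<zero>\<^bsub>U\<^esub>" using inj Suc.prems(2) by simp
        then show ?case using Suc by blast
      qed simp
      then have "carrier U \<subseteq> {\<zero>\<^bsub>U\<^esub>}" using l by blast
      then show False using ne by auto
    qed
  qed
  show ?thesis
    using c w eq
  proof (induction n arbitrary: w)
    case 0
    then have "w x = \<zero>\<^bsub>U\<^esub>" if "x \<in> carrier U" for x using that by simp
    then have "w ` carrier U \<subseteq> {\<zero>\<^bsub>U\<^esub>}" by auto
    then have False using 0(3) ne U.M.zero_closed by (auto simp: bij_betw_def)
    then show ?case ..
  next
    case (Suc n)
    note cl = linear_map_closed[OF Suc.prems(1)]
    let ?s = "\<lambda>x. \<Oplus>\<^bsub>U\<^esub>i\<in>{..<n}. c i x"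
    have s: "linear_map R U U ?s" by (rule linear_map_sum[OF U U Suc.prems(1)]) simp
    have "w x = ?s x \<oplus>\<^bsub>U\<^esub> c n x" if x: "x \<in> carrier U" for x
    proof -
      have "w x = c n x \<oplus>\<^bsub>U\<^esub> ?s x"
        unfolding Suc.prems(4)[OF x] lessThan_Suc using cl x by (intro U.M.finsum_insert) auto
      then show ?thesis using cl x linear_map_closed[OF s x] by (simp add: U.M.a_comm)
    qed
    then have "bij_betw ?s (carrier U) (carrier U) \<or> bij_betw (c n) (carrier U) (carrier U)"
      by (intro two[OF s Suc.prems(1)[of n] Suc.prems(2,3)]) auto
    then show ?case
    proof
      assume "bij_betw ?s (carrier U) (carrier U)"
      then have "\<exists>i<n. bij_betw (c i) (carrier U) (carrier U)"
        by (intro Suc.IH[OF _ s]) (use Suc.prems(1) in auto)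
      then show ?thesis using less_SucI by blast
    qed blast
  qed
qed

section \<open>Direct sums of indecomposable submodules\<close>

definition indecomposable_sum ::
  "('a, 'r) ring_scheme \<Rightarrow> ('a, 'm) module \<Rightarrow> 'm set \<Rightarrow> nat \<Rightarrow> (nat \<Rightarrow> 'm set) \<Rightarrow> bool" where
  "indecomposable_sum R M A n F \<longleftrightarrow>
     (\<forall>i<n. submodule (F i) R M \<and> indecomposable R (sub_module M (F i))) \<and>
     bij_betw (\<lambda>f. finsum M f {..<n}) (\<Pi>\<^sub>E i\<in>{..<n}. F i) A"

text \<open>All summands stay submodules of the one module M, so a decomposition grows without a
  change of ambient module. A tuple of length \<open>Suc n\<close> consists of its last entry, in A,
  and its restriction, with sum in B; if two tuples have equal sums, the difference of their last
  entries lies in both A and B.\<close>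

lemma indecomposable_sum_add:
  assumes M: "left_module R M" and A: "submodule A R M" "indecomposable R (sub_module M A)"
    and B: "submodule B R M" and int: "A \<inter> B = {\<zero>\<^bsub>M\<^esub>}" and F: "indecomposable_sum R M B n F"
  shows "indecomposable_sum R M (A <+>\<^bsub>M\<^esub> B) (Suc n) (F(n := A))"
proof -
  interpret M: left_module R M by fact
  note Ac = submodule_carrier[OF A(1)] and Bc = submodule_carrier[OF B]
  have Fs: "submodule (F i) R M" if "i < n" for i using F that by (simp add: indecomposable_sum_def)
  note Fc = submodule_carrier[OF Fs]
  have bij: "bij_betw (\<lambda>f. finsum M f {..<n}) (\<Pi>\<^sub>E i\<in>{..<n}. F i) B"
    using F by (simp add: indecomposable_sum_def)
  let ?P = "\<Pi>\<^sub>E i\<in>{..<Suc n}. (F(n := A)) i" and ?r = "\<lambda>f. restrict f {..<n}"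
  have P: "f n \<in> A" "?r f \<in> (\<Pi>\<^sub>E i\<in>{..<n}. F i)" if "f \<in> ?P" for f
  proof -
    have *: "f i \<in> (F(n := A)) i" if "i < Suc n" for i using \<open>f \<in> ?P\<close> that by (auto simp: PiE_def Pi_def)
    show "f n \<in> A" using *[of n] by simp
    have "f i \<in> F i" if "i < n" for i using *[of i] that by simp
    then show "?r f \<in> (\<Pi>\<^sub>E i\<in>{..<n}. F i)" by simp
  qed
  have rB: "finsum M (?r f) {..<n} \<in> B" if "f \<in> ?P" for f
    using bij P(2)[OF that] by (auto simp: bij_betw_def)
  have sum: "finsum M f {..<Suc n} = f n \<oplus>\<^bsub>M\<^esub> finsum M (?r f) {..<n}" if f: "f \<in> ?P" for f
  proof -
    have fi: "f i \<in> carrier M" if "i < n" for i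
    proof -
      have "?r f i \<in> F i" using P(2)[OF f] that by (auto simp: PiE_def Pi_def)
      then show ?thesis using Fc[OF that] that by simp
    qed
    have "finsum M f {..<Suc n} = f n \<oplus>\<^bsub>M\<^esub> finsum M f {..<n}"
      unfolding lessThan_Suc using fi Ac[OF P(1)[OF f]] by (intro M.M.finsum_insert) auto
    also have "finsum M f {..<n} = finsum M (?r f) {..<n}"
      using fi by (intro M.M.finsum_cong') auto
    finally show ?thesis .
  qed
  have "inj_on (\<lambda>f. finsum M f {..<Suc n}) ?P"
  proof (rule inj_onI)
    fix f g assume f: "f \<in> ?P" and g: "g \<in> ?P" and eq: "finsum M f {..<Suc n} = finsum M g {..<Suc n}"
    let ?f = "finsum M (?r f) {..<n}" and ?g = "finsum M (?r g) {..<n}"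
    have c: "f n \<in> carrier M" "g n \<in> carrier M" "?f \<in> carrier M" "?g \<in> carrier M"
      using Ac P(1) Bc rB f g by blast+
    have e: "f n \<oplus>\<^bsub>M\<^esub> ?f = g n \<oplus>\<^bsub>M\<^esub> ?g" using eq sum[OF f] sum[OF g] by simp
    have "f n \<ominus>\<^bsub>M\<^esub> g n = ?g \<ominus>\<^bsub>M\<^esub> ?f"
    proof -
      have "f n = (g n \<oplus>\<^bsub>M\<^esub> ?g) \<ominus>\<^bsub>M\<^esub> ?f" using M.add_diff_cancel_right[OF c(1,3)] e by simp
      also have "\<dots> = g n \<oplus>\<^bsub>M\<^esub> (?g \<ominus>\<^bsub>M\<^esub> ?f)" using c by (simp add: M.M.minus_eq M.M.a_assoc)
      finally show ?thesis using M.add_diff_cancel_left[OF c(2), of "?g \<ominus>\<^bsub>M\<^esub> ?f"] c by simp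
    qed
    then have "f n \<ominus>\<^bsub>M\<^esub> g n \<in> A \<inter> B"
      using submodule_diff[OF A(1) P(1)[OF f] P(1)[OF g]] submodule_diff[OF B rB[OF g] rB[OF f]] by simp
    then have fgn: "f n = g n" using int c M.diff_eq_zero_iff by simp
    then have "?f = ?g" using e c by (metis M.add_diff_cancel_left)
    then have r: "?r f = ?r g" using bij P(2)[OF f] P(2)[OF g] by (auto simp: bij_betw_def inj_on_def)
    have "f i = g i" if "i < Suc n" for i
      using fgn fun_cong[OF r, of i] that by (cases "i = n") auto
    then show "f = g" using f g by (intro extensionalityI[of f "{..<Suc n}" g]) (auto simp: PiE_def)
  qed
  moreover have "(\<lambda>f. finsum M f {..<Suc n}) ` ?P = A <+>\<^bsub>M\<^esub> B"
  proof (intro equalityI subsetI)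
    fix x assume "x \<in> (\<lambda>f. finsum M f {..<Suc n}) ` ?P"
    then obtain f where f: "f \<in> ?P" "x = finsum M f {..<Suc n}" by blast
    show "x \<in> A <+>\<^bsub>M\<^esub> B" unfolding f(2) sum[OF f(1)] set_add_iff using P(1)[OF f(1)] rB[OF f(1)] by blast
  next
    fix x assume "x \<in> A <+>\<^bsub>M\<^esub> B"
    then obtain a b where ab: "a \<in> A" "b \<in> B" "x = a \<oplus>\<^bsub>M\<^esub> b" unfolding set_add_iff by blast
    then obtain g where g: "g \<in> (\<Pi>\<^sub>E i\<in>{..<n}. F i)" "b = finsum M g {..<n}"
      using bij by (auto simp: bij_betw_def)
    let ?f = "\<lambda>i\<in>{..<Suc n}. if i = n then a else g i"
    have f: "?f \<in> ?P" using g(1) ab(1) by (auto simp: PiE_def Pi_def)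
    have "?r ?f = g"
      using g(1) by (intro extensionalityI[of "?r ?f" "{..<n}" g]) (auto simp: PiE_def)
    then have "x = finsum M ?f {..<Suc n}" unfolding sum[OF f] using ab g by simp
    then show "x \<in> (\<lambda>f. finsum M f {..<Suc n}) ` ?P" using f by blast
  qed
  ultimately have bij': "bij_betw (\<lambda>f. finsum M f {..<Suc n}) ?P (A <+>\<^bsub>M\<^esub> B)"
    by (simp add: bij_betw_def)
  show ?thesis
    unfolding indecomposable_sum_def
  proof (intro conjI bij')
    show "\<forall>i<Suc n. submodule ((F(n := A)) i) R M \<and> indecomposable R (sub_module M ((F(n := A)) i))"
      using F A by (auto simp: less_Suc_eq indecomposable_sum_def)
  qed
qed

text \<open>A nonzero direct summand S of A that is minimal among such is indecomposable: if S is
  the direct sum of H and K, then H is again a summand of A, with complement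
  \<open>K + S'\<close>.\<close>

lemma indecomposable_summand_exists:
  assumes M: "left_module R M" and art: "artinian_module R M"
    and A: "submodule A R M" "A \<noteq> {\<zero>\<^bsub>M\<^esub>}"
  obtains S S' where "submodule S R M" "submodule S' R M" "S \<inter> S' = {\<zero>\<^bsub>M\<^esub>}" "S <+>\<^bsub>M\<^esub> S' = A"
    "indecomposable R (sub_module M S)" "S \<noteq> {\<zero>\<^bsub>M\<^esub>}"
proof -
  interpret M: left_module R M by fact
  define \<S> where "\<S> = {S. submodule S R M \<and> S \<noteq> {\<zero>\<^bsub>M\<^esub>} \<and>
    (\<exists>S'. submodule S' R M \<and> S \<inter> S' = {\<zero>\<^bsub>M\<^esub>} \<and> S <+>\<^bsub>M\<^esub> S' = A)}"
  have "A <+>\<^bsub>M\<^esub> {\<zero>\<^bsub>M\<^esub>} = A"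
    using submodule_carrier[OF A(1)] by (force simp: set_add_iff)
  moreover have "A \<inter> {\<zero>\<^bsub>M\<^esub>} = {\<zero>\<^bsub>M\<^esub>}" using submodule_zero[OF A(1)] by blast
  ultimately have "A \<in> \<S>" unfolding \<S>_def using A M.submodule_zero_set by blast
  then have "\<S> \<noteq> {}" by blast
  moreover have "submodule H R M" if "H \<in> \<S>" for H using that by (simp add: \<S>_def)
  ultimately obtain S where S: "S \<in> \<S>" "\<And>H. \<lbrakk>H \<in> \<S>; H \<subseteq> S\<rbrakk> \<Longrightarrow> H = S"
    by (rule artinian_moduleE[OF art]) blast+
  then obtain S' where S': "submodule S R M" "S \<noteq> {\<zero>\<^bsub>M\<^esub>}" "submodule S' R M"
    "S \<inter> S' = {\<zero>\<^bsub>M\<^esub>}" "S <+>\<^bsub>M\<^esub> S' = A"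
    unfolding \<S>_def by blast
  note Sc = submodule_carrier[OF S'(1)] and S'c = submodule_carrier[OF S'(3)]
  have "H = {\<zero>\<^bsub>M\<^esub>} \<or> H = S" if H: "direct_summand R H (sub_module M S)" for H
  proof (rule ccontr)
    assume not: "\<not> ?thesis"
    obtain K where HK: "submodule H R M" "H \<subseteq> S" "submodule K R M" "K \<subseteq> S"
      "H \<inter> K = {\<zero>\<^bsub>M\<^esub>}" "H <+>\<^bsub>sub_module M S\<^esub> K = S"
      using H unfolding direct_summand_def submodule_sub_module_iff[OF M S'(1)] by auto
    note Hc = submodule_carrier[OF HK(1)] and Kc = submodule_carrier[OF HK(3)]
    have KS: "submodule (K <+>\<^bsub>M\<^esub> S') R M" by (rule submodule_set_add[OF M HK(3) S'(3)])
    have "H \<inter> (K <+>\<^bsub>M\<^esub> S') = {\<zero>\<^bsub>M\<^esub>}"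
    proof (intro equalityI subsetI)
      fix x assume "x \<in> H \<inter> (K <+>\<^bsub>M\<^esub> S')"
      then obtain y s where x: "x \<in> H" "y \<in> K" "s \<in> S'" "x = y \<oplus>\<^bsub>M\<^esub> s"
        unfolding Int_iff set_add_iff by blast
      have "s = x \<ominus>\<^bsub>M\<^esub> y" using x M.add_diff_cancel_left Kc S'c by simp
      then have "s \<in> S" using x HK submodule_diff[OF S'(1)] by blast
      then have "s = \<zero>\<^bsub>M\<^esub>" using S'(4) x by blast
      then have "x = y" using x Kc by simp
      then show "x \<in> {\<zero>\<^bsub>M\<^esub>}" using x HK by blast
    qed (use submodule_zero[OF HK(1)] submodule_zero[OF KS] in auto)
    moreover have "H <+>\<^bsub>M\<^esub> (K <+>\<^bsub>M\<^esub> S') = A"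
    proof (intro equalityI subsetI)
      fix x assume "x \<in> H <+>\<^bsub>M\<^esub> (K <+>\<^bsub>M\<^esub> S')"
      then obtain h y s where x: "h \<in> H" "y \<in> K" "s \<in> S'" "x = h \<oplus>\<^bsub>M\<^esub> (y \<oplus>\<^bsub>M\<^esub> s)"
        unfolding set_add_iff Bex_def by blast
      have "x = (h \<oplus>\<^bsub>M\<^esub> y) \<oplus>\<^bsub>M\<^esub> s" using x Hc Kc S'c by (simp add: M.M.a_assoc)
      moreover have "h \<oplus>\<^bsub>M\<^esub> y \<in> S" using x HK submodule_add[OF S'(1)] by blast
      ultimately show "x \<in> A" unfolding S'(5)[symmetric] set_add_iff using x by blast
    next
      fix x assume "x \<in> A"
      then obtain z s where zs: "z \<in> S" "s \<in> S'" "x = z \<oplus>\<^bsub>M\<^esub> s"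
        unfolding S'(5)[symmetric] set_add_iff by blast
      then obtain h y where hy: "h \<in> H" "y \<in> K" "z = h \<oplus>\<^bsub>M\<^esub> y"
        using HK(6) set_add_iff[of z "sub_module M S" H K] by auto
      have "x = h \<oplus>\<^bsub>M\<^esub> (y \<oplus>\<^bsub>M\<^esub> s)" using zs hy Hc Kc S'c by (simp add: M.M.a_assoc)
      then show "x \<in> H <+>\<^bsub>M\<^esub> (K <+>\<^bsub>M\<^esub> S')" unfolding set_add_iff Bex_def using hy zs by blast
    qed
    ultimately have "H \<in> \<S>" unfolding \<S>_def using HK(1) KS not by blast
    then show False using S(2) HK(2) not by blast
  qed
  then have "indecomposable R (sub_module M S)" unfolding indecomposable_def using S'(2) by simp
  then show thesis using that S' by blast
qed

text \<open>From a minimal counterexample an indecomposable summand splits off; the complement is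
  strictly smaller and so decomposes. The zero submodule is the empty sum, which makes the
  counterexample nonzero.\<close>

lemma indecomposable_sum_exists:
  assumes M: "left_module R M" and art: "artinian_module R M" and A: "submodule A R M"
  shows "\<exists>n F. indecomposable_sum R M A n F"
proof (rule ccontr)
  interpret M: left_module R M by fact
  assume "\<not> ?thesis"
  then have "{A. submodule A R M \<and> (\<nexists>n F. indecomposable_sum R M A n F)} \<noteq> {}" (is "?\<S> \<noteq> _")
    using A by blast
  moreover have "submodule H R M" if "H \<in> ?\<S>" for H using that by simp
  ultimately obtain B where B: "B \<in> ?\<S>" "\<And>H. \<lbrakk>H \<in> ?\<S>; H \<subseteq> B\<rbrakk> \<Longrightarrow> H = B"
    by (rule artinian_moduleE[OF art]) blast+
  have "indecomposable_sum R M {\<zero>\<^bsub>M\<^esub>} 0 (\<lambda>_. {})" by (simp add: indecomposable_sum_def bij_betw_def)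
  then have "B \<noteq> {\<zero>\<^bsub>M\<^esub>}" using B(1) by blast
  then obtain S S' where S: "submodule S R M" "submodule S' R M" "S \<inter> S' = {\<zero>\<^bsub>M\<^esub>}" "S <+>\<^bsub>M\<^esub> S' = B"
    "indecomposable R (sub_module M S)" "S \<noteq> {\<zero>\<^bsub>M\<^esub>}"
    using indecomposable_summand_exists[OF M art, of B] B(1) by blast
  have incl: "S \<subseteq> B" "S' \<subseteq> B" using submodule_subset_set_add[OF M S(1,2)] S(4) by simp_all
  have "S' \<noteq> B" using incl S(3,6) by blast
  then obtain n F where "indecomposable_sum R M S' n F" using B(2)[of S'] S(2) incl by blast
  then have "indecomposable_sum R M B (Suc n) (F(n := S))"
    using indecomposable_sum_add[OF M S(1,5,2,3)] S(4) by simp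
  then show False using B(1) by blast
qed

lemma indecomposable_iso:
  assumes M: "left_module R M" and N: "left_module R N"
    and f: "linear_map R M N f" "bij_betw f (carrier M) (carrier N)" and ind: "indecomposable R N"
  shows "indecomposable R M"
proof -
  interpret M: left_module R M by fact
  interpret N: left_module R N by fact
  have inj: "inj_on f (carrier M)" and im: "f ` carrier M = carrier N" using f(2) by (auto simp: bij_betw_def)
  have f0: "f \<zero>\<^bsub>M\<^esub> = \<zero>\<^bsub>N\<^esub>" by (rule linear_map_zero[OF M N f(1)])
  have "carrier M \<noteq> {\<zero>\<^bsub>M\<^esub>}"
  proof
    assume "carrier M = {\<zero>\<^bsub>M\<^esub>}"
    then have "carrier N = {\<zero>\<^bsub>N\<^esub>}" using im f0 by simp
    then show False using ind by (simp add: indecomposable_def)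
  qed
  moreover have "H = {\<zero>\<^bsub>M\<^esub>} \<or> H = carrier M" if H: "direct_summand R H M" for H
  proof -
    obtain K where HK: "submodule H R M" "submodule K R M" "H \<inter> K = {\<zero>\<^bsub>M\<^esub>}" "H <+>\<^bsub>M\<^esub> K = carrier M"
      using H unfolding direct_summand_def by blast
    note sub = submodule_subset[OF HK(1)] submodule_subset[OF HK(2)]
    have "f ` H \<inter> f ` K = {\<zero>\<^bsub>N\<^esub>}"
      using inj_on_image_Int[OF inj sub] HK(3) f0 by simp
    moreover have "f ` H <+>\<^bsub>N\<^esub> f ` K = carrier N"
    proof (intro equalityI subsetI)
      fix y assume "y \<in> carrier N"
      then obtain x where x: "x \<in> carrier M" "y = f x" using im by blast
      then obtain h k where hk: "h \<in> H" "k \<in> K" "x = h \<oplus>\<^bsub>M\<^esub> k" using HK(4) set_add_iff[of x M H K] by blast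
      then have "y = f h \<oplus>\<^bsub>N\<^esub> f k" using x(2) linear_map_add[OF f(1)] sub by blast
      then show "y \<in> f ` H <+>\<^bsub>N\<^esub> f ` K" unfolding set_add_iff using hk by blast
    qed (use submodule_subset[OF submodule_set_add[OF N linear_map_image[OF M N f(1) HK(1)]
            linear_map_image[OF M N f(1) HK(2)]]] in auto)
    ultimately have "direct_summand R (f ` H) N"
      unfolding direct_summand_def using linear_map_image[OF M N f(1) HK(1)] linear_map_image[OF M N f(1) HK(2)]
      by blast
    then have "f ` H = {\<zero>\<^bsub>N\<^esub>} \<or> f ` H = carrier N" using ind by (simp add: indecomposable_def)
    then have "f ` H = f ` {\<zero>\<^bsub>M\<^esub>} \<or> f ` H = f ` carrier M" using f0 im by simp
    then show ?thesis
      using inj_on_image_eq_iff[OF inj sub(1)] by (metis M.M.zero_closed empty_subsetI insert_subset order_refl)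
  qed
  ultimately show ?thesis by (simp add: indecomposable_def)
qed

lemma direct_decomposition_indecomposable_sum:
  assumes "indecomposable_sum R M (carrier M) n F"
  shows "direct_decomposition R M n F" "\<And>i. i < n \<Longrightarrow> indecomposable R (sub_module M (F i))"
proof -
  have bij: "bij_betw (\<lambda>f. finsum M f {..<n}) (\<Pi>\<^sub>E i\<in>{..<n}. F i) (carrier M)"
    using assms by (simp add: indecomposable_sum_def)
  have "\<exists>!f. f \<in> (\<Pi>\<^sub>E i\<in>{..<n}. F i) \<and> finsum M f {..<n} = x" if "x \<in> carrier M" for x
  proof -
    obtain f where f: "f \<in> (\<Pi>\<^sub>E i\<in>{..<n}. F i)" "x = finsum M f {..<n}"
      using \<open>x \<in> carrier M\<close> bij by (auto simp: bij_betw_def)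
    show ?thesis
    proof (intro ex1I[of _ f] conjI)
      show "g = f" if "g \<in> (\<Pi>\<^sub>E i\<in>{..<n}. F i) \<and> finsum M g {..<n} = x" for g
        using that f by (intro inj_onD[OF bij_betw_imp_inj_on[OF bij]]) auto
    qed (use f in auto)
  qed
  then show "direct_decomposition R M n F"
    unfolding direct_decomposition_def using assms by (intro conjI ballI) (auto simp: indecomposable_sum_def)
  show "indecomposable R (sub_module M (F i))" if "i < n" for i
    using assms that by (simp add: indecomposable_sum_def)
qed

text \<open>Let \<open>T = N \<oplus> U\<close> with \<open>U \<noteq> 0\<close>. An indecomposable summand \<open>S\<close> of \<open>U\<close> has a local endomorphism ring,
  so if it is a retract of a power of \<open>N\<close> then it is already a retract of \<open>N\<close>, and \<open>S\<close> occurs twice in \<open>T\<close>.\<close>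

lemma basic_not_retract_of_proper_summand:
  assumes alg: "artin_algebra k \<phi> R" and T: "left_module R T" and fg: "finitely_generated R T"
    and basic: "basic R T" and N: "proper_direct_summand R N T"
  shows "\<not> retract_of_power R (sub_module T N) T"
proof
  interpret T: left_module R T by fact
  assume ret: "retract_of_power R (sub_module T N) T"
  note algD = artin_algebraD[OF alg]
  note artk = artin_algebra_artinian[OF alg T fg]
  note art = artinian_restrict_scalars[OF algD(2,4) T artk]
  obtain U where NU: "submodule N R T" "submodule U R T" "N \<inter> U = {\<zero>\<^bsub>T\<^esub>}" "N <+>\<^bsub>T\<^esub> U = carrier T"
    and proper: "N \<noteq> carrier T"
    using N unfolding proper_direct_summand_def direct_summand_def by blast
  note Nc = submodule_carrier[OF NU(1)] and Uc = submodule_carrier[OF NU(2)]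
  have "U \<noteq> {\<zero>\<^bsub>T\<^esub>}"
  proof
    assume "U = {\<zero>\<^bsub>T\<^esub>}"
    then have "carrier T \<subseteq> N" using NU(4) Nc by (force simp: set_add_iff)
    then show False using proper submodule_subset[OF NU(1)] by blast
  qed
  then obtain S S' where S: "submodule S R T" "submodule S' R T" "S \<inter> S' = {\<zero>\<^bsub>T\<^esub>}" "S <+>\<^bsub>T\<^esub> S' = U"
    "indecomposable R (sub_module T S)" "S \<noteq> {\<zero>\<^bsub>T\<^esub>}"
    using indecomposable_summand_exists[OF T art NU(2)] by metis
  note Sc = submodule_carrier[OF S(1)] and S'c = submodule_carrier[OF S(2)]
  let ?S = "sub_module T S" and ?N = "sub_module T N" and ?U = "sub_module T U"
  have SU: "S \<subseteq> U" "S' \<subseteq> U" using submodule_subset_set_add[OF T S(1,2)] S(4) by simp_all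
  have Sm: "left_module R ?S" and Nm: "left_module R ?N" and Um: "left_module R ?U"
    using submodule_left_module[OF T] S(1) NU(1,2) by blast+
  have UN: "U \<inter> N = {\<zero>\<^bsub>T\<^esub>}" using NU(3) by blast
  have UNs: "U <+>\<^bsub>T\<^esub> N = carrier T"
  proof (intro equalityI subsetI)
    fix x assume "x \<in> carrier T"
    then obtain n u where "n \<in> N" "u \<in> U" "x = n \<oplus>\<^bsub>T\<^esub> u" unfolding NU(4)[symmetric] set_add_iff by blast
    then show "x \<in> U <+>\<^bsub>T\<^esub> N" unfolding set_add_iff using T.M.a_comm Nc Uc by metis
  qed (use submodule_subset[OF submodule_set_add[OF T NU(2,1)]] in auto)
  obtain pU where pU: "linear_map R T ?U pU" "\<And>x. x \<in> U \<Longrightarrow> pU x = x"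
    using direct_sum_projection[OF T NU(2,1) UN UNs] by metis
  have S_U: "submodule S R ?U" "submodule S' R ?U"
    using SU S by (simp_all add: submodule_sub_module_iff[OF T NU(2)])
  have sumU: "S <+>\<^bsub>?U\<^esub> S' = carrier ?U"
    using S(4) by (simp add: set_add_def set_mult_def)
  have intU: "S \<inter> S' = {\<zero>\<^bsub>?U\<^esub>}" using S(3) by simp
  obtain pS where pS: "linear_map R ?U (sub_module ?U S) pS" "\<And>x. x \<in> S \<Longrightarrow> pS x = x"
    by (rule direct_sum_projection[OF Um S_U intU sumU]) (rule that, assumption+)
  define \<pi> where "\<pi> x = pS (pU x)" for x
  have \<pi>: "linear_map R T ?S \<pi>" using linear_map_comp[OF pU(1) pS(1)] by (simp add: \<pi>_def[abs_def])
  have \<pi>S: "\<pi> x = x" if "x \<in> S" for x using that SU pU(2) pS(2) by (auto simp: \<pi>_def)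
  obtain n p q where p: "linear_map R (power_module ?N n) T p" and q: "linear_map R T (power_module ?N n) q"
    and pq: "\<And>x. x \<in> carrier T \<Longrightarrow> p (q x) = x"
    using retract_of_powerE[OF ret] by metis
  \<comment> \<open>Components of the retraction from a power of N: the identity of S is the sum of
    the composites \<open>a i \<circ> b i\<close>, each of which passes through N.\<close>
  define a where "a i x = \<pi> (p (power_incl ?N n i x))" for i x
  define b where "b i x = q x i" for i x
  have a: "linear_map R ?N ?S (a i)" for i
    unfolding a_def[abs_def] by (rule linear_map_comp[OF linear_map_comp[OF linear_map_power_incl[OF Nm] p] \<pi>])
  have b: "linear_map R ?S ?N (b i)" if "i < n" for i
    unfolding b_def[abs_def]
    by (rule linear_map_comp[OF linear_map_comp[OF linear_map_incl[OF S(1)] q] linear_map_nth[OF that]])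
  have sum: "x = (\<Oplus>\<^bsub>?S\<^esub>i\<in>{..<n}. a i (b i x))" if x: "x \<in> carrier ?S" for x
  proof -
    have xS: "x \<in> S" "x \<in> carrier T" using x Sc by simp_all
    have "q x \<in> {..<n} \<rightarrow>\<^sub>E carrier ?N" using linear_map_closed[OF q xS(2)] by simp
    from linear_map_power_eq[OF Nm Sm linear_map_comp[OF p \<pi>] this]
    have "\<pi> (p (q x)) = (\<Oplus>\<^bsub>?S\<^esub>i\<in>{..<n}. a i (b i x))" by (simp add: a_def b_def)
    then show ?thesis using pq[OF xS(2)] \<pi>S[OF xS(1)] by simp
  qed
  have fgS: "finitely_generated R ?S"
  proof (rule finitely_generated_image[OF T Sm \<pi> _ fg])
    show "\<pi> ` carrier T = carrier ?S" using \<pi>S Sc linear_map_closed[OF \<pi>] by force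
  qed
  have artS: "artinian_module R ?S" by (rule artinian_sub_module[OF T S(1) art])
  have artE: "artinian_module k (hom_module \<phi> R ?S ?S)"
    by (rule hom_module_artinian[OF alg Sm Sm fgS artin_algebra_artinian[OF alg Sm fgS]])
  note fit = indecomposable_endo[OF Sm S(5) alg artS artE]
  have neS: "carrier ?S \<noteq> {\<zero>\<^bsub>?S\<^esub>}" using S(6) by simp
  \<comment> \<open>Locality applied to this sum, whose total is the identity. Correcting
    \<open>a i\<close> by the inverse of the composite gives \<open>a'\<close> with
    \<open>a' \<circ> b i\<close> the identity, so N has a direct summand \<open>N'\<close>
    isomorphic to S.\<close>
  have "\<exists>i<n. bij_betw (\<lambda>x. a i (b i x)) (carrier ?S) (carrier ?S)"
    by (rule local_sum_bijective[OF Sm neS fit linear_map_comp[OF b a] linear_map_id _ sum])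
      (simp_all add: bij_betw_def)
  then obtain i where i: "i < n" "bij_betw (\<lambda>x. a i (b i x)) (carrier ?S) (carrier ?S)" by blast
  let ?v = "inv_into (carrier ?S) (\<lambda>x. a i (b i x))"
  have v: "linear_map R ?S ?S ?v" by (rule linear_map_inv[OF Sm linear_map_comp[OF b[OF i(1)] a] i(2)])
  define a' where "a' x = ?v (a i x)" for x
  have a': "linear_map R ?N ?S a'" unfolding a'_def[abs_def] by (rule linear_map_comp[OF a v])
  have ab: "a' (b i x) = x" if "x \<in> carrier ?S" for x
    using that i(2) inv_into_f_f[of "\<lambda>x. a i (b i x)" "carrier ?S" x] by (simp add: a'_def bij_betw_def)
  define N' where "N' = b i ` S"
  define N'' where "N'' = a_kernel ?N ?S a'"
  have dN: "N' \<inter> N'' = {\<zero>\<^bsub>T\<^esub>}" "N' <+>\<^bsub>T\<^esub> N'' = N"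
    using direct_summandI(2,3)[OF Sm Nm a' b[OF i(1)] ab] by (simp_all add: N'_def N''_def set_add_def set_mult_def)
  have "submodule N' R ?N"
    using linear_map_image[OF Sm Nm b[OF i(1)] left_module.submodule_self[OF Sm]] by (simp add: N'_def)
  moreover have "submodule N'' R ?N"
    using linear_map_kernel[OF Nm Sm a'] by (simp add: N''_def)
  ultimately have sN: "submodule N' R T" "N' \<subseteq> N" "submodule N'' R T" "N'' \<subseteq> N"
    by (simp_all add: submodule_sub_module_iff[OF T NU(1)])
  note N'c = submodule_carrier[OF sN(1)] and N''c = submodule_carrier[OF sN(3)]
  let ?N' = "sub_module T N'"
  have N'm: "left_module R ?N'" by (rule submodule_left_module[OF T sN(1)])
  have bN': "linear_map R ?S ?N' (b i)"
    by (rule linear_map_sub_cod[OF linear_map_sub_codD[OF NU(1) b[OF i(1)]]]) (simp add: N'_def)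
  have injb: "inj_on (b i) S" using ab by (auto intro!: inj_onI) (metis)
  have bbij: "bij_betw (b i) (carrier ?S) (carrier ?N')"
    using injb by (simp add: bij_betw_def N'_def)
  have iso: "mod_isomorphic R ?S ?N'"
    unfolding mod_isomorphic_iff[OF Sm] using bN' bbij by blast
  have indN': "indecomposable R ?N'"
    by (rule indecomposable_iso[OF N'm Sm linear_map_inv[OF Sm bN' bbij] bij_betw_inv_into[OF bbij] S(5)])
  \<comment> \<open>What remains of T besides S and its copy \<open>N'\<close>. It is decomposed
    arbitrarily; the contradiction comes from the two added summands.\<close>
  let ?W = "S' <+>\<^bsub>T\<^esub> N''"
  have W: "submodule ?W R T" by (rule submodule_set_add[OF T S(2) sN(3)])
  have N'W: "submodule (N' <+>\<^bsub>T\<^esub> ?W) R T" by (rule submodule_set_add[OF T sN(1) W])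
  obtain m F where F: "indecomposable_sum R T ?W m F"
    using indecomposable_sum_exists[OF T art W] by blast
  have "N' \<inter> ?W = {\<zero>\<^bsub>T\<^esub>}"
  proof (intro equalityI subsetI)
    fix x assume "x \<in> N' \<inter> ?W"
    then obtain s y where x: "x \<in> N'" "s \<in> S'" "y \<in> N''" "x = s \<oplus>\<^bsub>T\<^esub> y"
      unfolding Int_iff set_add_iff by blast
    then have "s = x \<ominus>\<^bsub>T\<^esub> y" using T.add_diff_cancel_right S'c N''c by simp
    then have "s \<in> N" using submodule_diff[OF NU(1)] x sN by blast
    then have "s = \<zero>\<^bsub>T\<^esub>" using x SU NU(3) by blast
    then have "x = y" using x N''c by simp
    then show "x \<in> {\<zero>\<^bsub>T\<^esub>}" using x dN by blast
  qed (use submodule_zero[OF W] submodule_zero[OF sN(1)] in auto)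
  note F1 = indecomposable_sum_add[OF T sN(1) indN' W this F]
  have "S \<inter> (N' <+>\<^bsub>T\<^esub> ?W) = {\<zero>\<^bsub>T\<^esub>}"
  proof (intro equalityI subsetI)
    fix x assume "x \<in> S \<inter> (N' <+>\<^bsub>T\<^esub> ?W)"
    then obtain z s y where x: "x \<in> S" "z \<in> N'" "s \<in> S'" "y \<in> N''" "x = z \<oplus>\<^bsub>T\<^esub> (s \<oplus>\<^bsub>T\<^esub> y)"
      unfolding Int_iff set_add_iff Bex_def by blast
    then have "x = (z \<oplus>\<^bsub>T\<^esub> y) \<oplus>\<^bsub>T\<^esub> s" using N'c S'c N''c by (simp add: T.M.a_ac)
    then have "x \<ominus>\<^bsub>T\<^esub> s = z \<oplus>\<^bsub>T\<^esub> y" using T.add_diff_cancel_right x N'c S'c N''c by simp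
    moreover have "z \<oplus>\<^bsub>T\<^esub> y \<in> N" using submodule_add[OF NU(1)] x sN by blast
    moreover have "x \<ominus>\<^bsub>T\<^esub> s \<in> U" using submodule_diff[OF NU(2)] x SU by blast
    ultimately have "x \<ominus>\<^bsub>T\<^esub> s = \<zero>\<^bsub>T\<^esub>" using NU(3) by auto
    then have "x = s" using T.diff_eq_zero_iff x Sc S'c by simp
    then show "x \<in> {\<zero>\<^bsub>T\<^esub>}" using x S(3) by blast
  qed (use submodule_zero[OF N'W] submodule_zero[OF S(1)] in auto)
  note F2 = indecomposable_sum_add[OF T S(1,5) N'W this F1]
  have "S <+>\<^bsub>T\<^esub> (N' <+>\<^bsub>T\<^esub> ?W) = carrier T"
  proof (intro equalityI subsetI)
    fix x assume "x \<in> carrier T"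
    then obtain y u where yu: "y \<in> N" "u \<in> U" "x = y \<oplus>\<^bsub>T\<^esub> u" unfolding NU(4)[symmetric] set_add_iff by blast
    obtain y1 y2 where y: "y1 \<in> N'" "y2 \<in> N''" "y = y1 \<oplus>\<^bsub>T\<^esub> y2" using yu(1) unfolding dN(2)[symmetric] set_add_iff by blast
    obtain u1 u2 where u: "u1 \<in> S" "u2 \<in> S'" "u = u1 \<oplus>\<^bsub>T\<^esub> u2" using yu(2) unfolding S(4)[symmetric] set_add_iff by blast
    have "x = u1 \<oplus>\<^bsub>T\<^esub> (y1 \<oplus>\<^bsub>T\<^esub> (u2 \<oplus>\<^bsub>T\<^esub> y2))"
      using yu y u N'c N''c Sc S'c by (simp add: T.M.a_ac)
    then show "x \<in> S <+>\<^bsub>T\<^esub> (N' <+>\<^bsub>T\<^esub> ?W)" unfolding set_add_iff Bex_def using y u by blast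
  qed (use submodule_subset[OF submodule_set_add[OF T S(1) N'W]] in auto)
  note dec = direct_decomposition_indecomposable_sum[OF F2[unfolded this]]
  \<comment> \<open>\<open>N'\<close> was added at index \<open>m\<close> and S at
    \<open>Suc m\<close>, in a decomposition of length \<open>Suc (Suc m)\<close>.\<close>
  have "\<not> mod_isomorphic R (sub_module T ((F(m := N', Suc m := S)) (Suc m)))
      (sub_module T ((F(m := N', Suc m := S)) m))"
    using basic[unfolded basic_def, rule_format, of "Suc (Suc m)" "F(m := N', Suc m := S)" "Suc m" m] dec
    by auto
  then show False using iso by simp
qed

section \<open>The subcategory $\mathrm{gen}_1$\<close>

lemma power_in_add_subcat:
  assumes M: "left_module R M"
  shows "power_module M n \<in> add_subcat R M"
proof -
  let ?P = "power_module M n"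
  have P: "left_module R ?P" by (rule power_left_module[OF M])
  have id: "linear_map R ?P ?P (\<lambda>x. x)" by (rule linear_map_id)
  have "direct_summand R ((\<lambda>x. x) ` carrier ?P) ?P" by (rule direct_summandI(1)[OF P P id id refl])
  moreover have "mod_isomorphic R ?P (sub_module ?P (carrier ?P))"
    unfolding mod_isomorphic_iff[OF P]
    by (intro exI[of _ "\<lambda>x. x"] conjI linear_map_sub_cod[OF id]) (simp_all add: bij_betw_def)
  ultimately show ?thesis unfolding add_subcat_def using P by auto
qed

text \<open>The structure on the image of \<open>j\<close> that makes \<open>j\<close> an
  isomorphism when it is injective on the carrier. It moves T to the element type at which
  \<open>gen1_critical\<close> compares subcategories.\<close>

definition transport_module :: "('m \<Rightarrow> 'x) \<Rightarrow> ('a, 'm) module \<Rightarrow> ('a, 'x) module" where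
  "transport_module j M =
     \<lparr>carrier = j ` carrier M, monoid.mult = undefined, one = undefined, ring.zero = j \<zero>\<^bsub>M\<^esub>,
      ring.add = (\<lambda>x y. j (inv_into (carrier M) j x \<oplus>\<^bsub>M\<^esub> inv_into (carrier M) j y)),
      smult = (\<lambda>r x. j (r \<odot>\<^bsub>M\<^esub> inv_into (carrier M) j x))\<rparr>"

lemma transport_module_simps [simp]:
  "carrier (transport_module j M) = j ` carrier M"
  "\<zero>\<^bsub>transport_module j M\<^esub> = j \<zero>\<^bsub>M\<^esub>"
  "x \<oplus>\<^bsub>transport_module j M\<^esub> y = j (inv_into (carrier M) j x \<oplus>\<^bsub>M\<^esub> inv_into (carrier M) j y)"
  "r \<odot>\<^bsub>transport_module j M\<^esub> x = j (r \<odot>\<^bsub>M\<^esub> inv_into (carrier M) j x)"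
  by (simp_all add: transport_module_def)

lemma transport_left_module:
  assumes M: "left_module R M" and inj: "inj_on j (carrier M)"
  shows "left_module R (transport_module j M)" "linear_map R M (transport_module j M) j"
proof -
  interpret M: left_module R M by fact
  note f = inv_into_f_f[OF inj]
  show "left_module R (transport_module j M)"
  proof (rule left_moduleI)
    fix x y z
    assume "x \<in> carrier (transport_module j M)" "y \<in> carrier (transport_module j M)"
      "z \<in> carrier (transport_module j M)"
    then show "x \<oplus>\<^bsub>transport_module j M\<^esub> y \<oplus>\<^bsub>transport_module j M\<^esub> z
      = x \<oplus>\<^bsub>transport_module j M\<^esub> (y \<oplus>\<^bsub>transport_module j M\<^esub> z)"
      by (auto simp: f M.M.a_assoc)
  next
    fix x y
    assume "x \<in> carrier (transport_module j M)" "y \<in> carrier (transport_module j M)"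
    then show "x \<oplus>\<^bsub>transport_module j M\<^esub> y = y \<oplus>\<^bsub>transport_module j M\<^esub> x"
      by (auto simp: f M.M.a_comm)
  qed (auto simp: f M.R.ring_axioms M.smult_l_distr M.smult_r_distr M.smult_assoc1)
  show "linear_map R M (transport_module j M) j"
    by (rule linear_mapI) (simp_all add: f)
qed

lemma generated_by_retract:
  assumes T: "left_module R T" and N: "left_module R N"
    and a: "linear_map R T N a" and b: "linear_map R N T b" and ab: "\<And>x. x \<in> carrier N \<Longrightarrow> a (b x) = x"
    and gen: "generated_by R N Y"
  shows "generated_by R T Y"
  unfolding generated_by_def
proof
  fix y assume "y \<in> carrier Y"
  then obtain n v t where v: "linear_map R (power_module N n) Y v" "t \<in> carrier (power_module N n)" "v t = y"
    using gen unfolding generated_by_def by blast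
  let ?a = "\<lambda>u. \<lambda>i\<in>{..<n}. a (u i)" and ?b = "\<lambda>u. \<lambda>i\<in>{..<n}. b (u i)"
  have a': "linear_map R (power_module T n) (power_module N n) ?a"
    by (rule linear_map_tuple[OF linear_map_comp[OF linear_map_nth a]])
  have b': "linear_map R (power_module N n) (power_module T n) ?b"
    by (rule linear_map_tuple[OF linear_map_comp[OF linear_map_nth b]])
  have t: "t \<in> {..<n} \<rightarrow>\<^sub>E carrier N" using v(2) by simp
  have "?a (?b t) = t"
    using t by (intro PiE_eqI[of _ n "carrier N" t "carrier N"]) (auto simp: ab PiE_nth[OF t])
  then have "v (?a (?b t)) = y" using v(3) by simp
  then show "\<exists>n v t. linear_map R (power_module T n) Y v \<and> t \<in> carrier (power_module T n) \<and> v t = y"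
    using linear_map_comp[OF a' v(1)] linear_map_closed[OF b' v(2)] by blast
qed

lemma retract_of_power_generated:
  assumes "retract_of_power R M X" "linear_map R X Y f" "f ` carrier X = carrier Y"
  shows "generated_by R M Y"
  unfolding generated_by_def
proof
  fix y assume "y \<in> carrier Y"
  then obtain x where x: "x \<in> carrier X" "y = f x" using assms(3) by blast
  obtain n p q where p: "linear_map R (power_module M n) X p" and q: "linear_map R X (power_module M n) q"
    and pq: "\<And>x. x \<in> carrier X \<Longrightarrow> p (q x) = x"
    using retract_of_powerE[OF assms(1)] by metis
  have "f (p (q x)) = y" using pq x by simp
  then show "\<exists>n v t. linear_map R (power_module M n) Y v \<and> t \<in> carrier (power_module M n) \<and> v t = y"
    using linear_map_comp[OF p assms(2)] linear_map_closed[OF q x(1)] by blast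
qed

lemma classical_tiltingD:
  assumes "classical_tilting R T"
  shows "left_module R T" "finitely_generated R T" "proj_dim_le_1 R T" "ext_zero R T T"
proof -
  show T: "left_module R T" and "finitely_generated R T" "proj_dim_le_1 R T"
    using assms by (simp_all add: classical_tilting_def fg_module_def)
  show "ext_zero R T T"
    using assms by (intro Ext1_trivial_ext_zero[OF T T]) (simp add: classical_tilting_def)
qed

text \<open>T is presented by itself, with the zero module in front. The powers with exponents 0 and
  1 take these places because \<open>gen1\<close> asks for modules with elements of type
  \<open>nat \<Rightarrow> 'm\<close>. The map onto the copy of T is an isomorphism, so the sequence
  stays exact under Hom.\<close>

lemma gen1_transport:
  assumes T: "left_module R T" and fg: "finitely_generated R T" and inj: "inj_on j (carrier T)"
  shows "transport_module j T \<in> gen1 R T"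
proof -
  interpret T: left_module R T by fact
  let ?X = "transport_module j T" and ?M2 = "power_module T 0" and ?M1 = "power_module T 1"
  have X: "left_module R ?X" and j: "linear_map R T ?X j" using transport_left_module[OF T inj] .
  have M1: "left_module R ?M1" and M2: "left_module R ?M2" by (rule power_left_module[OF T])+
  have fgX: "fg_module R ?X"
    unfolding fg_module_def using X finitely_generated_image[OF T X j _ fg] by simp
  have bij: "bij_betw j (carrier T) (carrier ?X)" using inj by (simp add: bij_betw_def)
  let ?f = "restrict (\<lambda>x. \<zero>\<^bsub>?M1\<^esub>) (carrier ?M2)" and ?g = "restrict (\<lambda>u. j (u 0)) (carrier ?M1)"
  have f: "?f \<in> mod_hom R ?M2 ?M1" by (rule restrict_mod_hom[OF M2 linear_map_const_zero[OF M1]])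
  have g: "?g \<in> mod_hom R ?M1 ?X"
    by (rule restrict_mod_hom[OF M1 linear_map_comp[OF linear_map_nth j]]) simp
  have inc: "power_incl T 1 0 x \<in> carrier ?M1" "power_incl T 1 0 x 0 = x" if "x \<in> carrier T" for x
    using that by (auto simp: power_incl_def)
  have g0: "u = \<zero>\<^bsub>?M1\<^esub>" if u: "u \<in> carrier ?M1" "j (u 0) = \<zero>\<^bsub>?X\<^esub>" for u
  proof -
    have u': "u \<in> {..<1} \<rightarrow>\<^sub>E carrier T" using u by simp
    have "u 0 \<in> carrier T" using PiE_nth[OF u', of 0] by simp
    then have "u 0 = \<zero>\<^bsub>T\<^esub>" using u(2) inj_onD[OF inj] by simp
    then show ?thesis using u' by (intro PiE_eqI[of u 1 "carrier T" _ "carrier T"]) auto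
  qed
  have "\<zero>\<^bsub>?M2\<^esub> \<in> carrier ?M2" by (rule submodule_zero[OF left_module.submodule_self[OF M2]])
  then have fim: "?f ` carrier ?M2 = {\<zero>\<^bsub>?M1\<^esub>}" by force
  have "\<zero>\<^bsub>?M1\<^esub> \<in> carrier ?M1" "?g \<zero>\<^bsub>?M1\<^esub> = \<zero>\<^bsub>?X\<^esub>" by simp_all
  then have ker: "a_kernel ?M1 ?X ?g = {\<zero>\<^bsub>?M1\<^esub>}"
  proof (intro equalityI subsetI)
    fix u assume "u \<in> a_kernel ?M1 ?X ?g"
    then have u: "u \<in> carrier ?M1" "?g u = \<zero>\<^bsub>?X\<^esub>" by (simp_all only: a_kernel_def' mem_Collect_eq)
    then have "j (u 0) = \<zero>\<^bsub>?X\<^esub>" by (simp only: restrict_apply if_True)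
    then show "u \<in> {\<zero>\<^bsub>?M1\<^esub>}" using g0[OF u(1)] by blast
  next
    fix u assume "u \<in> {\<zero>\<^bsub>?M1\<^esub>}"
    then show "u \<in> a_kernel ?M1 ?X ?g"
      using \<open>\<zero>\<^bsub>?M1\<^esub> \<in> carrier ?M1\<close> \<open>?g \<zero>\<^bsub>?M1\<^esub> = \<zero>\<^bsub>?X\<^esub>\<close>
      by (simp only: a_kernel_def' mem_Collect_eq singleton_iff)
  qed
  have gim: "?g ` carrier ?M1 = carrier ?X"
  proof (intro equalityI subsetI)
    fix x assume "x \<in> carrier ?X"
    then obtain t where t: "t \<in> carrier T" "x = j t" by auto
    then have "?g (power_incl T 1 0 t) = x" using inc[OF t(1)] by (simp only: restrict_apply if_True)
    then show "x \<in> ?g ` carrier ?M1" using inc(1)[OF t(1)] by (metis imageI)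
  qed (use linear_map_closed[OF mod_hom_linear[OF g]] in blast)
  have hom2: "mod_hom R T ?M2 \<noteq> {}"
    using restrict_mod_hom[OF T linear_map_const_zero[OF M2]] by blast
  have f_comp: "compose (carrier T) ?f h = (\<lambda>x\<in>carrier T. \<zero>\<^bsub>?M1\<^esub>)" if "h \<in> mod_hom R T ?M2" for h
    using linear_map_closed[OF mod_hom_linear[OF that]]
    unfolding compose_def by (intro restrict_ext) (simp only: restrict_apply if_True)
  have lhs: "compose (carrier T) ?f ` mod_hom R T ?M2 = {\<lambda>x\<in>carrier T. \<zero>\<^bsub>?M1\<^esub>}"
    using hom2 f_comp by (auto simp: image_iff)
  have rhs: "{h \<in> mod_hom R T ?M1. compose (carrier T) ?g h = (\<lambda>x\<in>carrier T. \<zero>\<^bsub>?X\<^esub>)}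
    = {\<lambda>x\<in>carrier T. \<zero>\<^bsub>?M1\<^esub>}"
  proof (intro equalityI subsetI)
    fix h assume "h \<in> {h \<in> mod_hom R T ?M1. compose (carrier T) ?g h = (\<lambda>x\<in>carrier T. \<zero>\<^bsub>?X\<^esub>)}"
    then have h: "h \<in> mod_hom R T ?M1" "compose (carrier T) ?g h = (\<lambda>x\<in>carrier T. \<zero>\<^bsub>?X\<^esub>)" by simp_all
    have "h x = \<zero>\<^bsub>?M1\<^esub>" if x: "x \<in> carrier T" for x
    proof -
      have hx: "h x \<in> carrier ?M1" by (rule linear_map_closed[OF mod_hom_linear[OF h(1)] x])
      have "?g (h x) = \<zero>\<^bsub>?X\<^esub>" using fun_cong[OF h(2), of x] x by (simp only: compose_def restrict_apply if_True)
      then show ?thesis using g0[OF hx] hx by (simp only: restrict_apply if_True)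
    qed
    then have "h = (\<lambda>x\<in>carrier T. \<zero>\<^bsub>?M1\<^esub>)"
      using h(1) by (intro extensionalityI[of h "carrier T"]) (auto simp: mod_hom_iff)
    then show "h \<in> {\<lambda>x\<in>carrier T. \<zero>\<^bsub>?M1\<^esub>}" by simp
  next
    fix h assume "h \<in> {\<lambda>x\<in>carrier T. \<zero>\<^bsub>?M1\<^esub>}"
    then have h: "h = (\<lambda>x\<in>carrier T. \<zero>\<^bsub>?M1\<^esub>)" by simp
    have "h \<in> mod_hom R T ?M1" unfolding h by (rule restrict_mod_hom[OF T linear_map_const_zero[OF M1]])
    moreover have "compose (carrier T) ?g h = (\<lambda>x\<in>carrier T. \<zero>\<^bsub>?X\<^esub>)"
      using \<open>\<zero>\<^bsub>?M1\<^esub> \<in> carrier ?M1\<close> \<open>?g \<zero>\<^bsub>?M1\<^esub> = \<zero>\<^bsub>?X\<^esub>\<close> unfolding h compose_def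
      by (intro restrict_ext) (simp only: restrict_apply if_True)
    ultimately show "h \<in> {h \<in> mod_hom R T ?M1. compose (carrier T) ?g h = (\<lambda>x\<in>carrier T. \<zero>\<^bsub>?X\<^esub>)}" by simp
  qed
  have "compose (carrier T) ?g ` mod_hom R T ?M1 = mod_hom R T ?X"
  proof (intro equalityI subsetI)
    fix h assume "h \<in> compose (carrier T) ?g ` mod_hom R T ?M1"
    then obtain h' where h': "h' \<in> mod_hom R T ?M1" "h = compose (carrier T) ?g h'" by blast
    show "h \<in> mod_hom R T ?X" unfolding h'(2) compose_def
      by (rule restrict_mod_hom[OF T linear_map_comp[OF mod_hom_linear[OF h'(1)] mod_hom_linear[OF g]]])
  next
    fix h assume h: "h \<in> mod_hom R T ?X"
    note hl = mod_hom_linear[OF h] and jl = linear_map_inv[OF T j bij]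
    let ?h = "\<lambda>x\<in>carrier T. power_incl T 1 0 (inv_into (carrier T) j (h x))"
    have h': "?h \<in> mod_hom R T ?M1"
      by (rule restrict_mod_hom[OF T linear_map_comp[OF linear_map_comp[OF hl jl] linear_map_power_incl[OF T]]])
    have "compose (carrier T) ?g ?h x = h x" if x: "x \<in> carrier T" for x
    proof -
      have hx: "h x \<in> carrier ?X" by (rule linear_map_closed[OF hl x])
      then have jx: "inv_into (carrier T) j (h x) \<in> carrier T" "j (inv_into (carrier T) j (h x)) = h x"
        using linear_map_closed[OF jl hx] by (simp_all add: f_inv_into_f)
      then show ?thesis using inc[OF jx(1)] x by (simp only: compose_def restrict_apply if_True)
    qed
    then have eq: "compose (carrier T) ?g ?h = h"
      using h by (intro extensionalityI[of _ "carrier T"]) (auto simp: mod_hom_iff compose_def)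
    have "compose (carrier T) ?g ?h \<in> compose (carrier T) ?g ` mod_hom R T ?M1" using h' by (rule imageI)
    then show "h \<in> compose (carrier T) ?g ` mod_hom R T ?M1" unfolding eq .
  qed
  then show ?thesis
    unfolding gen1_def using fgX power_in_add_subcat[OF T, of 0] power_in_add_subcat[OF T, of 1] f g fim ker gim lhs rhs
    by (intro CollectI conjI exI[of _ ?M2] exI[of _ ?M1] exI[of _ ?f] exI[of _ ?g]) (simp_all only:)
qed

lemma tilting_gen1_critical:
  assumes alg: "artin_algebra k \<phi> R" and tilt: "classical_tilting R T" and basic: "basic R T"
  shows "gen1_critical R (T :: ('a, 'm) module)"
  unfolding gen1_critical_def
proof (intro allI impI notI)
  note T = classical_tiltingD(1)[OF tilt] and fg = classical_tiltingD(2)[OF tilt]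
    and pd = classical_tiltingD(3)[OF tilt] and ext = classical_tiltingD(4)[OF tilt]
  interpret T: left_module R T by (rule T)
  fix N assume N: "proper_direct_summand R N T"
    and eq: "(gen1 R (sub_module T N) :: ('a, (nat \<Rightarrow> 'a) set) module set) = gen1 R T"
  let ?N = "sub_module T N"
  obtain N' where NN': "submodule N R T" "submodule N' R T" "N \<inter> N' = {\<zero>\<^bsub>T\<^esub>}" "N <+>\<^bsub>T\<^esub> N' = carrier T"
    using N unfolding proper_direct_summand_def direct_summand_def by blast
  obtain \<pi> where \<pi>: "linear_map R T ?N \<pi>" "\<And>x. x \<in> N \<Longrightarrow> \<pi> x = x"
    using direct_sum_projection[OF T NN'] by metis
  have Nm: "left_module R ?N" by (rule submodule_left_module[OF T NN'(1)])
  obtain n \<gamma> where \<gamma>: "linear_map R (power_module (regular_module R) n) T \<gamma>"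
    "\<gamma> ` carrier (power_module (regular_module R) n) = carrier T"
    using finitely_generated_surj[OF T fg] by metis
  \<comment> \<open>The fibre over \<open>t\<close> of a free presentation of T, that is, a coset of
    its kernel. Fibres over distinct points differ since they are nonempty and disjoint.\<close>
  define j where "j t = {u \<in> carrier (power_module (regular_module R) n). \<gamma> u = t}" for t
  have inj: "inj_on j (carrier T)"
  proof (rule inj_onI)
    fix s t assume st: "s \<in> carrier T" "t \<in> carrier T" "j s = j t"
    then obtain u where "u \<in> carrier (power_module (regular_module R) n)" "\<gamma> u = s"
      using \<gamma>(2) by (metis imageE)
    then have "u \<in> j s" by (simp add: j_def)
    then show "s = t" using st(3) by (auto simp: j_def)
  qed
  define X where "X = transport_module j T"
  have X: "left_module R X" and j: "linear_map R T X j" unfolding X_def using transport_left_module[OF T inj] .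
  have bij: "bij_betw j (carrier T) (carrier X)" using inj by (simp add: bij_betw_def X_def)
  let ?\<theta> = "inv_into (carrier T) j"
  have \<theta>: "linear_map R X T ?\<theta>" by (rule linear_map_inv[OF T j bij])
  have "X \<in> gen1 R ?N" unfolding X_def using gen1_transport[OF T fg inj] eq by blast
  then obtain M2 M1 :: "('a, nat \<Rightarrow> 'm) module" and f g where
    M: "M2 \<in> add_subcat R ?N" "M1 \<in> add_subcat R ?N" and
    f: "f \<in> mod_hom R M2 M1" and g: "g \<in> mod_hom R M1 X" and
    ex: "f ` carrier M2 = a_kernel M1 X g" "g ` carrier M1 = carrier X"
    unfolding gen1_def mem_Collect_eq by (elim conjE exE) (rule that; assumption)
  have M1: "left_module R M1" and M2: "left_module R M2" using M by (simp_all add: add_subcat_def)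
  \<comment> \<open>The surjection onto the copy of T is turned back into one onto T. As
    \<open>?\<theta>\<close> is injective the kernel does not change, and it remains the image of
    \<open>M2\<close>.\<close>
  let ?g = "\<lambda>x. ?\<theta> (g x)"
  have g': "linear_map R M1 T ?g" by (rule linear_map_comp[OF mod_hom_linear[OF g] \<theta>])
  have g's: "?g ` carrier M1 = carrier T"
  proof -
    have "?g ` carrier M1 = ?\<theta> ` (g ` carrier M1)" by (simp add: image_image)
    also have "\<dots> = carrier T" unfolding ex(2) by (rule bij_betw_imp_surj_on[OF bij_betw_inv_into[OF bij]])
    finally show ?thesis .
  qed
  have gx: "g x \<in> carrier X" if "x \<in> carrier M1" for x by (rule linear_map_closed[OF mod_hom_linear[OF g] that])
  have \<theta>0: "?\<theta> y = \<zero>\<^bsub>T\<^esub> \<longleftrightarrow> y = \<zero>\<^bsub>X\<^esub>" if "y \<in> carrier X" for y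
  proof
    have "j (?\<theta> y) = y" using that bij by (simp add: bij_betw_def f_inv_into_f)
    moreover assume "?\<theta> y = \<zero>\<^bsub>T\<^esub>"
    ultimately show "y = \<zero>\<^bsub>X\<^esub>" using linear_map_zero[OF T X j] by metis
  qed (simp add: linear_map_zero[OF X T \<theta>])
  have ker: "a_kernel M1 T ?g = a_kernel M1 X g"
    unfolding a_kernel_def' using gx \<theta>0 by blast
  let ?K = "sub_module M1 (a_kernel M1 T ?g)"
  have K: "submodule (a_kernel M1 T ?g) R M1" by (rule linear_map_kernel[OF M1 T g'])
  have Km: "left_module R ?K" by (rule submodule_left_module[OF M1 K])
  have fK: "linear_map R M2 ?K f"
    by (rule linear_map_sub_cod[OF mod_hom_linear[OF f]]) (use ex(1) ker in blast)
  have "generated_by R ?N ?K"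
    by (rule retract_of_power_generated[OF add_subcat_retract_of_power[OF Nm M(1)] fK]) (simp add: ker ex(1))
  then have "generated_by R T ?K"
    by (rule generated_by_retract[OF T Nm \<pi>(1) linear_map_incl[OF NN'(1)], rotated]) (simp add: \<pi>(2))
  then have "ext_zero R T ?K" by (rule ext_zero_generated[OF T Km pd ext])
  then obtain s where s: "linear_map R T M1 s" "\<And>x. x \<in> carrier T \<Longrightarrow> ?g (s x) = x"
    using ext_zero_split[OF T M1 g' g's] by blast
  obtain m p q where p: "linear_map R (power_module ?N m) M1 p" and q: "linear_map R M1 (power_module ?N m) q"
    and pq: "\<And>x. x \<in> carrier M1 \<Longrightarrow> p (q x) = x"
    using retract_of_powerE[OF add_subcat_retract_of_power[OF Nm M(2)]] by metis
  have "?g (p (q (s x))) = x" if "x \<in> carrier T" for x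
    using pq[OF linear_map_closed[OF s(1) that]] s(2)[OF that] by simp
  then have "retract_of_power R ?N T"
    unfolding retract_of_power_def using linear_map_comp[OF p g'] linear_map_comp[OF s(1) q] by blast
  then show False using basic_not_retract_of_proper_summand[OF alg T fg basic N] by blast
qed

section \<open>Faithfully balanced modules\<close>

text \<open>The endomorphisms of M over its endomorphism ring, freed from extensionality: neither
  \<open>\<psi>\<close> nor the maps \<open>e\<close> are constrained off the carrier.\<close>

definition bicommutant :: "('a, 'r) ring_scheme \<Rightarrow> ('a, 'm) module \<Rightarrow> ('m \<Rightarrow> 'm) set" where
  "bicommutant R M = {\<psi>. (\<forall>x\<in>carrier M. \<psi> x \<in> carrier M) \<and>
     (\<forall>x\<in>carrier M. \<forall>y\<in>carrier M. \<psi> (x \<oplus>\<^bsub>M\<^esub> y) = \<psi> x \<oplus>\<^bsub>M\<^esub> \<psi> y) \<and>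
     (\<forall>e x. linear_map R M M e \<longrightarrow> x \<in> carrier M \<longrightarrow> \<psi> (e x) = e (\<psi> x))}"

lemma bicommutantD:
  assumes "\<psi> \<in> bicommutant R M"
  shows "\<And>x. x \<in> carrier M \<Longrightarrow> \<psi> x \<in> carrier M"
    and "\<And>x y. \<lbrakk>x \<in> carrier M; y \<in> carrier M\<rbrakk> \<Longrightarrow> \<psi> (x \<oplus>\<^bsub>M\<^esub> y) = \<psi> x \<oplus>\<^bsub>M\<^esub> \<psi> y"
    and "\<And>e x. \<lbrakk>linear_map R M M e; x \<in> carrier M\<rbrakk> \<Longrightarrow> \<psi> (e x) = e (\<psi> x)"
  using assms by (auto simp: bicommutant_def)

lemma endo_simps [simp]:
  "carrier (endo_ring R M) = mod_hom R M M"
  "carrier (endo_module M) = carrier M"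
  "x \<oplus>\<^bsub>endo_module M\<^esub> y = x \<oplus>\<^bsub>M\<^esub> y"
  "e \<odot>\<^bsub>endo_module M\<^esub> x = e x"
  by (simp_all add: endo_ring_def endo_module_def)

lemma endo_hom_iff:
  assumes M: "left_module R M"
  shows "\<psi> \<in> mod_hom (endo_ring R M) (endo_module M) (endo_module M) \<longleftrightarrow>
    \<psi> \<in> bicommutant R M \<and> \<psi> \<in> extensional (carrier M)" (is "?l \<longleftrightarrow> ?r")
proof
  assume l: ?l
  then have \<psi>: "\<And>x. x \<in> carrier M \<Longrightarrow> \<psi> x \<in> carrier M" "\<psi> \<in> extensional (carrier M)"
    "\<And>x y. \<lbrakk>x \<in> carrier M; y \<in> carrier M\<rbrakk> \<Longrightarrow> \<psi> (x \<oplus>\<^bsub>M\<^esub> y) = \<psi> x \<oplus>\<^bsub>M\<^esub> \<psi> y"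
    "\<And>e x. \<lbrakk>e \<in> mod_hom R M M; x \<in> carrier M\<rbrakk> \<Longrightarrow> \<psi> (e x) = e (\<psi> x)"
    by (auto simp: mod_hom_def[of "endo_ring R M"] PiE_def)
  have "\<psi> (e x) = e (\<psi> x)" if "linear_map R M M e" "x \<in> carrier M" for e x
    using \<psi>(4)[OF restrict_mod_hom[OF M that(1)] that(2)] that(2) \<psi>(1) by simp
  then show ?r using \<psi> by (simp add: bicommutant_def)
next
  assume ?r
  then show ?l
    using mod_hom_linear[where R = R and M = M and N = M]
    by (auto simp: bicommutant_def mod_hom_def[of "endo_ring R M"] PiE_def)
qed

text \<open>The first conjunct is faithfulness, the second the double centralizer property; they
  express injectivity and surjectivity of the natural map.\<close>

lemma faithfully_balanced_iff:
  assumes M: "left_module R M"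
  shows "faithfully_balanced R M \<longleftrightarrow>
    (\<forall>r\<in>carrier R. \<forall>s\<in>carrier R. (\<forall>x\<in>carrier M. r \<odot>\<^bsub>M\<^esub> x = s \<odot>\<^bsub>M\<^esub> x) \<longrightarrow> r = s) \<and>
    (\<forall>\<psi>\<in>bicommutant R M. \<exists>r\<in>carrier R. \<forall>x\<in>carrier M. \<psi> x = r \<odot>\<^bsub>M\<^esub> x)"
proof -
  interpret M: left_module R M by fact
  let ?m = "\<lambda>r. \<lambda>x\<in>carrier M. r \<odot>\<^bsub>M\<^esub> x"
  let ?B = "mod_hom (endo_ring R M) (endo_module M) (endo_module M)"
  have B: "?B = {\<psi>. \<psi> \<in> bicommutant R M \<and> \<psi> \<in> extensional (carrier M)}"
    using endo_hom_iff[OF M] by blast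
  have m: "?m r \<in> ?B" if "r \<in> carrier R" for r
    unfolding B bicommutant_def
    using that by (auto simp: M.smult_r_distr linear_map_closed linear_map_smult)
  have eq: "?m r = \<psi> \<longleftrightarrow> (\<forall>x\<in>carrier M. \<psi> x = r \<odot>\<^bsub>M\<^esub> x)" if "\<psi> \<in> extensional (carrier M)" for r \<psi>
  proof
    assume "?m r = \<psi>"
    then show "\<forall>x\<in>carrier M. \<psi> x = r \<odot>\<^bsub>M\<^esub> x" by auto
  next
    assume "\<forall>x\<in>carrier M. \<psi> x = r \<odot>\<^bsub>M\<^esub> x"
    then show "?m r = \<psi>" using that by (intro extensionalityI[of _ "carrier M"]) auto
  qed
  have inj: "inj_on ?m (carrier R) \<longleftrightarrow>
    (\<forall>r\<in>carrier R. \<forall>s\<in>carrier R. (\<forall>x\<in>carrier M. r \<odot>\<^bsub>M\<^esub> x = s \<odot>\<^bsub>M\<^esub> x) \<longrightarrow> r = s)"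
    unfolding inj_on_def using eq[OF restrict_extensional] by auto
  have "?m ` carrier R = ?B \<longleftrightarrow>
    (\<forall>\<psi>\<in>bicommutant R M. \<exists>r\<in>carrier R. \<forall>x\<in>carrier M. \<psi> x = r \<odot>\<^bsub>M\<^esub> x)" (is "?l \<longleftrightarrow> ?r")
  proof
    assume l: ?l
    show ?r
    proof
      fix \<psi> assume \<psi>: "\<psi> \<in> bicommutant R M"
      have "linear_map R M M e \<Longrightarrow> x \<in> carrier M \<Longrightarrow> e x \<in> carrier M" for e x
        by (rule linear_map_closed)
      then have "restrict \<psi> (carrier M) \<in> bicommutant R M" using \<psi> by (simp add: bicommutant_def)
      then have "restrict \<psi> (carrier M) \<in> ?B" unfolding B by simp
      then have "restrict \<psi> (carrier M) \<in> ?m ` carrier R" using l by simp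
      then obtain r where r: "restrict \<psi> (carrier M) = ?m r" "r \<in> carrier R" by (rule imageE)
      have "\<psi> x = r \<odot>\<^bsub>M\<^esub> x" if "x \<in> carrier M" for x using fun_cong[OF r(1), of x] that by simp
      then show "\<exists>r\<in>carrier R. \<forall>x\<in>carrier M. \<psi> x = r \<odot>\<^bsub>M\<^esub> x" using r(2) by blast
    qed
  next
    assume r: ?r
    have "\<psi> \<in> ?m ` carrier R" if "\<psi> \<in> ?B" for \<psi>
    proof -
      have \<psi>: "\<psi> \<in> bicommutant R M" "\<psi> \<in> extensional (carrier M)" using that B by auto
      then obtain c where "c \<in> carrier R" "\<forall>x\<in>carrier M. \<psi> x = c \<odot>\<^bsub>M\<^esub> x" using r by blast
      then show ?thesis using eq[OF \<psi>(2)] by (metis image_eqI)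
    qed
    then show ?l using m by blast
  qed
  then show ?thesis unfolding faithfully_balanced_def bij_betw_def inj by blast
qed

text \<open>A map from a power of M to M is a sum of endomorphisms applied to the entries, and the
  additive map \<open>\<psi>\<close> commutes with each of them. In this way \<open>\<psi>\<close>
  acts on modules in add(M) and is natural there.\<close>

lemma bicommutant_power:
  assumes M: "left_module R M" and \<psi>: "\<psi> \<in> bicommutant R M"
    and h: "linear_map R (power_module M n) M h" and u: "u \<in> carrier (power_module M n)"
  shows "\<psi> (h u) = h (\<lambda>i\<in>{..<n}. \<psi> (u i))"
proof -
  interpret M: left_module R M by fact
  note \<psi>D = bicommutantD[OF \<psi>]
  have \<psi>0: "\<psi> \<zero>\<^bsub>M\<^esub> = \<zero>\<^bsub>M\<^esub>"
    using \<psi>D(3)[OF linear_map_const_zero[OF M], of "\<zero>\<^bsub>M\<^esub>"] by simp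
  have sum: "\<psi> (\<Oplus>\<^bsub>M\<^esub>i\<in>I. x i) = (\<Oplus>\<^bsub>M\<^esub>i\<in>I. \<psi> (x i))" if "finite I" "\<And>i. i \<in> I \<Longrightarrow> x i \<in> carrier M" for I x
    using that
  proof (induction I rule: finite_induct)
    case (insert i I)
    then show ?case by (simp add: Pi_def \<psi>D(1,2))
  qed (simp add: \<psi>0)
  have u': "u \<in> {..<n} \<rightarrow>\<^sub>E carrier M" using u by simp
  have ui: "u i \<in> carrier M" if "i < n" for i by (rule PiE_nth[OF u' that])
  have e: "linear_map R M M (\<lambda>x. h (power_incl M n i x))" for i
    by (rule linear_map_comp[OF linear_map_power_incl[OF M] h])
  note ec = linear_map_closed[OF e]
  have \<psi>u: "(\<lambda>i\<in>{..<n}. \<psi> (u i)) \<in> {..<n} \<rightarrow>\<^sub>E carrier M" using \<psi>D(1)[OF ui] by simp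
  have "\<psi> (h u) = \<psi> (\<Oplus>\<^bsub>M\<^esub>i\<in>{..<n}. h (power_incl M n i (u i)))"
    using linear_map_power_eq[OF M M h u'] by simp
  also have "\<dots> = (\<Oplus>\<^bsub>M\<^esub>i\<in>{..<n}. \<psi> (h (power_incl M n i (u i))))"
    using ec[OF ui] by (intro sum) auto
  also have "\<dots> = (\<Oplus>\<^bsub>M\<^esub>i\<in>{..<n}. h (power_incl M n i ((\<lambda>i\<in>{..<n}. \<psi> (u i)) i)))"
    using \<psi>D(3)[OF e ui] ec[OF \<psi>D(1)[OF ui]] by (intro M.M.finsum_cong') auto
  also have "\<dots> = h (\<lambda>i\<in>{..<n}. \<psi> (u i))"
    using linear_map_power_eq[OF M M h \<psi>u] by simp
  finally show ?thesis .
qed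

lemma tilting_faithfully_balanced:
  assumes tilt: "classical_tilting R (T :: ('a, 'm) module)"
  shows "faithfully_balanced R T"
proof -
  note T = classical_tiltingD(1)[OF tilt] and ext = classical_tiltingD(4)[OF tilt]
  interpret T: left_module R T by (rule T)
  have R: "ring R" by (rule T.R.ring_axioms)
  interpret R: ring R by (rule R)
  have reg: "left_module R (regular_module R)" by (rule regular_left_module[OF R])
  obtain T0 T1 :: "('a, nat \<Rightarrow> 'm) module" and f' g' where
    add: "T0 \<in> add_subcat R T" "T1 \<in> add_subcat R T" and ex: "short_exact R (regular_module R) f' T0 g' T1"
    using tilt unfolding classical_tilting_def by metis
  have T0: "left_module R T0" and T1: "left_module R T1" using add by (simp_all add: add_subcat_def)
  define f g where "f = f'" and "g = g'"
  have f: "linear_map R (regular_module R) T0 f" "inj_on f (carrier R)" "f ` carrier R = a_kernel T0 T1 g"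
    and g: "linear_map R T0 T1 g" "g ` carrier T0 = carrier T1"
    using ex by (simp_all add: short_exact_def mod_hom_linear f_def g_def)
  have feq: "f r = r \<odot>\<^bsub>T0\<^esub> f \<one>\<^bsub>R\<^esub>" if "r \<in> carrier R" for r by (rule linear_map_regular_eq[OF R f(1) that])
  have f1: "f \<one>\<^bsub>R\<^esub> \<in> carrier T0" using linear_map_closed[OF f(1)] by simp
  have gf1: "g (f \<one>\<^bsub>R\<^esub>) = \<zero>\<^bsub>T1\<^esub>" using f(3) by (auto simp: a_kernel_def')
  obtain n p q where p: "linear_map R (power_module T n) T0 p" and q: "linear_map R T0 (power_module T n) q"
    and pq: "\<And>x. x \<in> carrier T0 \<Longrightarrow> p (q x) = x"
    using retract_of_powerE[OF add_subcat_retract_of_power[OF T add(1)]] by metis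
  note ret1 = add_subcat_retract_of_power[OF T add(2)]
  obtain m p1 q1 where p1: "linear_map R (power_module T m) T1 p1" and q1: "linear_map R T1 (power_module T m) q1"
    and pq1: "\<And>x. x \<in> carrier T1 \<Longrightarrow> p1 (q1 x) = x"
    using retract_of_powerE[OF ret1] by metis
  have Tn: "left_module R (power_module T n)" and Tm: "left_module R (power_module T m)"
    by (rule power_left_module[OF T])+
  define e where "e = q (f \<one>\<^bsub>R\<^esub>)"
  have e: "e \<in> carrier (power_module T n)" "p e = f \<one>\<^bsub>R\<^esub>"
    using linear_map_closed[OF q f1] pq[OF f1] by (simp_all add: e_def del: power_module_carrier)
  have e': "e \<in> {..<n} \<rightarrow>\<^sub>E carrier T" using e(1) by simp
  show ?thesis unfolding faithfully_balanced_iff[OF T]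
  proof (intro conjI ballI impI)
    fix r s assume rs: "r \<in> carrier R" "s \<in> carrier R" "\<forall>x\<in>carrier T. r \<odot>\<^bsub>T\<^esub> x = s \<odot>\<^bsub>T\<^esub> x"
    have "r \<odot>\<^bsub>power_module T n\<^esub> e = s \<odot>\<^bsub>power_module T n\<^esub> e"
      using rs(3) PiE_nth[OF e'] by (simp cong: restrict_cong)
    then have "r \<odot>\<^bsub>T0\<^esub> f \<one>\<^bsub>R\<^esub> = s \<odot>\<^bsub>T0\<^esub> f \<one>\<^bsub>R\<^esub>"
      using linear_map_smult[OF p rs(1) e(1)] linear_map_smult[OF p rs(2) e(1)] e(2) by simp
    then have "f r = f s" using feq[OF rs(1)] feq[OF rs(2)] by metis
    then show "r = s" by (rule inj_onD[OF f(2) _ rs(1,2)])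
  next
    fix \<psi> assume \<psi>: "\<psi> \<in> bicommutant R T"
    let ?\<psi>e = "\<lambda>i\<in>{..<n}. \<psi> (e i)"
    have \<psi>e: "?\<psi>e \<in> carrier (power_module T n)" using bicommutantD(1)[OF \<psi> PiE_nth[OF e']] by simp
    \<comment> \<open>The effect of \<open>\<psi>\<close> on the image of 1 in T0, computed through
      the retraction of a power of T onto T0.\<close>
    define y where "y = p ?\<psi>e"
    have y: "y \<in> carrier T0" unfolding y_def by (rule linear_map_closed[OF p \<psi>e])
    have \<psi>0: "\<psi> \<zero>\<^bsub>T\<^esub> = \<zero>\<^bsub>T\<^esub>"
      using bicommutantD(3)[OF \<psi> linear_map_const_zero[OF T], of "\<zero>\<^bsub>T\<^esub>"] by simp
    \<comment> \<open>Each coordinate of \<open>q1 \<circ> g \<circ> p\<close> is a map from a power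
      of T to T, so \<open>\<psi>\<close> passes through it and is applied to its value at
      \<open>e\<close>, which is zero.\<close>
    have "q1 (g y) i = \<zero>\<^bsub>T\<^esub>" if i: "i < m" for i
    proof -
      have "linear_map R (power_module T n) T (\<lambda>u. q1 (g (p u)) i)"
        by (rule linear_map_comp[OF linear_map_comp[OF linear_map_comp[OF p g(1)] q1] linear_map_nth[OF i]])
      from bicommutant_power[OF T \<psi> this e(1)] have "q1 (g y) i = \<psi> (q1 (g (p e)) i)" by (simp add: y_def)
      also have "\<dots> = \<zero>\<^bsub>T\<^esub>" using linear_map_zero[OF T1 Tm q1] i by (simp add: e(2) gf1 \<psi>0)
      finally show ?thesis .
    qed
    moreover have gy: "g y \<in> carrier T1" by (rule linear_map_closed[OF g(1) y])
    ultimately have "q1 (g y) = \<zero>\<^bsub>power_module T m\<^esub>"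
      using linear_map_closed[OF q1 gy] by (intro PiE_eqI[of _ m "carrier T" _ "carrier T"]) auto
    then have "g y = \<zero>\<^bsub>T1\<^esub>" using pq1[OF gy] linear_map_zero[OF Tm T1 p1] by simp
    then have "y \<in> f ` carrier R" using y f(3) by (simp add: a_kernel_def')
    then obtain r where r: "r \<in> carrier R" "y = f r" by blast
    have "\<psi> t = r \<odot>\<^bsub>T\<^esub> t" if t: "t \<in> carrier T" for t
    proof -
      let ?K = "sub_module T0 (a_kernel T0 T1 g)"
      have fK: "linear_map R (regular_module R) ?K f"
        by (rule linear_map_sub_cod[OF f(1)]) (use f(3) in auto)
      have bij: "bij_betw f (carrier (regular_module R)) (carrier ?K)" using f(2,3) by (simp add: bij_betw_def)
      \<comment> \<open>The map that sends \<open>s\<close> to \<open>s t\<close>, read on the image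
        of R in T0. Since Ext of T1 by T vanishes, it extends to a map \<open>h\<close> on T0. The
        value of \<open>h\<close> at \<open>y = f r\<close> is \<open>r t\<close>, and it is also
        \<open>\<psi> t\<close> because \<open>\<psi>\<close> commutes with
        \<open>h \<circ> p\<close>.\<close>
      let ?u = "\<lambda>z. inv_into (carrier (regular_module R)) f z \<odot>\<^bsub>T\<^esub> t"
      have u: "linear_map R ?K T ?u"
        by (rule linear_map_comp[OF linear_map_inv[OF reg fK bij] linear_map_regular[OF T t]])
      obtain h where h: "linear_map R T0 T h" "\<And>x. x \<in> a_kernel T0 T1 g \<Longrightarrow> h x = ?u x"
        using ext_zero_extend[OF T T0 T1 T ext ret1 g u] by metis
      have hf: "h (f s) = s \<odot>\<^bsub>T\<^esub> t" if "s \<in> carrier R" for s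
        using h(2)[of "f s"] f(2,3) that by auto
      have "r \<odot>\<^bsub>T\<^esub> t = h y" using hf r by simp
      also have "\<dots> = \<psi> (h (p e))"
        unfolding y_def by (rule bicommutant_power[OF T \<psi> linear_map_comp[OF p h(1)] e(1), symmetric])
      also have "\<dots> = \<psi> t" using hf[of "\<one>\<^bsub>R\<^esub>"] t by (simp add: e(2))
      finally show ?thesis by simp
    qed
    then show "\<exists>r\<in>carrier R. \<forall>x\<in>carrier T. \<psi> x = r \<odot>\<^bsub>T\<^esub> x" using r(1) by blast
  qed
qed

text \<open>The last coordinate maps \<open>L\<close> onto a left ideal, which is projective, so it splits off.\<close>

lemma hereditary_lift:
  assumes R: "ring R" and "hereditary R" and "submodule L R (power_module (regular_module R) n)"
    and A: "left_module R A" and X: "left_module R X" and g: "linear_map R A X g"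
    and h: "linear_map R (sub_module (power_module (regular_module R) n) L) X h" "h ` L \<subseteq> g ` carrier A"
  shows "\<exists>l. linear_map R (sub_module (power_module (regular_module R) n) L) A l \<and> (\<forall>x\<in>L. g (l x) = h x)"
  using assms(3) h
proof (induction n arbitrary: L h)
  case 0
  let ?P = "power_module (regular_module R) 0"
  have P: "left_module R ?P" by (rule power_left_module[OF regular_left_module[OF R]])
  have L: "left_module R (sub_module ?P L)" by (rule submodule_left_module[OF P 0(1)])
  have "x = \<zero>\<^bsub>?P\<^esub>" if "x \<in> L" for x
    using submodule_carrier[OF 0(1) that] by (auto simp: restrict_def)
  then have "h x = \<zero>\<^bsub>X\<^esub>" if "x \<in> L" for x
    using linear_map_zero[OF L X 0(2)] that by simp
  then show ?case using linear_map_const_zero[OF A] linear_map_zero[OF A X g] by (intro exI[of _ "\<lambda>x. \<zero>\<^bsub>A\<^esub>"]) auto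
next
  case (Suc n)
  let ?\<Lambda> = "regular_module R"
  define P Q where "P = power_module ?\<Lambda> (Suc n)" and "Q = power_module ?\<Lambda> n"
  note L = Suc.prems(1)[folded P_def] and h = Suc.prems(2)[folded P_def] and hL = Suc.prems(3)
  have reg: "left_module R ?\<Lambda>" by (rule regular_left_module[OF R])
  interpret reg: left_module R ?\<Lambda> by (rule reg)
  interpret X: left_module R X by (rule X)
  interpret A: left_module R A by (rule A)
  have P: "left_module R P" and Q: "left_module R Q" unfolding P_def Q_def by (rule power_left_module[OF reg])+
  interpret P: left_module R P by (rule P)
  have Lm: "left_module R (sub_module P L)" by (rule submodule_left_module[OF P L])
  define pr where "pr u = u n" for u :: "nat \<Rightarrow> 'a"
  have pr: "linear_map R P ?\<Lambda> pr" unfolding P_def pr_def[abs_def] by (rule linear_map_nth) simp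
  \<comment> \<open>A left ideal, hence projective, so the projection of L onto it has a section
    \<open>\<sigma>\<close>. Then L is the sum of the image of \<open>\<sigma>\<close> and of its
    elements with last coordinate zero.\<close>
  define I where "I = pr ` L"
  have I: "submodule I R ?\<Lambda>" unfolding I_def by (rule linear_map_image[OF P reg pr L])
  let ?I = "sub_module ?\<Lambda> I"
  have Im: "left_module R ?I" by (rule submodule_left_module[OF reg I])
  have proj: "fg_projective R ?I" using \<open>hereditary R\<close> I by (simp add: hereditary_def)
  have prI: "linear_map R (sub_module P L) ?I pr"
    by (rule linear_map_sub_cod[OF linear_map_sub_dom[OF L pr]]) (simp add: I_def)
  obtain \<sigma> where \<sigma>: "linear_map R ?I (sub_module P L) \<sigma>" "\<And>x. x \<in> carrier ?I \<Longrightarrow> pr (\<sigma> x) = x"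
    by (rule fg_projective_lift[OF R Im proj Lm Im prI linear_map_id]) (simp add: I_def, rule that, assumption+)
  have \<sigma>L: "\<sigma> x \<in> L" if "x \<in> I" for x using linear_map_closed[OF \<sigma>(1)] that by simp
  define ex where "ex u = (\<lambda>i\<in>{..<Suc n}. if i < n then u i else \<zero>\<^bsub>R\<^esub>)" for u
  have "linear_map R Q ?\<Lambda> (\<lambda>u. if i < n then u i else \<zero>\<^bsub>R\<^esub>)" for i
    using linear_map_nth[of i n R ?\<Lambda>] linear_map_const_zero[OF reg, of Q] by (cases "i < n") (simp_all add: Q_def)
  then have ex: "linear_map R Q P ex" unfolding ex_def[abs_def] P_def by (rule linear_map_tuple)
  define re where "re u = (\<lambda>i\<in>{..<n}. u i)" for u :: "nat \<Rightarrow> 'a"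
  have re: "linear_map R P Q re" unfolding re_def[abs_def] P_def Q_def
    by (rule linear_map_tuple[OF linear_map_nth]) simp
  have exre: "ex (re u) = u" if "u \<in> carrier P" "pr u = \<zero>\<^bsub>R\<^esub>" for u
  proof (rule extensionalityI[of _ "{..<Suc n}"])
    show "u \<in> extensional {..<Suc n}" using that(1) by (simp add: P_def PiE_def)
    fix i assume "i \<in> {..<Suc n}"
    then show "ex (re u) i = u i" using that(2) by (cases "i = n") (auto simp: ex_def re_def pr_def)
  qed (simp add: ex_def)
  \<comment> \<open>The elements of L with last coordinate zero, seen in the shorter power to which
    the induction hypothesis applies.\<close>
  define L' where "L' = {u \<in> carrier Q. ex u \<in> L}"
  have L': "submodule L' R Q" unfolding L'_def by (rule linear_map_vimage[OF Q P ex L])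
  have exL: "linear_map R (sub_module Q L') (sub_module P L) ex"
    by (rule linear_map_sub_cod[OF linear_map_sub_dom[OF L' ex]]) (simp add: L'_def)
  have "\<exists>l. linear_map R (sub_module Q L') A l \<and> (\<forall>x\<in>L'. g (l x) = h (ex x))"
    by (rule Suc.IH[folded Q_def, OF L' linear_map_comp[OF exL h]]) (use hL L'_def in blast)
  then obtain l' where l': "linear_map R (sub_module Q L') A l'" "\<And>x. x \<in> L' \<Longrightarrow> g (l' x) = h (ex x)" by blast
  have h\<sigma>: "linear_map R ?I X (\<lambda>x. h (\<sigma> x))" by (rule linear_map_comp[OF \<sigma>(1) h])
  have "(\<lambda>x. h (\<sigma> x)) ` carrier ?I \<subseteq> g ` carrier A" using \<sigma>L hL by auto
  then obtain l'' where l'': "linear_map R ?I A l''" "\<And>x. x \<in> carrier ?I \<Longrightarrow> g (l'' x) = h (\<sigma> x)"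
    using fg_projective_lift[OF R Im proj A X g h\<sigma>] by metis
  \<comment> \<open>The component of \<open>x\<close> with last coordinate zero. The lift of
    \<open>x\<close> is the lift of \<open>pr x\<close> through the projective ideal plus the lift
    of \<open>d x\<close> from the induction hypothesis.\<close>
  define d where "d x = x \<ominus>\<^bsub>P\<^esub> \<sigma> (pr x)" for x
  have d: "linear_map R (sub_module P L) P d"
    unfolding d_def[abs_def]
    by (rule linear_map_minus[OF Lm P linear_map_incl[OF L]
          linear_map_sub_codD[OF L linear_map_comp[OF prI \<sigma>(1)]]])
  have prxI: "pr x \<in> I" if "x \<in> L" for x using that by (simp add: I_def)
  have dL: "d x \<in> L" and prd: "pr (d x) = \<zero>\<^bsub>R\<^esub>" if x: "x \<in> L" for x
  proof -
    note c = submodule_carrier[OF L x] submodule_carrier[OF L \<sigma>L[OF prxI[OF x]]]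
    show "d x \<in> L" unfolding d_def by (rule submodule_diff[OF L x \<sigma>L[OF prxI[OF x]]])
    have "pr (d x) = pr x \<ominus>\<^bsub>?\<Lambda>\<^esub> pr (\<sigma> (pr x))"
      unfolding d_def by (rule linear_map_diff[OF P reg pr c])
    also have "\<dots> = \<zero>\<^bsub>?\<Lambda>\<^esub>"
      using \<sigma>(2)[of "pr x"] prxI[OF x] linear_map_closed[OF pr c(1)] by (simp add: reg.diff_eq_zero_iff del: regular_module_simps)
    finally show "pr (d x) = \<zero>\<^bsub>R\<^esub>" by simp
  qed
  have exd: "ex (re (d x)) = d x" if "x \<in> L" for x
    using exre[OF submodule_carrier[OF L dL[OF that]] prd[OF that]] .
  have reL': "re (d x) \<in> L'" if x: "x \<in> L" for x
    using exd[OF x] dL[OF x] linear_map_closed[OF re submodule_carrier[OF L dL[OF x]]] by (simp add: L'_def)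
  have red: "linear_map R (sub_module P L) (sub_module Q L') (\<lambda>x. re (d x))"
    by (rule linear_map_sub_cod[OF linear_map_comp[OF d re]]) (simp add: reL')
  let ?l = "\<lambda>x. l'' (pr x) \<oplus>\<^bsub>A\<^esub> l' (re (d x))"
  have "linear_map R (sub_module P L) A ?l"
    by (rule linear_map_plus[OF A linear_map_comp[OF prI l''(1)] linear_map_comp[OF red l'(1)]])
  moreover have "g (?l x) = h x" if x: "x \<in> L" for x
  proof -
    have "l'' (pr x) \<in> carrier A" "l' (re (d x)) \<in> carrier A"
      using linear_map_closed[OF l''(1)] linear_map_closed[OF l'(1)] prxI[OF x] reL'[OF x] by simp_all
    then have "g (?l x) = h (\<sigma> (pr x)) \<oplus>\<^bsub>X\<^esub> h (d x)"
      using linear_map_add[OF g] l''(2) l'(2)[OF reL'[OF x]] prxI[OF x] exd[OF x] by simp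
    also have "\<dots> = h (\<sigma> (pr x) \<oplus>\<^bsub>P\<^esub> d x)"
      using linear_map_add[OF h, of "\<sigma> (pr x)" "d x"] \<sigma>L[OF prxI[OF x]] dL[OF x] by simp
    also have "\<sigma> (pr x) \<oplus>\<^bsub>P\<^esub> d x = x"
      unfolding d_def using submodule_carrier[OF L] x \<sigma>L[OF prxI[OF x]] by (simp add: P.add_diff_eq)
    finally show ?thesis .
  qed
  ultimately show ?case unfolding P_def by blast
qed

section \<open>Minimality over hereditary algebras\<close>

lemma submodule_finsum:
  assumes "left_module R M" "submodule H R M" "finite I" "\<And>i. i \<in> I \<Longrightarrow> f i \<in> H"
  shows "(\<Oplus>\<^bsub>M\<^esub>i\<in>I. f i) \<in> H"
proof -
  interpret S: left_module R "sub_module M H" by (rule submodule_left_module[OF assms(1,2)])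
  have "(\<Oplus>\<^bsub>sub_module M H\<^esub>i\<in>I. f i) \<in> carrier (sub_module M H)"
    using assms(4) by (intro S.M.finsum_closed) auto
  then show ?thesis using sub_module_finsum[OF assms] by simp
qed

lemma finitely_generated_power:
  assumes M: "left_module R M" and fg: "finitely_generated R M"
  shows "finitely_generated R (power_module M n)"
proof -
  obtain G where G: "finite G" "G \<subseteq> carrier M" "\<And>H. submodule H R M \<and> G \<subseteq> H \<Longrightarrow> H = carrier M"
    using fg unfolding finitely_generated_def by blast
  let ?P = "power_module M n" and ?G = "\<Union>i\<in>{..<n}. power_incl M n i ` G"
  have P: "left_module R ?P" by (rule power_left_module[OF M])
  note inc = linear_map_power_incl[OF M, of n]
  have "H = carrier ?P" if H: "submodule H R ?P" "?G \<subseteq> H" for H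
  proof (rule antisym[OF submodule_subset[OF H(1)] subsetI])
    fix u assume "u \<in> carrier ?P"
    then have u: "u \<in> {..<n} \<rightarrow>\<^sub>E carrier M" by simp
    have "power_incl M n i (u i) \<in> H" if i: "i < n" for i
    proof -
      have "submodule {x \<in> carrier M. power_incl M n i x \<in> H} R M"
        by (rule linear_map_vimage[OF M P inc H(1)])
      moreover have "G \<subseteq> {x \<in> carrier M. power_incl M n i x \<in> H}" using G(2) H(2) i by blast
      ultimately have "{x \<in> carrier M. power_incl M n i x \<in> H} = carrier M" using G(3) by blast
      then show ?thesis using PiE_nth[OF u i] by blast
    qed
    then have "(\<Oplus>\<^bsub>?P\<^esub>i\<in>{..<n}. power_incl M n i (u i)) \<in> H"
      by (intro submodule_finsum[OF P H(1)]) auto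
    then show "u \<in> H" using power_module_decomp[OF M u] by simp
  qed
  moreover have "finite ?G" using G(1) by simp
  moreover have "?G \<subseteq> carrier ?P" using linear_map_closed[OF inc] G(2) by blast
  ultimately show ?thesis unfolding finitely_generated_def by blast
qed

text \<open>Hom groups are artinian over k, so their submodules are finitely generated. Generation
  is tested by submodules of the whole Hom group: a property holds on X once the maps having it form
  a k-submodule containing the \<open>h j\<close>, and no linear combinations are written
  down.\<close>

lemma hom_submodule_generators:
  assumes alg: "artin_algebra k \<phi> R" and M: "left_module R M" and N: "left_module R N"
    and fg: "finitely_generated R M" and art: "artinian_module k (restrict_scalars \<phi> N)"
    and X: "submodule X k (hom_module \<phi> R M N)"
  obtains s :: nat and h where "\<And>j. j < s \<Longrightarrow> h j \<in> X"
    "\<And>H. \<lbrakk>submodule H k (hom_module \<phi> R M N); \<And>j. j < s \<Longrightarrow> h j \<in> H\<rbrakk> \<Longrightarrow> X \<subseteq> H"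
proof -
  let ?H = "hom_module \<phi> R M N"
  have Hm: "left_module k ?H" by (rule hom_module_left_module[OF alg M N])
  have "finitely_generated k (sub_module ?H X)"
    by (rule artinian_finitely_generated[OF artin_algebraD(1)[OF alg] submodule_left_module[OF Hm X]
          artinian_sub_module[OF Hm X hom_module_artinian[OF alg M N fg art]]])
  then obtain S where S: "finite S" "S \<subseteq> X"
    "\<And>H. submodule H k (sub_module ?H X) \<and> S \<subseteq> H \<Longrightarrow> H = X"
    unfolding finitely_generated_def by auto
  obtain s :: nat and h where h: "S = h ` {j. j < s}"
    using finite_imp_nat_seg_image_inj_on[OF S(1)] by blast
  show thesis
  proof (rule that)
    show "h j \<in> X" if "j < s" for j using that h S(2) by blast
    fix H assume H: "submodule H k ?H" "\<And>j. j < s \<Longrightarrow> h j \<in> H"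
    have "submodule (H \<inter> X) k (sub_module ?H X)"
      using submodule_Int[OF Hm H(1) X] by (simp add: submodule_sub_module_iff[OF Hm X])
    moreover have "S \<subseteq> H \<inter> X" using H(2) h S(2) by blast
    ultimately show "X \<subseteq> H" using S(3) by blast
  qed
qed

text \<open>A faithfully balanced module \<open>N\<close> gives an exact sequence \<open>0 \<rightarrow> R \<rightarrow> N\<^sup>m \<rightarrow> N\<^sup>s\<close>, where \<open>1\<close> is sent
  to a tuple \<open>\<nu>\<close> of generators over \<open>k\<close> and the components of the second map generate the maps \<open>N\<^sup>m \<rightarrow> N\<close>
  that vanish at \<open>\<nu>\<close>.\<close>

lemma faithfully_balanced_copresentation:
  assumes alg: "artin_algebra k \<phi> R" and N: "left_module R N" and fg: "finitely_generated R N"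
    and bal: "faithfully_balanced R N"
  obtains m s \<nu> \<Phi> where "\<nu> \<in> carrier (power_module N m)"
    "linear_map R (power_module N m) (power_module N s) \<Phi>"
    "a_kernel (power_module N m) (power_module N s) \<Phi> = (\<lambda>r. r \<odot>\<^bsub>power_module N m\<^esub> \<nu>) ` carrier R"
    "inj_on (\<lambda>r. r \<odot>\<^bsub>power_module N m\<^esub> \<nu>) (carrier R)"
    "\<And>v. linear_map R (sub_module (power_module N s) (\<Phi> ` carrier (power_module N m))) N v \<Longrightarrow>
       \<exists>w. linear_map R (power_module N s) N w \<and> (\<forall>x\<in>\<Phi> ` carrier (power_module N m). w x = v x)"
proof -
  interpret N: left_module R N by (rule N)
  note algD = artin_algebraD[OF alg]
  have Nk: "left_module k (restrict_scalars \<phi> N)" by (rule restrict_scalars_left_module[OF algD(2,4) N])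
  interpret Nk: left_module k "restrict_scalars \<phi> N" by (rule Nk)
  have art: "artinian_module k (restrict_scalars \<phi> N)" by (rule artin_algebra_artinian[OF alg N fg])
  have "finitely_generated k (restrict_scalars \<phi> N)" by (rule artinian_finitely_generated[OF algD(1) Nk art])
  then obtain S where S: "finite S" "S \<subseteq> carrier N"
    "\<And>H. submodule H k (restrict_scalars \<phi> N) \<and> S \<subseteq> H \<Longrightarrow> H = carrier N"
    unfolding finitely_generated_def by auto
  obtain m :: nat and b where b: "S = b ` {i. i < m}"
    using finite_imp_nat_seg_image_inj_on[OF S(1)] by blast
  define P where "P = power_module N m"
  have P: "left_module R P" unfolding P_def by (rule power_left_module[OF N])
  interpret P: left_module R P by (rule P)
  define \<nu> where "\<nu> = (\<lambda>i\<in>{..<m}. b i)"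
  have \<nu>: "\<nu> \<in> carrier P" using b S(2) by (auto simp: \<nu>_def P_def)
  have nth: "linear_map R P N (\<lambda>u. u i)" if "i < m" for i unfolding P_def by (rule linear_map_nth[OF that])
  \<comment> \<open>The values \<open>h \<nu>\<close> form a k-submodule of N, and the coordinate
    maps show that it contains the generators \<open>b i\<close>.\<close>
  have ex: "\<exists>h. linear_map R P N h \<and> h \<nu> = t" if "t \<in> carrier N" for t
  proof -
    let ?H = "{t \<in> carrier N. \<exists>h. linear_map R P N h \<and> h \<nu> = t}"
    have "submodule ?H k (restrict_scalars \<phi> N)"
    proof (rule Nk.submoduleI)
      show "\<zero>\<^bsub>restrict_scalars \<phi> N\<^esub> \<in> ?H" using linear_map_const_zero[OF N, of P] by auto
      show "x \<oplus>\<^bsub>restrict_scalars \<phi> N\<^esub> y \<in> ?H" if xy: "x \<in> ?H" "y \<in> ?H" for x y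
      proof -
        obtain h h' where h: "linear_map R P N h" "h \<nu> = x" "linear_map R P N h'" "h' \<nu> = y" using xy by blast
        have "x \<oplus>\<^bsub>N\<^esub> y \<in> carrier N" using xy by auto
        moreover have "h \<nu> \<oplus>\<^bsub>N\<^esub> h' \<nu> = x \<oplus>\<^bsub>N\<^esub> y" using h by simp
        ultimately show ?thesis
          using linear_map_plus[OF N h(1,3)] unfolding restrict_scalars_simps by blast
      qed
      show "c \<odot>\<^bsub>restrict_scalars \<phi> N\<^esub> x \<in> ?H" if cx: "c \<in> carrier k" "x \<in> ?H" for c x
      proof -
        obtain h where h: "linear_map R P N h" "h \<nu> = x" using cx by blast
        have c: "\<phi> c \<in> carrier R" by (rule ring_hom_closed[OF algD(4) cx(1)])
        have "\<phi> c \<odot>\<^bsub>N\<^esub> x \<in> carrier N" using cx c by auto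
        moreover have "\<phi> c \<odot>\<^bsub>N\<^esub> h \<nu> = \<phi> c \<odot>\<^bsub>N\<^esub> x" using h by simp
        ultimately show ?thesis
          using linear_map_central_smult[OF alg N h(1) cx(1)] unfolding restrict_scalars_simps by blast
      qed
    qed auto
    moreover have "S \<subseteq> ?H"
    proof
      fix x assume "x \<in> S"
      then obtain i where "i < m" "x = b i" using b by blast
      then show "x \<in> ?H" using nth[of i] \<open>x \<in> S\<close> S(2) by (auto simp: \<nu>_def intro!: exI)
    qed
    ultimately have "?H = carrier N" using S(3) by blast
    then show ?thesis using that by blast
  qed
  have faith: "r = r'" if "r \<in> carrier R" "r' \<in> carrier R" "r \<odot>\<^bsub>P\<^esub> \<nu> = r' \<odot>\<^bsub>P\<^esub> \<nu>" for r r'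
  proof -
    have "r \<odot>\<^bsub>N\<^esub> t = r' \<odot>\<^bsub>N\<^esub> t" if t: "t \<in> carrier N" for t
    proof -
      obtain h where h: "linear_map R P N h" "h \<nu> = t" using ex[OF t] by blast
      show ?thesis
        using linear_map_smult[OF h(1) \<open>r \<in> carrier R\<close> \<nu>] linear_map_smult[OF h(1) \<open>r' \<in> carrier R\<close> \<nu>]
          \<open>r \<odot>\<^bsub>P\<^esub> \<nu> = r' \<odot>\<^bsub>P\<^esub> \<nu>\<close> h(2) by simp
    qed
    then show ?thesis using bal that(1,2) unfolding faithfully_balanced_iff[OF N] by blast
  qed
  let ?HM = "hom_module \<phi> R P N"
  have HM: "left_module k ?HM" by (rule hom_module_left_module[OF alg P N])
  have ev: "linear_map k ?HM (restrict_scalars \<phi> N) (\<lambda>h. h u)" if "u \<in> carrier P" for u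
    using that linear_map_closed[OF mod_hom_linear that] by (intro linear_mapI) auto
  define X where "X = {h \<in> mod_hom R P N. h \<nu> = \<zero>\<^bsub>N\<^esub>}"
  have X: "submodule X k ?HM"
    using linear_map_kernel[OF HM Nk ev[OF \<nu>]] by (simp add: X_def a_kernel_def')
  obtain s :: nat and h where h: "\<And>j. j < s \<Longrightarrow> h j \<in> X"
    "\<And>H. \<lbrakk>submodule H k ?HM; \<And>j. j < s \<Longrightarrow> h j \<in> H\<rbrakk> \<Longrightarrow> X \<subseteq> H"
    using hom_submodule_generators[OF alg P N finitely_generated_power[OF N fg, of m, folded P_def] art X] by metis
  have hl: "linear_map R P N (h j)" if "j < s" for j using h(1)[OF that] by (simp add: X_def mod_hom_linear)
  define Q where "Q = power_module N s"
  have Q: "left_module R Q" unfolding Q_def by (rule power_left_module[OF N])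
  define \<Phi> where "\<Phi> u = (\<lambda>j\<in>{..<s}. h j u)" for u
  have \<Phi>: "linear_map R P Q \<Phi>" unfolding \<Phi>_def[abs_def] Q_def by (rule linear_map_tuple[OF hl])
  \<comment> \<open>\<open>\<Phi> u = \<zero>\<close> says that the generators of X vanish at
    \<open>u\<close>; the maps that vanish at \<open>u\<close> form a k-submodule, so all of X
    does.\<close>
  have hX: "x u = \<zero>\<^bsub>N\<^esub>" if u: "u \<in> carrier P" "\<Phi> u = \<zero>\<^bsub>Q\<^esub>" and x: "x \<in> X" for u x
  proof -
    have "submodule (a_kernel ?HM (restrict_scalars \<phi> N) (\<lambda>h. h u)) k ?HM"
      by (rule linear_map_kernel[OF HM Nk ev[OF u(1)]])
    moreover have "h j \<in> a_kernel ?HM (restrict_scalars \<phi> N) (\<lambda>h. h u)" if "j < s" for j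
      using h(1)[OF that] fun_cong[OF u(2), of j] that by (simp add: a_kernel_def' X_def \<Phi>_def Q_def)
    ultimately have "X \<subseteq> a_kernel ?HM (restrict_scalars \<phi> N) (\<lambda>h. h u)" by (rule h(2))
    then show ?thesis using x by (auto simp: a_kernel_def')
  qed
  have linX: "restrict x (carrier P) \<in> X" if "linear_map R P N x" "x \<nu> = \<zero>\<^bsub>N\<^esub>" for x
    using restrict_mod_hom[OF P that(1)] that(2) \<nu> by (simp add: X_def)
  \<comment> \<open>An element \<open>u\<close> of the kernel defines \<open>\<psi>\<close> by
    sending \<open>h \<nu>\<close> to \<open>h u\<close>. The difference of two maps that agree at
    \<open>\<nu>\<close> lies in X and so vanishes at \<open>u\<close>, which makes
    \<open>\<psi>\<close> well defined. It commutes with endomorphisms, hence is multiplication by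
    some \<open>r\<close>, and the coordinate maps give \<open>u = r \<nu>\<close>.\<close>
  have ker1: "\<exists>r\<in>carrier R. u = r \<odot>\<^bsub>P\<^esub> \<nu>" if u: "u \<in> carrier P" "\<Phi> u = \<zero>\<^bsub>Q\<^esub>" for u
  proof -
    define H where "H t = (SOME h. linear_map R P N h \<and> h \<nu> = t)" for t
    have H: "linear_map R P N (H t)" "H t \<nu> = t" if "t \<in> carrier N" for t
      using someI_ex[OF ex[OF that]] by (simp_all add: H_def)
    define \<psi> where "\<psi> t = H t u" for t
    have \<psi>: "\<psi> t = x u" if t: "t \<in> carrier N" and x: "linear_map R P N x" "x \<nu> = t" for t x
    proof -
      have lin: "linear_map R P N (\<lambda>u. H t u \<ominus>\<^bsub>N\<^esub> x u)" by (rule linear_map_minus[OF P N H(1)[OF t] x(1)])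
      have "H t \<nu> \<ominus>\<^bsub>N\<^esub> x \<nu> = \<zero>\<^bsub>N\<^esub>" using H(2)[OF t] x(2) t by (simp add: N.diff_eq_zero_iff)
      from hX[OF u linX[OF lin this]] have "H t u \<ominus>\<^bsub>N\<^esub> x u = \<zero>\<^bsub>N\<^esub>" using u(1) by simp
      then show ?thesis
        using linear_map_closed[OF H(1)[OF t] u(1)] linear_map_closed[OF x(1) u(1)]
        by (simp add: \<psi>_def N.diff_eq_zero_iff)
    qed
    have "\<psi> \<in> bicommutant R N"
      unfolding bicommutant_def
    proof (intro CollectI conjI ballI allI impI)
      show "\<psi> t \<in> carrier N" if "t \<in> carrier N" for t
        unfolding \<psi>_def by (rule linear_map_closed[OF H(1)[OF that] u(1)])
      show "\<psi> (t \<oplus>\<^bsub>N\<^esub> t') = \<psi> t \<oplus>\<^bsub>N\<^esub> \<psi> t'" if t: "t \<in> carrier N" "t' \<in> carrier N" for t t'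
      proof -
        have "\<psi> (t \<oplus>\<^bsub>N\<^esub> t') = H t u \<oplus>\<^bsub>N\<^esub> H t' u"
          by (rule \<psi>[OF _ linear_map_plus[OF N H(1)[OF t(1)] H(1)[OF t(2)]]]) (simp_all add: H t)
        then show ?thesis by (simp add: \<psi>_def)
      qed
      show "\<psi> (e t) = e (\<psi> t)" if e: "linear_map R N N e" and t: "t \<in> carrier N" for e t
      proof -
        have "\<psi> (e t) = e (H t u)"
          by (rule \<psi>[OF linear_map_closed[OF e t] linear_map_comp[OF H(1)[OF t] e]]) (simp add: H t)
        then show ?thesis by (simp add: \<psi>_def)
      qed
    qed
    then have "\<exists>r\<in>carrier R. \<forall>t\<in>carrier N. \<psi> t = r \<odot>\<^bsub>N\<^esub> t"
      by (rule bal[unfolded faithfully_balanced_iff[OF N], THEN conjunct2, rule_format])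
    then obtain r where r: "r \<in> carrier R" "\<And>t. t \<in> carrier N \<Longrightarrow> \<psi> t = r \<odot>\<^bsub>N\<^esub> t" by blast
    have u': "u \<in> {..<m} \<rightarrow>\<^sub>E carrier N" using u(1) by (simp add: P_def)
    have "u = r \<odot>\<^bsub>P\<^esub> \<nu>"
    proof (rule PiE_eqI[OF u'])
      show "r \<odot>\<^bsub>P\<^esub> \<nu> \<in> {..<m} \<rightarrow>\<^sub>E carrier N" using P.smult_closed[OF r(1) \<nu>] by (simp add: P_def)
      fix i assume i: "i < m"
      have \<nu>i: "\<nu> i \<in> carrier N" by (rule linear_map_closed[OF nth[OF i] \<nu>])
      have "u i = \<psi> (\<nu> i)" by (rule \<psi>[OF \<nu>i nth[OF i] refl, symmetric])
      then show "u i = (r \<odot>\<^bsub>P\<^esub> \<nu>) i" using r(2)[OF \<nu>i] i by (simp add: P_def)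
    qed
    then show ?thesis using r(1) by blast
  qed
  have \<Phi>\<nu>: "\<Phi> \<nu> = \<zero>\<^bsub>Q\<^esub>"
    using h(1) by (auto simp: \<Phi>_def Q_def X_def intro!: restrict_ext)
  show thesis
  proof (rule that[of \<nu> m s \<Phi>, folded P_def Q_def])
    show "\<nu> \<in> carrier P" "linear_map R P Q \<Phi>" by fact+
    show "a_kernel P Q \<Phi> = (\<lambda>r. r \<odot>\<^bsub>P\<^esub> \<nu>) ` carrier R"
    proof (intro equalityI subsetI)
      fix u assume "u \<in> a_kernel P Q \<Phi>"
      then show "u \<in> (\<lambda>r. r \<odot>\<^bsub>P\<^esub> \<nu>) ` carrier R" using ker1[of u] by (auto simp: a_kernel_def')
    next
      interpret Q: left_module R Q by (rule Q)
      fix u assume "u \<in> (\<lambda>r. r \<odot>\<^bsub>P\<^esub> \<nu>) ` carrier R"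
      then show "u \<in> a_kernel P Q \<Phi>"
        using \<nu> \<Phi>\<nu> Q.smult_r_null linear_map_smult[OF \<Phi> _ \<nu>] by (auto simp: a_kernel_def')
    qed
    show "inj_on (\<lambda>r. r \<odot>\<^bsub>P\<^esub> \<nu>) (carrier R)" by (rule inj_onI) (rule faith)
    fix v assume v: "linear_map R (sub_module Q (\<Phi> ` carrier P)) N v"
    have \<Phi>D: "linear_map R P (sub_module Q (\<Phi> ` carrier P)) \<Phi>" by (rule linear_map_sub_cod[OF \<Phi>]) simp
    have v\<Phi>: "linear_map R P N (\<lambda>u. v (\<Phi> u))" by (rule linear_map_comp[OF \<Phi>D v])
    have Dsub: "submodule (\<Phi> ` carrier P) R Q" by (rule linear_map_image[OF P Q \<Phi> P.submodule_self])
    have "v \<zero>\<^bsub>Q\<^esub> = \<zero>\<^bsub>N\<^esub>" using linear_map_zero[OF submodule_left_module[OF Q Dsub] N v] by simp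
    then have vX: "restrict (\<lambda>u. v (\<Phi> u)) (carrier P) \<in> X" using \<Phi>\<nu> by (intro linX[OF v\<Phi>]) simp
    \<comment> \<open>The maps \<open>w \<circ> \<Phi>\<close> with \<open>w\<close> defined on the
      whole power Q. They form a k-submodule containing the generators of X, hence also
      \<open>v \<circ> \<Phi>\<close>, which vanishes at \<open>\<nu>\<close>.\<close>
    define W where "W = {x \<in> mod_hom R P N. \<exists>w. linear_map R Q N w \<and> (\<forall>u\<in>carrier P. x u = w (\<Phi> u))}"
    interpret HM: left_module k ?HM by (rule HM)
    have "submodule W k ?HM"
    proof (rule HM.submoduleI)
      show "W \<subseteq> carrier ?HM" by (auto simp: W_def)
      have "\<zero>\<^bsub>?HM\<^esub> \<in> carrier ?HM" by (rule HM.M.zero_closed)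
      then show "\<zero>\<^bsub>?HM\<^esub> \<in> W" using linear_map_const_zero[OF N, of Q] by (auto simp: W_def intro!: exI[of _ "\<lambda>x. \<zero>\<^bsub>N\<^esub>"])
      fix x assume "x \<in> W"
      then obtain w where x: "x \<in> mod_hom R P N" and w: "linear_map R Q N w" "\<And>u. u \<in> carrier P \<Longrightarrow> x u = w (\<Phi> u)"
        by (auto simp: W_def)
      { fix y assume "y \<in> W"
        then obtain w' where y: "y \<in> mod_hom R P N" and w': "linear_map R Q N w'" "\<And>u. u \<in> carrier P \<Longrightarrow> y u = w' (\<Phi> u)"
          by (auto simp: W_def)
        have "x \<oplus>\<^bsub>?HM\<^esub> y \<in> carrier ?HM" using x y by (intro HM.M.a_closed) auto
        moreover have "(x \<oplus>\<^bsub>?HM\<^esub> y) u = w (\<Phi> u) \<oplus>\<^bsub>N\<^esub> w' (\<Phi> u)" if "u \<in> carrier P" for u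
          using that w(2) w'(2) by simp
        ultimately show "x \<oplus>\<^bsub>?HM\<^esub> y \<in> W"
          using linear_map_plus[OF N w(1) w'(1)] unfolding W_def hom_module_simps(1) by blast }
      fix c assume c: "c \<in> carrier k"
      have "c \<odot>\<^bsub>?HM\<^esub> x \<in> carrier ?HM" using x c by (intro HM.smult_closed) auto
      moreover have "(c \<odot>\<^bsub>?HM\<^esub> x) u = \<phi> c \<odot>\<^bsub>N\<^esub> w (\<Phi> u)" if "u \<in> carrier P" for u
        using that w(2) by simp
      ultimately show "c \<odot>\<^bsub>?HM\<^esub> x \<in> W"
        using linear_map_central_smult[OF alg N w(1) c] unfolding W_def hom_module_simps(1) by blast
    qed
    moreover have "h j \<in> W" if "j < s" for j
    proof -
      have "h j \<in> mod_hom R P N" using h(1)[OF that] by (simp add: X_def)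
      moreover have "h j u = \<Phi> u j" for u using that by (simp add: \<Phi>_def)
      ultimately show ?thesis using linear_map_nth[OF that, of R N] unfolding W_def Q_def by blast
    qed
    ultimately have "X \<subseteq> W" by (rule h(2))
    then have "restrict (\<lambda>u. v (\<Phi> u)) (carrier P) \<in> W" using vX by blast
    then obtain w where w: "linear_map R Q N w" "\<And>u. u \<in> carrier P \<Longrightarrow> restrict (\<lambda>u. v (\<Phi> u)) (carrier P) u = w (\<Phi> u)"
      by (auto simp: W_def)
    then show "\<exists>w. linear_map R Q N w \<and> (\<forall>x\<in>\<Phi> ` carrier P. w x = v x)" by (intro exI[of _ w]) auto
  qed
qed

text \<open>Let \<open>\<alpha>\<close> be a surjection from a free module of finite rank onto Q and
  L the preimage of the image D of \<open>\<Phi>\<close>. By heredity \<open>\<alpha>\<close> on L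
  lifts along \<open>\<Phi>\<close> to a map \<open>w\<close> into P. The hypotheses make Ext of Q/D
  by P vanish, so \<open>w\<close> extends to the free module; \<open>\<Phi>\<close> after the
  extension kills the kernel of \<open>\<alpha>\<close> and descends to a map from Q to D that is
  the identity on D.\<close>

lemma hereditary_image_retract:
  assumes her: "hereditary R" and N: "left_module R N" and P: "left_module R P" and Q: "left_module R Q"
    and fgQ: "finitely_generated R Q" and PN: "retract_of_power R N P" and QN: "retract_of_power R N Q"
    and ext: "ext_zero R N P" and \<Phi>: "linear_map R P Q \<Phi>"
    and extend: "\<And>v. linear_map R (sub_module Q (\<Phi> ` carrier P)) P v \<Longrightarrow>
       \<exists>w. linear_map R Q P w \<and> (\<forall>x\<in>\<Phi> ` carrier P. w x = v x)"
  obtains \<rho> where "linear_map R Q (sub_module Q (\<Phi> ` carrier P)) \<rho>" "\<And>x. x \<in> \<Phi> ` carrier P \<Longrightarrow> \<rho> x = x"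
proof -
  interpret P: left_module R P by (rule P)
  interpret Q: left_module R Q by (rule Q)
  have R: "ring R" by (rule P.R.ring_axioms)
  have reg: "left_module R (regular_module R)" by (rule regular_left_module[OF R])
  let ?D = "\<Phi> ` carrier P"
  have D: "submodule ?D R Q" by (rule linear_map_image[OF P Q \<Phi> P.submodule_self])
  have Dm: "left_module R (sub_module Q ?D)" by (rule submodule_left_module[OF Q D])
  have \<Phi>D: "linear_map R P (sub_module Q ?D) \<Phi>" by (rule linear_map_sub_cod[OF \<Phi>]) simp
  obtain n \<alpha> where \<alpha>: "linear_map R (power_module (regular_module R) n) Q \<alpha>"
    "\<alpha> ` carrier (power_module (regular_module R) n) = carrier Q"
    using finitely_generated_surj[OF Q fgQ] by metis
  define F where "F = power_module (regular_module R) n"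
  note \<alpha> = \<alpha>[folded F_def]
  have F: "left_module R F" unfolding F_def by (rule power_left_module[OF reg])
  define L where "L = {x \<in> carrier F. \<alpha> x \<in> ?D}"
  have L: "submodule L R F" unfolding L_def by (rule linear_map_vimage[OF F Q \<alpha>(1) D])
  have Lm: "left_module R (sub_module F L)" by (rule submodule_left_module[OF F L])
  have \<alpha>L: "linear_map R (sub_module F L) (sub_module Q ?D) \<alpha>"
    by (rule linear_map_sub_cod[OF linear_map_sub_dom[OF L \<alpha>(1)]]) (simp add: L_def)
  have Lc: "x \<in> carrier F" if "x \<in> L" for x using that by (simp add: L_def)
  have \<alpha>D: "\<alpha> x \<in> ?D" if "x \<in> L" for x using that by (simp add: L_def)
  have \<alpha>Ls: "\<exists>x\<in>L. \<alpha> x = d" if d: "d \<in> ?D" for d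
  proof -
    have "d \<in> carrier Q" by (rule submodule_carrier[OF D d])
    then obtain x where "x \<in> carrier F" "d = \<alpha> x" unfolding \<alpha>(2)[symmetric] by (rule imageE)
    then show ?thesis using d by (auto simp: L_def)
  qed
  have "\<alpha> ` L \<subseteq> \<Phi> ` carrier P" using \<alpha>D by blast
  then obtain w where w: "linear_map R (sub_module F L) P w" "\<And>x. x \<in> L \<Longrightarrow> \<Phi> (w x) = \<alpha> x"
    using hereditary_lift[OF R her L[unfolded F_def] P Dm \<Phi>D \<alpha>L[unfolded F_def]] unfolding F_def by blast
  have kerL: "x \<in> L" if "x \<in> carrier F" "\<alpha> x = \<zero>\<^bsub>Q\<^esub>" for x
    using that submodule_zero[OF D] by (simp add: L_def)
  have K: "submodule (a_kernel F Q \<alpha>) R F" by (rule linear_map_kernel[OF F Q \<alpha>(1)])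
  have wK: "linear_map R (sub_module F (a_kernel F Q \<alpha>)) P w"
    by (rule linear_map_comp[OF linear_map_sub_cod[OF linear_map_incl[OF K]] w(1)])
      (use kerL in \<open>auto simp: a_kernel_def'\<close>)
  \<comment> \<open>The extension of \<open>w\<close> is built in two stages: \<open>e1\<close>
    agrees with \<open>w\<close> on the kernel of \<open>\<alpha>\<close>, and the remaining
    difference descends to D, from which it extends to Q by hypothesis.\<close>
  obtain e1 where e1: "linear_map R F P e1" "\<And>x. x \<in> a_kernel F Q \<alpha> \<Longrightarrow> e1 x = w x"
    using ext_zero_extend[OF N F Q P ext QN \<alpha> wK] by metis
  have diff: "linear_map R (sub_module F L) P (\<lambda>x. w x \<ominus>\<^bsub>P\<^esub> e1 x)"
    by (rule linear_map_minus[OF Lm P w(1) linear_map_sub_dom[OF L e1(1)]])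
  have wP: "w x \<in> carrier P" if "x \<in> L" for x using linear_map_closed[OF w(1)] that by simp
  have d0: "w x \<ominus>\<^bsub>P\<^esub> e1 x = \<zero>\<^bsub>P\<^esub>" if x: "x \<in> carrier (sub_module F L)" "\<alpha> x = \<zero>\<^bsub>sub_module Q ?D\<^esub>" for x
  proof -
    have xL: "x \<in> L" using x(1) by simp
    have "x \<in> a_kernel F Q \<alpha>" using x(2) Lc[OF xL] by (simp add: a_kernel_def')
    then show ?thesis using e1(2) wP[OF xL] by (simp add: P.diff_eq_zero_iff)
  qed
  have surj: "\<alpha> ` carrier (sub_module F L) = carrier (sub_module Q ?D)"
    using \<alpha>D \<alpha>Ls by (auto simp: image_iff) (metis imageI)
  obtain v where v: "linear_map R (sub_module Q ?D) P v"
    "\<And>x. x \<in> carrier (sub_module F L) \<Longrightarrow> v (\<alpha> x) = w x \<ominus>\<^bsub>P\<^esub> e1 x"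
    by (rule linear_map_factor[OF Lm Dm P \<alpha>L surj diff d0]) (assumption+, rule that, assumption+)
  obtain e2 where e2: "linear_map R Q P e2" "\<And>x. x \<in> ?D \<Longrightarrow> e2 x = v x" using extend[OF v(1)] by blast
  define e where "e x = e1 x \<oplus>\<^bsub>P\<^esub> e2 (\<alpha> x)" for x
  have e: "linear_map R F P e" unfolding e_def[abs_def]
    by (rule linear_map_plus[OF P e1(1) linear_map_comp[OF \<alpha>(1) e2(1)]])
  have ew: "e x = w x" if x: "x \<in> L" for x
    using e2(2)[OF \<alpha>D[OF x]] v(2)[of x] x wP[OF x] linear_map_closed[OF e1(1) Lc[OF x]]
    by (simp add: e_def P.add_diff_eq)
  have \<Phi>e: "linear_map R F (sub_module Q ?D) (\<lambda>x. \<Phi> (e x))" by (rule linear_map_comp[OF e \<Phi>D])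
  have \<Phi>e0: "\<Phi> (e x) = \<zero>\<^bsub>sub_module Q ?D\<^esub>" if "x \<in> carrier F" "\<alpha> x = \<zero>\<^bsub>Q\<^esub>" for x
    using w(2)[OF kerL[OF that]] ew[OF kerL[OF that]] that(2) by simp
  obtain \<rho> where \<rho>: "linear_map R Q (sub_module Q ?D) \<rho>" "\<And>x. x \<in> carrier F \<Longrightarrow> \<rho> (\<alpha> x) = \<Phi> (e x)"
    by (rule linear_map_factor[OF F Q Dm \<alpha> \<Phi>e \<Phi>e0]) (assumption+, rule that, assumption+)
  have "\<rho> d = d" if d: "d \<in> ?D" for d
  proof -
    obtain x where x: "x \<in> L" "\<alpha> x = d" using \<alpha>Ls[OF d] by blast
    then show ?thesis using \<rho>(2)[OF Lc[OF x(1)]] ew[OF x(1)] w(2)[OF x(1)] by simp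
  qed
  then show thesis using that \<rho>(1) by blast
qed

text \<open>In an exact sequence \<open>0 \<rightarrow> R \<rightarrow> P \<rightarrow> C \<rightarrow> 0\<close> with \<open>Ext\<^sup>1(C,Y) = 0\<close>, every map \<open>R \<rightarrow> Y\<close> extends to
  \<open>P\<close>.\<close>

lemma generated_by_coresolution:
  assumes N: "left_module R N" and C: "left_module R C" and Y: "left_module R Y"
    and ext: "ext_zero R N Y" and CN: "retract_of_power R N C"
    and \<nu>: "\<nu> \<in> carrier (power_module N m)"
    and \<Phi>: "linear_map R (power_module N m) C \<Phi>" "\<Phi> ` carrier (power_module N m) = carrier C"
    and ker: "a_kernel (power_module N m) C \<Phi> = (\<lambda>r. r \<odot>\<^bsub>power_module N m\<^esub> \<nu>) ` carrier R"
    and inj: "inj_on (\<lambda>r. r \<odot>\<^bsub>power_module N m\<^esub> \<nu>) (carrier R)"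
  shows "generated_by R N Y"
  unfolding generated_by_def
proof
  fix y assume y: "y \<in> carrier Y"
  interpret Y: left_module R Y by (rule Y)
  have reg: "left_module R (regular_module R)" by (rule regular_left_module[OF Y.R.ring_axioms])
  define P where "P = power_module N m"
  have P: "left_module R P" unfolding P_def by (rule power_left_module[OF N])
  interpret P: left_module R P by (rule P)
  note \<nu> = \<nu>[folded P_def] and \<Phi> = \<Phi>[folded P_def] and ker = ker[folded P_def] and inj = inj[folded P_def]
  let ?f = "\<lambda>r. r \<odot>\<^bsub>P\<^esub> \<nu>" and ?K = "sub_module P (a_kernel P C \<Phi>)"
  have f: "linear_map R (regular_module R) ?K ?f"
    by (rule linear_map_sub_cod[OF linear_map_regular[OF P \<nu>]]) (simp add: ker)
  have bij: "bij_betw ?f (carrier (regular_module R)) (carrier ?K)" using inj by (simp add: bij_betw_def ker)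
  let ?u = "\<lambda>z. inv_into (carrier (regular_module R)) ?f z \<odot>\<^bsub>Y\<^esub> y"
  have u: "linear_map R ?K Y ?u"
    by (rule linear_map_comp[OF linear_map_inv[OF reg f bij] linear_map_regular[OF Y y]])
  obtain h where h: "linear_map R P Y h" "\<And>x. x \<in> a_kernel P C \<Phi> \<Longrightarrow> h x = ?u x"
    using ext_zero_extend[OF N P C Y ext CN \<Phi> u] by metis
  have "?f \<one>\<^bsub>R\<^esub> \<in> a_kernel P C \<Phi>" unfolding ker by (rule imageI) simp
  then have "h (?f \<one>\<^bsub>R\<^esub>) = ?u (?f \<one>\<^bsub>R\<^esub>)" by (rule h(2))
  also have "\<dots> = y" using inv_into_f_f[OF inj, of "\<one>\<^bsub>R\<^esub>"] y by simp
  finally have "h \<nu> = y" using \<nu> by simp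
  then show "\<exists>n v t. linear_map R (power_module N n) Y v \<and> t \<in> carrier (power_module N n) \<and> v t = y"
    using h(1) \<nu> unfolding P_def by blast
qed

text \<open>N enters as a retract of T instead of a submodule, so the argument does not depend on
  how the summand sits in T.\<close>

lemma faithfully_balanced_retract:
  assumes alg: "artin_algebra k \<phi> R" and her: "hereditary R"
    and T: "left_module R T" and fgT: "finitely_generated R T" and pd: "proj_dim_le_1 R T"
    and extT: "ext_zero R T T"
    and N: "left_module R N" and a: "linear_map R T N a" and b: "linear_map R N T b"
    and ab: "\<And>x. x \<in> carrier N \<Longrightarrow> a (b x) = x" and bal: "faithfully_balanced R N"
  shows "retract_of_power R N T"
proof -
  interpret T: left_module R T by (rule T)
  interpret N: left_module R N by (rule N)
  note algD = artin_algebraD[OF alg]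
  have TN: "retract_of_power R T N" by (rule retract_of_powerI[OF T a b ab])
  have extNT: "ext_zero R N T" by (rule ext_zero_retract[OF T N T extT TN])
  have extNN: "ext_zero R N N" by (rule ext_zero_retract_right[OF N T N extNT TN])
  have extNp: "ext_zero R N (power_module N n)" for n
    by (rule ext_zero_retract_right[OF N N power_left_module[OF N] extNN retract_of_power_power])
  have fgN: "finitely_generated R N"
  proof (rule finitely_generated_image[OF T N a _ fgT])
    show "a ` carrier T = carrier N"
    proof (intro equalityI subsetI)
      fix x assume "x \<in> carrier N"
      then show "x \<in> a ` carrier T" using ab linear_map_closed[OF b] by (metis imageI)
    qed (use linear_map_closed[OF a] in blast)
  qed
  obtain m s \<nu> \<Phi> where \<nu>: "\<nu> \<in> carrier (power_module N m)"
    and \<Phi>: "linear_map R (power_module N m) (power_module N s) \<Phi>"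
    and ker: "a_kernel (power_module N m) (power_module N s) \<Phi> = (\<lambda>r. r \<odot>\<^bsub>power_module N m\<^esub> \<nu>) ` carrier R"
    and inj: "inj_on (\<lambda>r. r \<odot>\<^bsub>power_module N m\<^esub> \<nu>) (carrier R)"
    and extend: "\<And>v. linear_map R (sub_module (power_module N s) (\<Phi> ` carrier (power_module N m))) N v \<Longrightarrow>
       \<exists>w. linear_map R (power_module N s) N w \<and> (\<forall>x\<in>\<Phi> ` carrier (power_module N m). w x = v x)"
    by (rule faithfully_balanced_copresentation[OF alg N fgN bal]) (rule that, assumption+)
  let ?P = "power_module N m" and ?Q = "power_module N s"
  let ?D = "\<Phi> ` carrier ?P"
  have P: "left_module R ?P" and Q: "left_module R ?Q" by (rule power_left_module[OF N])+
  have D: "submodule ?D R ?Q" by (rule linear_map_image[OF P Q \<Phi> left_module.submodule_self[OF P]])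
  have Dm: "left_module R (sub_module ?Q ?D)" by (rule submodule_left_module[OF Q D])
  \<comment> \<open>The extension property is known for maps into N and is carried over to maps into
    a power of N one coordinate at a time.\<close>
  have extP: "\<exists>w. linear_map R ?Q ?P w \<and> (\<forall>x\<in>?D. w x = v x)"
    if v: "linear_map R (sub_module ?Q ?D) ?P v" for v
  proof -
    have "\<exists>w. i < m \<longrightarrow> linear_map R ?Q N w \<and> (\<forall>x\<in>?D. w x = v x i)" for i
      using extend[OF linear_map_comp[OF v linear_map_nth]] by (cases "i < m") auto
    then obtain w where w: "\<And>i. i < m \<Longrightarrow> linear_map R ?Q N (w i)"
      "\<And>i x. \<lbrakk>i < m; x \<in> ?D\<rbrakk> \<Longrightarrow> w i x = v x i" by metis
    have lin: "linear_map R ?Q ?P (\<lambda>x. \<lambda>i\<in>{..<m}. w i x)" by (rule linear_map_tuple[OF w(1)])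
    have "(\<lambda>i\<in>{..<m}. w i x) = v x" if x: "x \<in> ?D" for x
    proof -
      have "v x \<in> carrier ?P" using linear_map_closed[OF v, of x] x by simp
      moreover have "(\<lambda>i\<in>{..<m}. w i x) \<in> carrier ?P"
        by (rule linear_map_closed[OF lin submodule_carrier[OF D x]])
      ultimately show ?thesis
        using w(2)[OF _ x] by (intro PiE_eqI[of _ m "carrier N" _ "carrier N"]) simp_all
    qed
    then show ?thesis using lin by blast
  qed
  obtain \<rho> where \<rho>: "linear_map R ?Q (sub_module ?Q ?D) \<rho>" "\<And>x. x \<in> ?D \<Longrightarrow> \<rho> x = x"
    using hereditary_image_retract[OF her N P Q finitely_generated_power[OF N fgN] retract_of_power_power
        retract_of_power_power extNp \<Phi> extP] by blast
  have DN: "retract_of_power R N (sub_module ?Q ?D)"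
    unfolding retract_of_power_def
    using \<rho> linear_map_incl[OF D] by (intro exI[of _ s] exI[of _ \<rho>] exI[of _ "\<lambda>x. x"]) simp
  have \<Phi>D: "linear_map R ?P (sub_module ?Q ?D) \<Phi>" "\<Phi> ` carrier ?P = carrier (sub_module ?Q ?D)"
    by (rule linear_map_sub_cod[OF \<Phi>]) simp_all
  have kerD: "a_kernel ?P (sub_module ?Q ?D) \<Phi> = (\<lambda>r. r \<odot>\<^bsub>?P\<^esub> \<nu>) ` carrier R"
    using ker by (simp add: a_kernel_def')
  \<comment> \<open>With the retract D as last term the sequence starting at R is short exact, and
    both terms after R lie in add(N). It is used twice: for T, and for the kernel of the
    approximation of T.\<close>
  note gen = generated_by_coresolution[OF N Dm _ _ DN \<nu> \<Phi>D kerD inj]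
  have genT: "generated_by R N T" by (rule gen[OF T extNT])
  let ?HM = "hom_module \<phi> R N T"
  have HM: "left_module k ?HM" by (rule hom_module_left_module[OF alg N T])
  interpret HM: left_module k ?HM by (rule HM)
  obtain l :: nat and g where g: "\<And>j. j < l \<Longrightarrow> g j \<in> carrier ?HM"
    "\<And>H. \<lbrakk>submodule H k ?HM; \<And>j. j < l \<Longrightarrow> g j \<in> H\<rbrakk> \<Longrightarrow> carrier ?HM \<subseteq> H"
    using hom_submodule_generators[OF alg N T fgN artin_algebra_artinian[OF alg T fgT] HM.submodule_self] by metis
  have gl: "linear_map R N T (g j)" if "j < l" for j using g(1)[OF that] by (simp add: mod_hom_linear)
  \<comment> \<open>The right approximation of T: its components generate Hom(N,T) over k, so every
    map from N to T factors through \<open>G\<close>. The set \<open>W\<close> of maps that factor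
    is the k-submodule that proves this.\<close>
  define G where "G u = (\<Oplus>\<^bsub>T\<^esub>j\<in>{..<l}. g j (u j))" for u
  let ?B = "power_module N l"
  have B: "left_module R ?B" by (rule power_left_module[OF N])
  have G: "linear_map R ?B T G" unfolding G_def[abs_def] by (rule linear_map_copair[OF T gl])
  define W where "W = {h \<in> mod_hom R N T. \<exists>w. linear_map R N ?B w \<and> (\<forall>x\<in>carrier N. G (w x) = h x)}"
  have "submodule W k ?HM"
  proof (rule HM.submoduleI)
    show "W \<subseteq> carrier ?HM" by (auto simp: W_def)
    have "\<zero>\<^bsub>?HM\<^esub> \<in> carrier ?HM" by (rule HM.M.zero_closed)
    then show "\<zero>\<^bsub>?HM\<^esub> \<in> W"
      using linear_map_const_zero[OF B, of N] linear_map_zero[OF B T G]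
      unfolding W_def by (intro CollectI conjI exI[of _ "\<lambda>x. \<zero>\<^bsub>?B\<^esub>"]) simp_all
    fix x assume "x \<in> W"
    then obtain w where x: "x \<in> mod_hom R N T" and w: "linear_map R N ?B w" "\<And>u. u \<in> carrier N \<Longrightarrow> G (w u) = x u"
      unfolding W_def by blast
    { fix y assume "y \<in> W"
      then obtain w' where y: "y \<in> mod_hom R N T" and w': "linear_map R N ?B w'" "\<And>u. u \<in> carrier N \<Longrightarrow> G (w' u) = y u"
        unfolding W_def by blast
      have "x \<oplus>\<^bsub>?HM\<^esub> y \<in> carrier ?HM" using x y by (intro HM.M.a_closed) auto
      moreover have "G (w u \<oplus>\<^bsub>?B\<^esub> w' u) = (x \<oplus>\<^bsub>?HM\<^esub> y) u" if "u \<in> carrier N" for u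
        using that w(2) w'(2) linear_map_add[OF G linear_map_closed[OF w(1) that] linear_map_closed[OF w'(1) that]]
        by (simp del: power_module_add)
      ultimately show "x \<oplus>\<^bsub>?HM\<^esub> y \<in> W"
        using linear_map_plus[OF B w(1) w'(1)] unfolding W_def hom_module_simps(1) by blast }
    fix c assume c: "c \<in> carrier k"
    have "c \<odot>\<^bsub>?HM\<^esub> x \<in> carrier ?HM" using x c by (intro HM.smult_closed) auto
    moreover have "G (\<phi> c \<odot>\<^bsub>?B\<^esub> w u) = (c \<odot>\<^bsub>?HM\<^esub> x) u" if "u \<in> carrier N" for u
      using that w(2) linear_map_smult[OF G ring_hom_closed[OF algD(4) c] linear_map_closed[OF w(1) that]]
      by (simp del: power_module_smult)
    ultimately show "c \<odot>\<^bsub>?HM\<^esub> x \<in> W"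
      using linear_map_central_smult[OF alg B w(1) c] unfolding W_def hom_module_simps(1) by blast
  qed
  moreover have "g j \<in> W" if j: "j < l" for j
  proof -
    have "G (power_incl N l j x) = g j x" if "x \<in> carrier N" for x
      unfolding G_def by (rule copair_power_incl[OF T N gl j that])
    then show ?thesis using g(1)[OF j] linear_map_power_incl[OF N] unfolding W_def hom_module_simps(1) by blast
  qed
  ultimately have "carrier ?HM \<subseteq> W" by (rule g(2))
  then have lift: "\<exists>w. linear_map R N ?B w \<and> (\<forall>x\<in>carrier N. G (w x) = h x)" if "linear_map R N T h" for h
    using restrict_mod_hom[OF N that] unfolding W_def hom_module_simps(1) by fastforce
  have Gim: "submodule (G ` carrier ?B) R T" by (rule linear_map_image[OF B T G left_module.submodule_self[OF B]])
  \<comment> \<open>N generates T, and each map from N to T factors through \<open>G\<close>; so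
    every element of T is a sum of elements of the image.\<close>
  have Gs: "G ` carrier ?B = carrier T"
  proof (rule antisym[OF submodule_subset[OF Gim] subsetI])
    fix y assume "y \<in> carrier T"
    then obtain n v t where v: "linear_map R (power_module N n) T v" "t \<in> carrier (power_module N n)" "v t = y"
      using genT unfolding generated_by_def by blast
    have t: "t \<in> {..<n} \<rightarrow>\<^sub>E carrier N" using v(2) by simp
    have "v (power_incl N n i (t i)) \<in> G ` carrier ?B" if i: "i < n" for i
    proof -
      obtain w where w: "linear_map R N ?B w" "\<And>x. x \<in> carrier N \<Longrightarrow> G (w x) = v (power_incl N n i x)"
        using lift[OF linear_map_comp[OF linear_map_power_incl[OF N] v(1)]] by metis
      show ?thesis
        using w(2)[OF PiE_nth[OF t i]] linear_map_closed[OF w(1) PiE_nth[OF t i]] by (metis imageI)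
    qed
    then have "(\<Oplus>\<^bsub>T\<^esub>i\<in>{..<n}. v (power_incl N n i (t i))) \<in> G ` carrier ?B"
      by (intro submodule_finsum[OF T Gim]) auto
    then show "y \<in> G ` carrier ?B" using linear_map_power_eq[OF N T v(1) t] v(3) by simp
  qed
  let ?K = "sub_module ?B (a_kernel ?B T G)"
  have K: "left_module R ?K" by (rule submodule_left_module[OF B linear_map_kernel[OF B T G]])
  \<comment> \<open>The approximation property makes Ext of N by the kernel vanish, so N, and with
    it T, generates the kernel. Then Ext of T by the kernel vanishes as well, and \<open>G\<close>
    splits.\<close>
  have "ext_zero R N ?K" by (rule ext_zero_kernel[OF N B T G lift extNp])
  then have "generated_by R N ?K" by (rule gen[OF K])
  then have "generated_by R T ?K" by (rule generated_by_retract[OF T N a b ab, rotated])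
  then have "ext_zero R T ?K" by (rule ext_zero_generated[OF T K pd extT])
  then obtain \<sigma> where \<sigma>: "linear_map R T ?B \<sigma>" "\<And>x. x \<in> carrier T \<Longrightarrow> G (\<sigma> x) = x"
    using ext_zero_split[OF T B G Gs] by blast
  then show ?thesis unfolding retract_of_power_def using G by blast
qed

theorem theorem1p3:
  fixes k :: "('k, 's) ring_scheme"
    and \<phi> :: "'k \<Rightarrow> 'a"
    and \<Lambda> :: "('a, 'r) ring_scheme"
    and T :: "('a, 'm) module"
  assumes "artin_algebra k \<phi> \<Lambda>"
    and "classical_tilting \<Lambda> T"
    and "basic \<Lambda> T"
  shows "gen1_critical \<Lambda> T \<and> (hereditary \<Lambda> \<longrightarrow> minimal_faithfully_balanced \<Lambda> T)"
proof (intro conjI impI)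
  show "gen1_critical \<Lambda> T" by (rule tilting_gen1_critical[OF assms])
  assume her: "hereditary \<Lambda>"
  note T = classical_tiltingD[OF assms(2)]
  show "minimal_faithfully_balanced \<Lambda> T"
    unfolding minimal_faithfully_balanced_def
  proof (intro conjI allI impI notI)
    show "faithfully_balanced \<Lambda> T" by (rule tilting_faithfully_balanced[OF assms(2)])
    fix N assume N: "proper_direct_summand \<Lambda> N T" and bal: "faithfully_balanced \<Lambda> (sub_module T N)"
    obtain N' where NN': "submodule N \<Lambda> T" "submodule N' \<Lambda> T" "N \<inter> N' = {\<zero>\<^bsub>T\<^esub>}" "N <+>\<^bsub>T\<^esub> N' = carrier T"
      using N unfolding proper_direct_summand_def direct_summand_def by blast
    obtain \<pi> where \<pi>: "linear_map \<Lambda> T (sub_module T N) \<pi>" "\<And>x. x \<in> N \<Longrightarrow> \<pi> x = x"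
      using direct_sum_projection[OF T(1) NN'] by metis
    have "retract_of_power \<Lambda> (sub_module T N) T"
      by (rule faithfully_balanced_retract[OF assms(1) her T submodule_left_module[OF T(1) NN'(1)] \<pi>(1)
            linear_map_incl[OF NN'(1)] _ bal]) (simp add: \<pi>(2))
    then show False using basic_not_retract_of_proper_summand[OF assms(1) T(1,2) assms(3) N] by blast
  qed
qed

end
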